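(* Let $\Lambda$ be a compact invariant set that is sectional hyperbolic for a $C^1$ flow $\phi_t$ on $M$, with all the singularities in $\Lambda$ hyperbolic. Furthermore, assume that $\Lambda$ is Lyapunov stable. Then $h_{top}(\phi_t|_\Lambda)\ge\lambda>0$, where $\lambda$ is the sectional volume expanding rate on $F^{cu}$.
   Context: $M$ is a compact Riemannian manifold. A $C^1$ flow $\phi_t$ is the flow generated by a $C^1$ vector field $X$ on $M$. A singularity is a zero of $X$; it is hyperbolic if the derivative of $X$ there has no eigenvalue with zero real part. The topological entropy $h_{top}$ of a flow on an invariant set is the topological entropy of its time-one map on that set. Dominated splitting: a splitting $T_\Lambda M=E\oplus F$ over a compact invariant set $\Lambda$ is dominated if it is continuous, invariant under $D\phi_t$, and there are $C>0$ and $0<\lambda'<1$ such that $\|D\phi_t(x)u\|\le C(\lambda')^t\|D\phi_t(x)v\|$ for all $x\in\Lambda$, all unit vectors $u\in E_x$, $v\in F_x$ and all $t>0$. Sectional hyperbolic: a compact invariant set $\Lambda$ is sectional hyperbolic if it admits a dominated splitting $E^s\oplus F^{cu}$ such that $E^s$ is uniformly contracting under $D\phi_t$, and $F^{cu}$ is sectional-expanding: there are constants $C,\lambda>0$ such that for every $x\in\Lambda$ and every subspace $V_x\subset F^{cu}_x$ with $\dim V_x\ge 2$ one has $|\det D\phi_t(x)|_{V_x}|\ge Ce^{\lambda t}$ for all $t>0$. The constant $\lambda$ is called the sectional volume expanding rate on $F^{cu}$. Lyapunov stable: there is a sequence of compact neighborhoods $\{U_i\}$ of $\Lambda$ such that $U_1\supset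 U_2\supset\cdots$, $\bigcap_iU_i=\Lambda$, and for each $i\ge1$, $\phi_t(U_{i+1})\subset U_i$ for all $t\ge0$.
   Formalization: The formal theorem additionally assumes that F^cu has dimension at least 2 at some point of Λ; otherwise sectional expansion is vacuous for every λ and the claim fails, e.g. for an attracting hyperbolic singularity, whose entropy is 0. *)

theory Defs
  imports "HOL-Analysis.Analysis" "Jordan_Normal_Form.Determinant"
begin

subsection \<open>Smooth manifolds and tangent vectors\<close>

text \<open>On an open set this is the usual class of k times continuously differentiable maps:
  in finite dimension the Frechet derivative is of class C^k iff all directional
  derivatives are.\<close>

primrec Ck_on :: "nat \<Rightarrow> ('a::real_normed_vector \<Rightarrow> 'b::real_normed_vector) \<Rightarrow> 'a set \<Rightarrow> bool" where
  "Ck_on 0 f S \<longleftrightarrow> continuous_on S f"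
| "Ck_on (Suc k) f S \<longleftrightarrow>
     (\<exists>f'. (\<forall>x\<in>S. (f has_derivative f' x) (at x)) \<and> (\<forall>v. Ck_on k (\<lambda>x. f' x v) S))"

definition smooth_on :: "('a::real_normed_vector \<Rightarrow> 'b::real_normed_vector) \<Rightarrow> 'a set \<Rightarrow> bool" where
  "smooth_on f S \<longleftrightarrow> (\<forall>k. Ck_on k f S)"

text \<open>A chart is its domain together with its coordinate map; the values of the coordinate map
  outside the domain are irrelevant.\<close>

type_synonym ('m, 'n) chart = "'m set \<times> ('m \<Rightarrow> real^'n)"

abbreviation chart_dom :: "('m, 'n::finite) chart \<Rightarrow> 'm set" where
  "chart_dom c \<equiv> fst c"

abbreviation coord :: "('m, 'n::finite) chart \<Rightarrow> 'm \<Rightarrow> real^'n" where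
  "coord c \<equiv> snd c"

abbreviation chart_im :: "('m, 'n::finite) chart \<Rightarrow> (real^'n) set" where
  "chart_im c \<equiv> coord c ` chart_dom c"

abbreviation coord_inv :: "('m, 'n::finite) chart \<Rightarrow> real^'n \<Rightarrow> 'm" where
  "coord_inv c \<equiv> inv_into (chart_dom c) (coord c)"

definition smooth_atlas :: "('m::metric_space, 'n::finite) chart set \<Rightarrow> bool" where
  "smooth_atlas A \<longleftrightarrow>
     (\<Union>c\<in>A. chart_dom c) = UNIV \<and>
     (\<forall>c\<in>A. open (chart_dom c) \<and> open (chart_im c) \<and>
        homeomorphism (chart_dom c) (chart_im c) (coord c) (coord_inv c)) \<and>
     (\<forall>c\<in>A. \<forall>d\<in>A. smooth_on (coord d \<circ> coord_inv c) (coord c ` (chart_dom c \<inter> chart_dom d)))"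

text \<open>A tangent vector at \<open>x\<close> is represented by its coordinates in one fixed chart
  \<open>chart_at A x\<close> around \<open>x\<close>, so that every tangent space is a copy of \<open>real^'n\<close>.  Since the chosen
  chart need not vary continuously with \<open>x\<close>, regularity of vector fields, metrics and
  distributions is always expressed after passing to coordinates in a common chart.\<close>

definition chart_at :: "('m, 'n::finite) chart set \<Rightarrow> 'm \<Rightarrow> ('m, 'n) chart" where
  "chart_at A x = (SOME c. c \<in> A \<and> x \<in> chart_dom c)"

definition chart_change :: "('m, 'n::finite) chart \<Rightarrow> ('m, 'n) chart \<Rightarrow> 'm \<Rightarrow> real^'n \<Rightarrow> real^'n" where
  "chart_change c d x = frechet_derivative (coord d \<circ> coord_inv c) (at (coord c x))"

definition tangent_coord :: "('m, 'n::finite) chart set \<Rightarrow> ('m, 'n) chart \<Rightarrow> 'm \<Rightarrow> real^'n \<Rightarrow> real^'n" where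
  "tangent_coord A c x = chart_change (chart_at A x) c x"

definition mderiv ::
    "('m, 'n::finite) chart set \<Rightarrow> ('m \<Rightarrow> 'm) \<Rightarrow> 'm \<Rightarrow> real^'n \<Rightarrow> real^'n" where
  "mderiv A f x =
     frechet_derivative (coord (chart_at A (f x)) \<circ> f \<circ> coord_inv (chart_at A x))
       (at (coord (chart_at A x) x))"


subsection \<open>Riemannian metrics\<close>

definition inner_product :: "('a::real_vector \<Rightarrow> 'a \<Rightarrow> real) \<Rightarrow> bool" where
  "inner_product ip \<longleftrightarrow>
     (\<forall>u. linear (ip u)) \<and> (\<forall>u v. ip u v = ip v u) \<and> (\<forall>u. u \<noteq> 0 \<longrightarrow> ip u u > 0)"

definition riemannian_metric ::
    "('m, 'n::finite) chart set \<Rightarrow> ('m \<Rightarrow> real^'n \<Rightarrow> real^'n \<Rightarrow> real) \<Rightarrow> bool" where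
  "riemannian_metric A g \<longleftrightarrow>
     (\<forall>x. inner_product (g x)) \<and>
     (\<forall>c\<in>A. \<forall>u v. smooth_on
        (\<lambda>p. let x = coord_inv c p; T = chart_change c (chart_at A x) x in g x (T u) (T v))
        (chart_im c))"

text \<open>The manifold is the whole type.  Its distance is any metric inducing the manifold topology,
  for instance the Riemannian distance when \<open>M\<close> is connected.\<close>

definition compact_riemannian_manifold ::
    "('m::metric_space, 'n::finite) chart set \<Rightarrow> ('m \<Rightarrow> real^'n \<Rightarrow> real^'n \<Rightarrow> real) \<Rightarrow> bool" where
  "compact_riemannian_manifold A g \<longleftrightarrow>
     compact (UNIV :: 'm set) \<and> smooth_atlas A \<and> riemannian_metric A g"

definition gnorm :: "('m \<Rightarrow> 'v \<Rightarrow> 'v \<Rightarrow> real) \<Rightarrow> 'm \<Rightarrow> 'v \<Rightarrow> real" where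
  "gnorm g x v = sqrt (g x v v)"

definition orthonormal_basis ::
    "('a::real_vector \<Rightarrow> 'a \<Rightarrow> real) \<Rightarrow> nat \<Rightarrow> (nat \<Rightarrow> 'a) \<Rightarrow> 'a set \<Rightarrow> bool" where
  "orthonormal_basis ip k e V \<longleftrightarrow>
     (\<forall>i<k. \<forall>j<k. ip (e i) (e j) = (if i = j then 1 else 0)) \<and> span (e ` {..<k}) = V"

text \<open>The absolute value of the determinant of \<open>L : V \<rightarrow> L V\<close>, computed in orthonormal bases of
  \<open>V\<close> and \<open>L V\<close>; for \<open>L\<close> injective on \<open>V\<close> it does not depend on the bases.\<close>

definition abs_det_on ::
    "('a::real_vector \<Rightarrow> 'a \<Rightarrow> real) \<Rightarrow> ('b::real_vector \<Rightarrow> 'b \<Rightarrow> real) \<Rightarrow> ('a \<Rightarrow> 'b) \<Rightarrow> 'a set \<Rightarrow> real" where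
  "abs_det_on ip ip' L V =
     (THE d. \<exists>k e f. orthonormal_basis ip k e V \<and> orthonormal_basis ip' k f (L ` V) \<and>
        d = \<bar>Determinant.det (Matrix.mat k k (\<lambda>(i, j). ip' (f i) (L (e j))))\<bar>)"


subsection \<open>Flows and singularities\<close>

definition vf_in_chart ::
    "('m, 'n::finite) chart set \<Rightarrow> ('m \<Rightarrow> real^'n) \<Rightarrow> ('m, 'n) chart \<Rightarrow> real^'n \<Rightarrow> real^'n" where
  "vf_in_chart A X c p = (let x = coord_inv c p in tangent_coord A c x (X x))"

definition C1_vector_field :: "('m, 'n::finite) chart set \<Rightarrow> ('m \<Rightarrow> real^'n) \<Rightarrow> bool" where
  "C1_vector_field A X \<longleftrightarrow> (\<forall>c\<in>A. Ck_on 1 (vf_in_chart A X c) (chart_im c))"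

definition flow_of ::
    "('m::metric_space, 'n::finite) chart set \<Rightarrow> ('m \<Rightarrow> real^'n) \<Rightarrow> (real \<Rightarrow> 'm \<Rightarrow> 'm) \<Rightarrow> bool" where
  "flow_of A X \<phi> \<longleftrightarrow>
     (\<forall>x. \<phi> 0 x = x) \<and> (\<forall>s t x. \<phi> (s + t) x = \<phi> s (\<phi> t x)) \<and>
     (\<forall>x. continuous_on UNIV (\<lambda>t. \<phi> t x)) \<and>
     (\<forall>x t. ((\<lambda>s. coord (chart_at A (\<phi> t x)) (\<phi> s x)) has_vector_derivative X (\<phi> t x)) (at t))"

definition hyperbolic_linear :: "(real^'n::finite \<Rightarrow> real^'n) \<Rightarrow> bool" where
  "hyperbolic_linear L \<longleftrightarrow>
     (\<forall>(z::complex) (v::complex^'n).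
        v \<noteq> 0 \<and> map_matrix complex_of_real (matrix L) *v v = z *s v \<longrightarrow> Re z \<noteq> 0)"

definition hyperbolic_singularity ::
    "('m, 'n::finite) chart set \<Rightarrow> ('m \<Rightarrow> real^'n) \<Rightarrow> 'm \<Rightarrow> bool" where
  "hyperbolic_singularity A X x \<longleftrightarrow>
     X x = 0 \<and>
     hyperbolic_linear
       (frechet_derivative (vf_in_chart A X (chart_at A x)) (at (coord (chart_at A x) x)))"

definition compact_invariant :: "(real \<Rightarrow> 'm::metric_space \<Rightarrow> 'm) \<Rightarrow> 'm set \<Rightarrow> bool" where
  "compact_invariant \<phi> \<Lambda> \<longleftrightarrow> compact \<Lambda> \<and> (\<forall>t. \<phi> t ` \<Lambda> = \<Lambda>)"

definition lyapunov_stable :: "(real \<Rightarrow> 'm::metric_space \<Rightarrow> 'm) \<Rightarrow> 'm set \<Rightarrow> bool" where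
  "lyapunov_stable \<phi> \<Lambda> \<longleftrightarrow>
     (\<exists>U :: nat \<Rightarrow> 'm set.
        (\<forall>i. compact (U i) \<and> \<Lambda> \<subseteq> interior (U i) \<and> U (Suc i) \<subseteq> U i) \<and>
        (\<Inter>i. U i) = \<Lambda> \<and>
        (\<forall>i. \<forall>t\<ge>0. \<phi> t ` U (Suc i) \<subseteq> U i))"


subsection \<open>Sectional hyperbolicity\<close>

text \<open>Continuity of a distribution over \<open>\<Lambda>\<close>: it is locally spanned by a continuous frame.\<close>

definition continuous_distribution ::
    "('m::metric_space, 'n::finite) chart set \<Rightarrow> 'm set \<Rightarrow> ('m \<Rightarrow> (real^'n) set) \<Rightarrow> bool" where
  "continuous_distribution A \<Lambda> E \<longleftrightarrow>
     (\<forall>x\<in>\<Lambda>. \<exists>c\<in>A. \<exists>U k (e :: nat \<Rightarrow> 'm \<Rightarrow> real^'n).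
        open U \<and> x \<in> U \<and> U \<subseteq> chart_dom c \<and>
        (\<forall>i<k. continuous_on (\<Lambda> \<inter> U) (\<lambda>y. tangent_coord A c y (e i y))) \<and>
        (\<forall>y\<in>\<Lambda> \<inter> U. inj_on (\<lambda>i. e i y) {..<k} \<and> independent ((\<lambda>i. e i y) ` {..<k}) \<and>
           span ((\<lambda>i. e i y) ` {..<k}) = E y))"

definition dominated_splitting ::
    "('m::metric_space, 'n::finite) chart set \<Rightarrow> ('m \<Rightarrow> real^'n \<Rightarrow> real^'n \<Rightarrow> real) \<Rightarrow>
     (real \<Rightarrow> 'm \<Rightarrow> 'm) \<Rightarrow> 'm set \<Rightarrow> ('m \<Rightarrow> (real^'n) set) \<Rightarrow> ('m \<Rightarrow> (real^'n) set) \<Rightarrow> bool" where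
  "dominated_splitting A g \<phi> \<Lambda> E F \<longleftrightarrow>
     (\<forall>x\<in>\<Lambda>. subspace (E x) \<and> subspace (F x) \<and> E x \<inter> F x = {0} \<and>
        {u + v | u v. u \<in> E x \<and> v \<in> F x} = UNIV) \<and>
     continuous_distribution A \<Lambda> E \<and> continuous_distribution A \<Lambda> F \<and>
     (\<forall>x\<in>\<Lambda>. \<forall>t. mderiv A (\<phi> t) x ` E x = E (\<phi> t x) \<and> mderiv A (\<phi> t) x ` F x = F (\<phi> t x)) \<and>
     (\<exists>C \<mu>. C > 0 \<and> 0 < \<mu> \<and> \<mu> < 1 \<and>
        (\<forall>x\<in>\<Lambda>. \<forall>u\<in>E x. \<forall>v\<in>F x. \<forall>t>0. gnorm g x u = 1 \<longrightarrow> gnorm g x v = 1 \<longrightarrow>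
           gnorm g (\<phi> t x) (mderiv A (\<phi> t) x u) \<le>
             C * \<mu> powr t * gnorm g (\<phi> t x) (mderiv A (\<phi> t) x v)))"

definition uniformly_contracting ::
    "('m, 'n::finite) chart set \<Rightarrow> ('m \<Rightarrow> real^'n \<Rightarrow> real^'n \<Rightarrow> real) \<Rightarrow>
     (real \<Rightarrow> 'm \<Rightarrow> 'm) \<Rightarrow> 'm set \<Rightarrow> ('m \<Rightarrow> (real^'n) set) \<Rightarrow> bool" where
  "uniformly_contracting A g \<phi> \<Lambda> E \<longleftrightarrow>
     (\<exists>C \<mu>. C > 0 \<and> 0 < \<mu> \<and> \<mu> < 1 \<and>
        (\<forall>x\<in>\<Lambda>. \<forall>u\<in>E x. \<forall>t>0.
           gnorm g (\<phi> t x) (mderiv A (\<phi> t) x u) \<le> C * \<mu> powr t * gnorm g x u))"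

definition sectional_expanding ::
    "('m, 'n::finite) chart set \<Rightarrow> ('m \<Rightarrow> real^'n \<Rightarrow> real^'n \<Rightarrow> real) \<Rightarrow>
     (real \<Rightarrow> 'm \<Rightarrow> 'm) \<Rightarrow> 'm set \<Rightarrow> ('m \<Rightarrow> (real^'n) set) \<Rightarrow> real \<Rightarrow> bool" where
  "sectional_expanding A g \<phi> \<Lambda> F lam \<longleftrightarrow>
     lam > 0 \<and>
     (\<exists>C>0. \<forall>x\<in>\<Lambda>. \<forall>V. subspace V \<and> V \<subseteq> F x \<and> dim V \<ge> 2 \<longrightarrow>
        (\<forall>t>0. abs_det_on (g x) (g (\<phi> t x)) (mderiv A (\<phi> t) x) V \<ge> C * exp (lam * t)))"

definition sectional_hyperbolic ::
    "('m::metric_space, 'n::finite) chart set \<Rightarrow> ('m \<Rightarrow> real^'n \<Rightarrow> real^'n \<Rightarrow> real) \<Rightarrow>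
     (real \<Rightarrow> 'm \<Rightarrow> 'm) \<Rightarrow> 'm set \<Rightarrow> ('m \<Rightarrow> (real^'n) set) \<Rightarrow> ('m \<Rightarrow> (real^'n) set) \<Rightarrow> real \<Rightarrow> bool" where
  "sectional_hyperbolic A g \<phi> \<Lambda> Es Fcu lam \<longleftrightarrow>
     dominated_splitting A g \<phi> \<Lambda> Es Fcu \<and> uniformly_contracting A g \<phi> \<Lambda> Es \<and>
     sectional_expanding A g \<phi> \<Lambda> Fcu lam"


subsection \<open>Topological entropy\<close>

definition separated :: "('m::metric_space \<Rightarrow> 'm) \<Rightarrow> nat \<Rightarrow> real \<Rightarrow> 'm set \<Rightarrow> bool" where
  "separated f n \<epsilon> S \<longleftrightarrow>
     (\<forall>x\<in>S. \<forall>y\<in>S. x \<noteq> y \<longrightarrow> (\<exists>i<n. dist ((f ^^ i) x) ((f ^^ i) y) > \<epsilon>))"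

text \<open>Bowen's definition.  The supremum over \<open>\<epsilon>\<close> is the limit as \<open>\<epsilon>\<close> tends to 0, by monotonicity.\<close>

definition topological_entropy :: "('m::metric_space \<Rightarrow> 'm) \<Rightarrow> 'm set \<Rightarrow> ereal" where
  "topological_entropy f K =
     (SUP \<epsilon>\<in>{0<..}. limsup (\<lambda>n.
        SUP S\<in>{S. finite S \<and> S \<subseteq> K \<and> separated f n \<epsilon> S}. ereal (ln (real (card S)) / real n)))"

definition flow_entropy :: "(real \<Rightarrow> 'm::metric_space \<Rightarrow> 'm) \<Rightarrow> 'm set \<Rightarrow> ereal" where
  "flow_entropy \<phi> \<Lambda> = topological_entropy (\<phi> 1) \<Lambda>"

end

theory Submission
  imports Defs
begin

text \<open>By domination, a large time map \<open>f\<close> of the flow preserves the relation that two nearby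
  points differ, in a chart, by a vector of a cone around \<open>F\<^sup>c\<^sup>u\<close>.  For a small disc tangent to
  \<open>F\<^sup>c\<^sup>u\<close> this keeps all pieces that follow a common itinerary graphs over \<open>F\<^sup>c\<^sup>u\<close>, so that their
  \<open>d\<close>-dimensional volume, \<open>d = dim F\<^sup>c\<^sup>u\<close>, is expanded at every step while it remains bounded; hence
  the disc has exponentially many itineraries.  Lyapunov stability provides a disc whose forward
  orbit stays so close to \<open>\<Lambda>\<close> that the itineraries of length \<open>n m\<close> are given by \<open>n\<close>-tuples of
  elements of a maximal \<open>(m, \<epsilon>)\<close>-separated subset of \<open>\<Lambda>\<close>.  Letting \<open>n\<close> tend to infinity bounds
  the cardinality of this subset from below.\<close>

text \<open>The splitting exists only over \<Lambda>, whereas the disc and its images lie off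
  \<Lambda>. It is never extended: the coordinate difference of two nearby points is read as a
  tangent vector at a centre \<open>p\<close> in \<Lambda> and split there, and the centres may jump
  along an itinerary. Images of the disc are never parametrised and no Jacobian is computed along
  them; estimates for pairs of points suffice, because a Lipschitz bound controls volume. This costs
  the factor \<open>4 ^ (2 * CARD('n))\<close> per step, and sectional expansion brings a further
  constant; both enter the entropy bound as a logarithm divided by the time \<open>N\<close> of
  \<open>f\<close>, so they vanish as \<open>N\<close> grows. The volume of the initial disc depends
  on \<open>m\<close>, since the disc must lie in a neighbourhood chosen after the separated set;
  this is why \<open>m\<close> stays fixed while \<open>n\<close> grows. Differentiability of the
  flow in space is not part of \<open>flow_of\<close>; it is derived from the vector field, in the
  strict form that compares two moving points.\<close>

no_notation Matrix.vec_index (infixl \<open>$\<close> 100)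
hide_fact (open) Matrix.vec_eq_iff
hide_const (open) Determinant.det Matrix.mat Matrix.vec


subsection \<open>Volume of thickened plane sets\<close>

lemma measure_lipschitz_image_le:
  fixes h :: "'a::euclidean_space \<Rightarrow> 'a"
  assumes V: "compact V" and L: "L > 0"
    and lip: "\<And>x y. x \<in> V \<Longrightarrow> y \<in> V \<Longrightarrow> norm (h x - h y) \<le> L * norm (x - y)"
  shows "measure lebesgue (h ` V) \<le> (2 * L) ^ DIM('a) * measure lebesgue V"
proof (rule field_le_epsilon)
  fix e' :: real assume "e' > 0"
  define e where "e = e' / (2 * L) ^ DIM('a)"
  have "e > 0" using \<open>e' > 0\<close> L by (simp add: e_def)
  have mV: "V \<in> lmeasurable" by (rule lmeasurable_compact[OF V])
  \<comment> \<open>The packing balls stick out of \<open>V\<close>, so they are measured inside a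
    slightly larger open set.\<close>
  obtain W where W0: "open W" "V \<subseteq> W" "W - V \<in> lmeasurable" "emeasure lebesgue (W - V) < ennreal e"
    using sets_lebesgue_outer_open[of V e] fmeasurableD[OF mV] \<open>e > 0\<close> by blast
  have W: "open W" "V \<subseteq> W" "W \<in> lmeasurable" "measure lebesgue W \<le> measure lebesgue V + e"
  proof -
    have eq: "W = V \<union> (W - V)" using W0 by auto
    show "W \<in> lmeasurable" using fmeasurable.Un[OF mV W0(3)] eq by simp
    have "measure lebesgue W = measure lebesgue V + measure lebesgue (W - V)"
      using measure_Un2[OF mV \<open>W \<in> lmeasurable\<close>] W0(2) by (simp add: Un_absorb1)
    moreover have "measure lebesgue (W - V) \<le> e"
      using W0(3,4) \<open>e > 0\<close> by (metis emeasure_eq_measure2 ennreal_less_iff less_eq_real_def measure_nonneg)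
    ultimately show "measure lebesgue W \<le> measure lebesgue V + e" by simp
  qed (use W0 in auto)
  obtain r where r: "r > 0" "\<And>x. x \<in> V \<Longrightarrow> ball x r \<subseteq> W"
  proof -
    have "\<And>x. x \<in> V \<Longrightarrow> \<exists>G\<in>{W}. x \<in> G" using W by auto
    then obtain e where "0 < e" "\<And>x. x \<in> V \<Longrightarrow> \<exists>G\<in>{W}. ball x e \<subseteq> G"
      using Heine_Borel_lemma[OF V, of "{W}"] W by auto
    then show ?thesis using that by auto
  qed
  define P where "P = (\<lambda>T. finite T \<and> T \<subseteq> V \<and> (\<forall>x\<in>T. \<forall>y\<in>T. x \<noteq> y \<longrightarrow> dist x y \<ge> r))"
  obtain F where F: "finite F" "F \<subseteq> V" "V \<subseteq> (\<Union>x\<in>F. ball x (r/2))"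
    using compactE_image[OF V, of V "\<lambda>x. ball x (r/2)"] r(1)
    by (metis (no_types, lifting) UN_I centre_in_ball half_gt_zero open_ball subsetI)
  have bound: "card T \<le> card F" if "P T" for T
  proof -
    have "\<forall>x\<in>T. \<exists>y\<in>F. dist y x < r/2" using F(3) that unfolding P_def by (fastforce simp: subset_iff)
    then obtain c where c: "\<And>x. x \<in> T \<Longrightarrow> c x \<in> F \<and> dist (c x) x < r/2" by metis
    have "inj_on c T"
    proof (rule inj_onI, rule ccontr)
      fix x y assume xy: "x \<in> T" "y \<in> T" "c x = c y" "x \<noteq> y"
      have "dist x y < r" using c[OF xy(1)] c[OF xy(2)] xy(3)
        by (metis dist_commute dist_triangle_half_l)
      then show False using that xy unfolding P_def by force
    qed
    moreover have "c ` T \<subseteq> F" using c by auto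
    ultimately show ?thesis using F(1) card_inj_on_le by blast
  qed
  \<comment> \<open>The cardinality bound makes a largest separated set exist; by maximality its
    balls of radius \<open>r\<close> cover \<open>V\<close>.\<close>
  have "P {}" by (simp add: P_def)
  then obtain T where T: "P T" "\<And>T'. P T' \<Longrightarrow> card T' \<le> card T"
    using ex_has_greatest_nat[of P "{}" card "Suc (card F)"] bound by (auto simp: less_Suc_eq_le)
  have cover: "\<exists>x\<in>T. dist x y < r" if "y \<in> V" for y
  proof (rule ccontr)
    assume neg: "\<not> ?thesis"
    then have "y \<notin> T" using r(1) by (metis dist_self)
    have "P (insert y T)" using neg T(1) that unfolding P_def
      by (auto simp: dist_commute not_less)
    then show False using T(2)[of "insert y T"] \<open>y \<notin> T\<close> T(1) by (simp add: P_def)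
  qed
  have fT: "finite T" "T \<subseteq> V" using T(1) by (auto simp: P_def)
  let ?u = "unit_ball_vol (real DIM('a))"
  have disj: "disjoint_family_on (\<lambda>x. ball x (r/2)) T"
    unfolding disjoint_family_on_def
  proof (intro ballI impI)
    fix x y assume xy: "x \<in> T" "y \<in> T" "x \<noteq> y"
    have "dist x y \<ge> r" using T(1) xy by (auto simp: P_def)
    then have False if "w \<in> ball x (r/2)" "w \<in> ball y (r/2)" for w
      using that dist_triangle2[of x y w] by simp
    then show "ball x (r/2) \<inter> ball y (r/2) = {}" by blast
  qed
  have "real (card T) * (?u * (r/2) ^ DIM('a)) = (\<Sum>x\<in>T. measure lebesgue (ball x (r/2)))"
    using r(1) by (simp add: content_ball measure_completion)
  also have "\<dots> = measure lebesgue (\<Union>x\<in>T. ball x (r/2))"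
  proof (rule measure_finite_Union[symmetric, OF fT(1) _ disj])
    fix x show "emeasure lebesgue (ball x (r/2)) \<noteq> \<infinity>"
      using emeasure_lborel_ball_finite[of x "r/2"] by (simp add: less_top)
  qed auto
  also have "\<dots> \<le> measure lebesgue W"
  proof (rule measure_mono_fmeasurable)
    show "(\<Union>x\<in>T. ball x (r/2)) \<subseteq> W"
    proof (rule UN_least)
      fix x assume "x \<in> T"
      have "ball x (r/2) \<subseteq> ball x r" using r(1) by (intro subset_ball) simp
      then show "ball x (r/2) \<subseteq> W" using r(2)[of x] fT \<open>x \<in> T\<close> by blast
    qed
  qed (use W fT in auto)
  finally have c1: "real (card T) * (?u * (r/2) ^ DIM('a)) \<le> measure lebesgue W" .
  have "h ` V \<subseteq> (\<Union>x\<in>T. cball (h x) (L * r))"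
  proof safe
    fix y assume "y \<in> V"
    then obtain x where "x \<in> T" "dist x y < r" using cover by blast
    then have "norm (h x - h y) \<le> L * r" using lip[of x y] fT \<open>y \<in> V\<close> L
      by (smt (verit, best) dist_norm mult_left_mono subset_eq)
    then show "h y \<in> (\<Union>x\<in>T. cball (h x) (L * r))" using \<open>x \<in> T\<close> by (auto simp: dist_norm)
  qed
  then have "measure lebesgue (h ` V) \<le> measure lebesgue (\<Union>x\<in>T. cball (h x) (L * r))"
  proof (rule measure_mono_fmeasurable)
    have "continuous_on V h"
    proof (rule continuous_onI)
      fix x e :: _ assume "x \<in> V" "(0::real) < e"
      show "\<exists>d>0. \<forall>x'\<in>V. dist x' x < d \<longrightarrow> dist (h x') (h x) \<le> e"
      proof (intro exI[of _ "e / L"] conjI ballI impI)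
        fix x' assume "x' \<in> V" "dist x' x < e / L"
        then show "dist (h x') (h x) \<le> e" using lip[of x' x] L \<open>x \<in> V\<close>
          by (simp add: dist_norm field_simps)
      qed (use L \<open>0 < e\<close> in simp)
    qed
    then show "h ` V \<in> sets lebesgue" using V
      by (simp add: compact_continuous_image fmeasurableD lmeasurable_compact)
  qed (use fT in \<open>auto intro!: fmeasurable.finite_UN\<close>)
  also have "\<dots> \<le> (\<Sum>x\<in>T. measure lebesgue (cball (h x) (L * r)))"
    using fT by (intro measure_UNION_le) auto
  also have "\<dots> = real (card T) * (?u * (L * r) ^ DIM('a))"
    using r(1) L by (simp add: content_cball measure_completion)
  also have "\<dots> = (2 * L) ^ DIM('a) * (real (card T) * (?u * (r/2) ^ DIM('a)))"
    by (simp add: power_mult_distrib power_divide)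
  also have "\<dots> \<le> (2 * L) ^ DIM('a) * (measure lebesgue V + e)"
    using c1 W(4) L by (intro mult_left_mono) auto
  also have "\<dots> = (2 * L) ^ DIM('a) * measure lebesgue V + e'"
    using L by (simp add: e_def algebra_simps)
  finally show "measure lebesgue (h ` V) \<le> (2 * L) ^ DIM('a) * measure lebesgue V + e'" .
qed

section \<open>Volume of sets in a coordinate plane\<close>

definition slab :: "'n set \<Rightarrow> (real^'n::finite) set" where
  "slab I = {a. (\<forall>j\<in>I. a $ j = 0) \<and> norm a \<le> 1}"

definition thicken :: "'n set \<Rightarrow> ('m \<Rightarrow> real^'n::finite) \<Rightarrow> 'm set \<Rightarrow> (real^'n) set" where
  "thicken I u S = (\<Union>z\<in>S. (+) (u z) ` slab I)"

lemma compact_slab: "compact (slab I :: (real^'n::finite) set)"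
proof -
  have "closed {a :: real^'n. \<forall>j\<in>I. a $ j = 0}"
    unfolding Ball_def
    by (intro closed_Collect_all closed_Collect_imp open_Collect_const closed_Collect_eq continuous_intros)
  moreover have "slab I = cball 0 1 \<inter> {a. \<forall>j\<in>I. a $ j = 0}"
    by (auto simp: slab_def)
  ultimately show ?thesis by (simp add: compact_Int_closed)
qed

lemma thicken_iff: "x \<in> thicken I u S \<longleftrightarrow> (\<exists>z\<in>S. \<exists>a\<in>slab I. x = u z + a)"
  by (auto simp: thicken_def)

lemma compact_thicken:
  fixes u :: "'m::metric_space \<Rightarrow> real^'n::finite"
  assumes "compact S" "continuous_on S u"
  shows "compact (thicken I u S)"
proof -
  have "continuous_on (S \<times> slab I) (\<lambda>p. u (fst p) + snd p)"
    by (intro continuous_intros continuous_on_compose2[OF assms(2)]) auto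
  moreover have "thicken I u S = (\<lambda>p. u (fst p) + snd p) ` (S \<times> slab I)"
    by (force simp: thicken_def image_iff)
  ultimately show ?thesis
    by (simp add: compact_continuous_image compact_Times compact_slab assms)
qed

lemma thicken_UN: "thicken I u (\<Union>c\<in>C. S c) = (\<Union>c\<in>C. thicken I u (S c))"
  by (auto simp: thicken_def)

text \<open>The slab turns the volume of a set in the coordinate plane spanned by \<open>I\<close> into a Lebesgue
  measure on the whole space, so that planes of any dimension can be handled in one type.\<close>

lemma measure_thicken_expand:
  fixes u v :: "'m::metric_space \<Rightarrow> real^'n::{finite,wellorder}" and M :: "real^'n::_^'n::_"
  assumes S: "compact S" "continuous_on S u" "continuous_on S v"
    and supp: "\<And>z j. z \<in> S \<Longrightarrow> j \<notin> I \<Longrightarrow> u z $ j = 0" "\<And>z j. z \<in> S \<Longrightarrow> j \<notin> I \<Longrightarrow> v z $ j = 0"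
    and block: "\<And>b j. (\<And>i. i \<notin> I \<Longrightarrow> b $ i = 0) \<Longrightarrow> j \<notin> I \<Longrightarrow> (M *v b) $ j = 0"
      "\<And>a. (\<And>i. i \<in> I \<Longrightarrow> a $ i = 0) \<Longrightarrow> M *v a = a"
    and exp: "\<And>y z. y \<in> S \<Longrightarrow> z \<in> S \<Longrightarrow> norm (M *v (u y - u z)) \<le> 2 * norm (v y - v z)"
  shows "\<bar>det M\<bar> * measure lebesgue (thicken I u S) \<le> 4 ^ CARD('n) * measure lebesgue (thicken I v S)"
proof -
  \<comment> \<open>The slab is orthogonal to the coordinate plane of \<open>I\<close>, so estimates
    in the plane and in the slab combine by Pythagoras.\<close>
  have pyth: "norm (b + a) ^ 2 = norm b ^ 2 + norm a ^ 2"
    if "\<And>j. j \<notin> I \<Longrightarrow> b $ j = 0" "\<And>j. j \<in> I \<Longrightarrow> a $ j = 0" for a b :: "real^'n::_"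
  proof -
    have "inner b a = 0" unfolding inner_vec_def
      by (rule sum.neutral) (use that in \<open>metis inner_zero_left inner_zero_right UNIV_I\<close>)
    then show ?thesis by (simp add: power2_norm_eq_inner inner_add_left inner_add_right inner_commute)
  qed
  \<comment> \<open>The map from \<open>v\<close>-coordinates back to \<open>M\<close>-transformed
    \<open>u\<close>-coordinates, extended by the identity in the slab directions. It is well
    defined because \<open>exp\<close> forces equal values of \<open>v\<close> to have equal images,
    and the plane and slab parts of a sum are determined by the sum.\<close>
  have h: "\<exists>h. \<forall>z\<in>S. \<forall>a\<in>slab I. h (v z + a) = M *v (u z + a)"
  proof -
    define h where "h w = (SOME y. \<exists>z\<in>S. \<exists>a\<in>slab I. w = v z + a \<and> y = M *v (u z + a))" for w
    have "h (v z + a) = M *v (u z + a)" if "z \<in> S" "a \<in> slab I" for z a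
    proof -
      have "\<exists>z'\<in>S. \<exists>a'\<in>slab I. v z + a = v z' + a' \<and> h (v z + a) = M *v (u z' + a')"
        unfolding h_def by (rule someI_ex) (use that in blast)
      then obtain z' a' where z': "z' \<in> S" "a' \<in> slab I" "v z + a = v z' + a'"
        "h (v z + a) = M *v (u z' + a')" by blast
      have "(v z - v z') + (a - a') = 0" using z'(3) by (simp add: algebra_simps)
      moreover have "norm ((v z - v z') + (a - a')) ^ 2 = norm (v z - v z') ^ 2 + norm (a - a') ^ 2"
        by (rule pyth) (use supp z' that in \<open>auto simp: slab_def\<close>)
      ultimately have eq: "v z - v z' = 0" "a - a' = 0"
        by (auto simp: add_nonneg_eq_0_iff)
      then have "M *v (u z - u z') = 0" using exp[OF that(1) z'(1)] by simp
      then show ?thesis using z'(4) eq by (simp add: matrix_vector_mult_diff_distrib matrix_vector_right_distrib)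
    qed
    then show ?thesis by blast
  qed
  then obtain h where h: "\<And>z a. z \<in> S \<Longrightarrow> a \<in> slab I \<Longrightarrow> h (v z + a) = M *v (u z + a)" by blast
  have img: "h ` thicken I v S = (*v) M ` thicken I u S"
    unfolding thicken_def image_UN image_image by (intro SUP_cong image_cong refl) (auto simp: h)
  have lip: "norm (h x - h y) \<le> 2 * norm (x - y)" if xy: "x \<in> thicken I v S" "y \<in> thicken I v S" for x y
  proof -
    obtain z a z' a' where za: "z \<in> S" "a \<in> slab I" "x = v z + a" "z' \<in> S" "a' \<in> slab I" "y = v z' + a'"
      using xy unfolding thicken_iff by blast
    define \<alpha> where "\<alpha> = norm (a - a') ^ 2"
    have "h x - h y = M *v (u z - u z') + (a - a')"
      using h[of z a] h[of z' a'] za block(2)[of a] block(2)[of a']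
      by (simp add: slab_def matrix_vector_mult_diff_distrib matrix_vector_right_distrib)
    moreover have "norm (M *v (u z - u z') + (a - a')) ^ 2 = norm (M *v (u z - u z')) ^ 2 + \<alpha>"
      unfolding \<alpha>_def by (rule pyth, rule block(1)) (use supp za in \<open>auto simp: slab_def\<close>)
    moreover have "norm (v z - v z' + (a - a')) ^ 2 = norm (v z - v z') ^ 2 + \<alpha>"
      unfolding \<alpha>_def by (rule pyth) (use supp za in \<open>auto simp: slab_def\<close>)
    moreover have "norm (M *v (u z - u z')) ^ 2 \<le> (2 * norm (v z - v z')) ^ 2"
      by (rule power_mono[OF exp]) (use za in auto)
    moreover have "x - y = v z - v z' + (a - a')" using za by simp
    moreover have "\<alpha> \<ge> 0" by (simp add: \<alpha>_def)
    ultimately have "norm (h x - h y) ^ 2 \<le> (2 * norm (x - y)) ^ 2"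
      by (simp add: power_mult_distrib)
    then show ?thesis by (rule power2_le_imp_le) simp
  qed
  have lin: "linear ((*v) M)" by (rule matrix_vector_mul_linear)
  have "\<bar>det M\<bar> * measure lebesgue (thicken I u S) = measure lebesgue ((*v) M ` thicken I u S)"
    using measure_linear_image[OF lin lmeasurable_compact[OF compact_thicken[OF S(1,2)]]]
    by (simp add: matrix_of_matrix_vector_mul)
  \<comment> \<open>One factor 2 is the Lipschitz constant of \<open>h\<close>, the other the loss
    in \<open>measure_lipschitz_image_le\<close>.\<close>
  also have "\<dots> \<le> (2 * 2) ^ DIM(real^'n::_) * measure lebesgue (thicken I v S)"
    unfolding img[symmetric]
    by (rule measure_lipschitz_image_le[OF compact_thicken[OF S(1,3)] _ lip]) auto
  finally show ?thesis by simp
qed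

text \<open>An upper bound that is the same for all pieces, whatever their itinerary: diameter at
  most 1 in the plane plus the unit slab fit in a ball of radius 2.\<close>

lemma measure_thicken_le:
  fixes u :: "'m::metric_space \<Rightarrow> real^'n::finite"
  assumes "compact S" "continuous_on S u" and 1: "\<And>y z. y \<in> S \<Longrightarrow> z \<in> S \<Longrightarrow> norm (u y - u z) \<le> 1"
  shows "measure lebesgue (thicken I u S) \<le> measure lebesgue (cball (0::real^'n) 2)"
proof (cases "S = {}")
  case False
  then obtain y where "y \<in> S" by blast
  have "thicken I u S \<subseteq> cball (u y) 2"
  proof
    fix x assume "x \<in> thicken I u S"
    then obtain z a where "z \<in> S" "a \<in> slab I" "x = u z + a" by (auto simp: thicken_def)
    then have "norm (u y - x) \<le> norm (u y - u z) + norm a"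
      using norm_triangle_ineq4[of "u y - u z" a] by (simp add: algebra_simps)
    also have "\<dots> \<le> 2" using 1[OF \<open>y \<in> S\<close> \<open>z \<in> S\<close>] \<open>a \<in> slab I\<close> by (simp add: slab_def)
    finally show "x \<in> cball (u y) 2" by (simp add: dist_norm)
  qed
  then have "measure lebesgue (thicken I u S) \<le> measure lebesgue (cball (u y) 2)"
    by (rule measure_mono_fmeasurable)
      (use assms in \<open>auto intro!: fmeasurableD lmeasurable_compact compact_thicken\<close>)
  then show ?thesis by (simp add: content_cball measure_completion)
qed (simp add: thicken_def)

lemma measure_thicken_pos:
  fixes u :: "'m::metric_space \<Rightarrow> real^'n::finite"
  assumes S: "compact S" "continuous_on S u" and r: "r > 0"
    and cov: "\<And>b. (\<And>j. j \<notin> I \<Longrightarrow> b $ j = 0) \<Longrightarrow> norm b \<le> r \<Longrightarrow> c + b \<in> u ` S"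
  shows "measure lebesgue (thicken I u S) > 0"
proof -
  \<comment> \<open>The slab has radius 1 and the covered part of the plane has radius
    \<open>r\<close>, so a ball of the smaller radius fits.\<close>
  define s where "s = min r 1"
  have "s > 0" using r by (simp add: s_def)
  have "ball c s \<subseteq> thicken I u S"
  proof
    fix x assume "x \<in> ball c s"
    then have n: "norm (x - c) < s" by (simp add: dist_norm norm_minus_commute)
    define b where "b = (\<chi> j. if j \<in> I then (x - c) $ j else 0)"
    define a where "a = (\<chi> j. if j \<in> I then 0 else (x - c) $ j)"
    have "norm b \<le> norm (x - c)" "norm a \<le> norm (x - c)"
      by (rule norm_le_componentwise_cart; simp add: a_def b_def)+
    then have "a \<in> slab I" "c + b \<in> u ` S"
      using n by (auto simp: slab_def s_def a_def b_def intro!: cov)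
    moreover have "x = (c + b) + a" by (simp add: vec_eq_iff a_def b_def)
    ultimately show "x \<in> thicken I u S" unfolding thicken_def by force
  qed
  then have "measure lebesgue (ball c s) \<le> measure lebesgue (thicken I u S)"
    by (rule measure_mono_fmeasurable) (auto intro!: lmeasurable_compact compact_thicken S)
  moreover have "measure lebesgue (ball c s) > 0"
    using \<open>s > 0\<close> content_ball_pos[OF \<open>s > 0\<close>, of c] by simp
  ultimately show ?thesis by linarith
qed


subsection \<open>Orthonormal bases and determinants\<close>

text \<open>Two kinds of determinant meet here: \<open>abs_det_on\<close> uses matrices indexed by
  numbers, the change of Lebesgue measure uses matrices indexed by a type. The Leibniz sums
  correspond under conjugation by \<open>h\<close>, which preserves signs of permutations.\<close>

lemma det_reindex_eq_JNF:
  fixes h :: "'k::finite \<Rightarrow> nat" and N :: "nat \<Rightarrow> nat \<Rightarrow> real"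
  assumes h: "bij_betw h UNIV {0..<n}"
  shows "det (\<chi> i j. N (h i) (h j)) = Determinant.det (Matrix.mat n n (\<lambda>(i, j). N i j))"
proof -
  let ?c = "map_permutation UNIV h"
  have inj: "inj_on h UNIV" and img: "range h = {0..<n}" using h by (auto simp: bij_betw_def)
  have c_eq: "?c p = (\<lambda>x. if x \<in> {0..<n} then h (p (inv_into UNIV h x)) else x)" for p
    unfolding map_permutation_def img restrict_id_def by auto
  have bij: "bij_betw ?c {p. p permutes UNIV} {p. p permutes {0..<n}}"
    using bij_betw_permutations[OF h] unfolding c_eq .
  have "Determinant.det (Matrix.mat n n (\<lambda>(i, j). N i j)) =
      (\<Sum>p | p permutes {0..<n}. signof p * (\<Prod>i = 0..<n. N i (p i)))"
    unfolding Determinant.det_def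
    by (auto intro!: sum.cong prod.cong arg_cong2[where f="(*)"] simp: permutes_in_image)
  also have "\<dots> = (\<Sum>p | p permutes UNIV. signof (?c p) * (\<Prod>i = 0..<n. N i (?c p i)))"
    by (rule sum.reindex_bij_betw[OF bij, symmetric])
  also have "\<dots> = (\<Sum>p | p permutes (UNIV :: 'k set). of_int (sign p) * (\<Prod>i\<in>UNIV. N (h i) (h (p i))))"
  proof (rule sum.cong)
    fix p :: "'k \<Rightarrow> 'k" assume "p \<in> {p. p permutes UNIV}"
    then have p: "p permutes UNIV" by simp
    have "sign (?c p) = sign p" by (rule sign_map_permutation[OF inj p]) simp
    moreover have "(\<Prod>i = 0..<n. N i (?c p i)) = (\<Prod>i\<in>UNIV. N (h i) (?c p (h i)))"
      by (rule prod.reindex_bij_betw[OF h, symmetric])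
    moreover have "?c p (h i) = h (p i)" for i
      using img inj unfolding c_eq by (auto simp: inv_f_f)
    ultimately show "signof (?c p) * (\<Prod>i = 0..<n. N i (?c p i)) = of_int (sign p) * (\<Prod>i\<in>UNIV. N (h i) (h (p i)))"
      by (auto simp: sign_def)
  qed simp
  also have "\<dots> = det (\<chi> i j. N (h i) (h j))" by (simp add: Determinants.det_def)
  finally show ?thesis by simp
qed

text \<open>The dimension \<open>d\<close> of the plane is a number and not a type. Padding with an
  identity block gives a matrix of the fixed full size without changing the determinant.\<close>

lemma det_block_identity_eq_JNF:
  fixes h :: "'k::finite \<Rightarrow> nat" and M :: "nat \<Rightarrow> nat \<Rightarrow> real"
  assumes h: "bij_betw h UNIV {0..<n}" and "d \<le> n"
  shows "det (\<chi> i j. if h i < d \<and> h j < d then M (h i) (h j) else if i = j then 1 else 0) =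
    Determinant.det (Matrix.mat d d (\<lambda>(i, j). M i j))"
proof -
  let ?N = "\<lambda>i j. if i < d \<and> j < d then M i j else if i = j then 1 else 0"
  let ?B = "four_block_mat (Matrix.mat d d (\<lambda>(i, j). M i j)) (0\<^sub>m d (n - d)) (0\<^sub>m (n - d) d) (1\<^sub>m (n - d)) :: real mat"
  have eq: "h i = h j \<longleftrightarrow> i = j" for i j using h by (auto simp: bij_betw_def inj_on_def)
  have "det (\<chi> i j. if h i < d \<and> h j < d then M (h i) (h j) else if i = j then 1 else 0) = det (\<chi> i j. ?N (h i) (h j))"
    unfolding eq ..
  also have "\<dots> = Determinant.det (Matrix.mat n n (\<lambda>(i, j). ?N i j))" by (rule det_reindex_eq_JNF[OF h])
  also have "Matrix.mat n n (\<lambda>(i, j). ?N i j) = ?B"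
    using \<open>d \<le> n\<close> by (intro eq_matI) (auto simp: four_block_mat_def Let_def)
  also have "Determinant.det ?B = Determinant.det (Matrix.mat d d (\<lambda>(i, j). M i j)) * Determinant.det (1\<^sub>m (n - d) :: real mat)"
    by (rule det_four_block_mat_upper_right_zero) auto
  finally show ?thesis by simp
qed

section \<open>Orthonormal bases for an arbitrary inner product\<close>

lemma orthonormal_in: "orthonormal_basis ip k e V \<Longrightarrow> i < k \<Longrightarrow> e i \<in> V"
  by (auto simp: orthonormal_basis_def intro: span_base)

context
  fixes ip :: "'a::real_vector \<Rightarrow> 'a \<Rightarrow> real"
  assumes ip: "inner_product ip"
begin

lemma ip_linear: "linear (ip u)" and ip_commute: "ip u v = ip v u" and ip_pos: "u \<noteq> 0 \<Longrightarrow> ip u u > 0"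
  using ip unfolding inner_product_def by auto

lemma ip_simps:
  "ip u (v + w) = ip u v + ip u w" "ip (v + w) u = ip v u + ip w u"
  "ip u (c *\<^sub>R v) = c * ip u v" "ip (c *\<^sub>R v) u = c * ip v u"
  "ip u (v - w) = ip u v - ip u w" "ip (v - w) u = ip v u - ip w u" "ip u 0 = 0" "ip 0 u = 0"
  "ip u (sum f S) = (\<Sum>i\<in>S. ip u (f i))" "ip (sum f S) u = (\<Sum>i\<in>S. ip (f i) u)"
  using linear_add[OF ip_linear] linear_cmul[OF ip_linear] linear_diff[OF ip_linear] linear_0[OF ip_linear]
    linear_sum[OF ip_linear]
  by (auto simp: ip_commute[of _ u])

lemma ip_nonneg: "ip u u \<ge> 0"
  using ip_pos[of u] ip_simps(7)[of 0] by (cases "u = 0") (auto intro: less_imp_le)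

lemma orthonormal_expansion:
  assumes e: "orthonormal_basis ip k e V" and v: "v \<in> V"
  shows "v = (\<Sum>i<k. ip (e i) v *\<^sub>R e i)"
proof -
  let ?S = "\<lambda>v. \<Sum>i<k. ip (e i) v *\<^sub>R e i"
  have "linear ?S"
    by (rule linearI) (simp_all add: ip_simps scaleR_left_distrib sum.distrib scaleR_sum_right)
  then have lin: "linear (\<lambda>v. v - ?S v)" by (intro linear_compose_sub linear_id[unfolded id_def])
  have vs: "v \<in> span (e ` {..<k})" using e v by (simp add: orthonormal_basis_def)
  have "x - ?S x = 0" if x: "x \<in> e ` {..<k}" for x
  proof -
    obtain j where j: "j < k" "x = e j" using x by auto
    have "?S x = (\<Sum>i<k. if i = j then e i else 0)"
      using e j by (intro sum.cong) (auto simp: orthonormal_basis_def)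
    then show ?thesis using j by simp
  qed
  then have "v - ?S v = 0" using linear_eq_0_on_span[OF lin _ vs] by blast
  then show ?thesis by simp
qed

lemma orthonormal_parseval:
  assumes e: "orthonormal_basis ip k e V" and v: "v \<in> V"
  shows "ip v w = (\<Sum>i<k. ip (e i) v * ip (e i) w)"
  by (subst orthonormal_expansion[OF e v]) (simp add: ip_simps)

lemma orthonormal_inj_independent:
  assumes e: "orthonormal_basis ip k e V"
  shows "inj_on e {..<k}" "independent (e ` {..<k})" "k = dim V"
proof -
  have on: "ip (e i) (e j) = (if i = j then 1 else 0)" if "i < k" "j < k" for i j
    using e that by (auto simp: orthonormal_basis_def)
  show inj: "inj_on e {..<k}"
  proof (rule inj_onI, rule ccontr)
    fix i j assume ij: "i \<in> {..<k}" "j \<in> {..<k}" "e i = e j" "i \<noteq> j"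
    then show False using on[of i j] on[of i i] by simp
  qed
  show indep: "independent (e ` {..<k})"
    unfolding dependent_def
  proof safe
    fix j assume j: "j < k" "e j \<in> span (e ` {..<k} - {e j})"
    have "ip (e j) x = 0" if x: "x \<in> e ` {..<k} - {e j}" for x
    proof -
      obtain i where "i < k" "x = e i" "i \<noteq> j" using x by auto
      then show ?thesis using on[of j i] j by simp
    qed
    then have "ip (e j) (e j) = 0" using linear_eq_0_on_span[OF ip_linear[of "e j"] _ j(2)] by blast
    then show False using on[of j j] j by simp
  qed
  have "V = span (e ` {..<k})" using e by (simp add: orthonormal_basis_def)
  then show "k = dim V" using dim_span_eq_card_independent[OF indep] card_image[OF inj] by simp
qed

text \<open>Gram-Schmidt, one basis vector at a time: \<open>b'\<close> is the part of
  \<open>b\<close> orthogonal to the basis already built, and it is nonzero because \<open>b\<close>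
  lies outside the span of \<open>B\<close>.\<close>

lemma orthonormal_basis_exists_span:
  assumes "finite B" "independent B"
  shows "\<exists>e. orthonormal_basis ip (card B) e (span B)"
  using assms
proof (induction B)
  case empty
  then show ?case by (auto simp: orthonormal_basis_def)
next
  case (insert b B)
  then have b: "b \<notin> span B" and "independent B" by (auto simp: independent_insert)
  then obtain e where e: "orthonormal_basis ip (card B) e (span B)" using insert by blast
  let ?k = "card B"
  define p where "p = (\<Sum>i<?k. ip (e i) b *\<^sub>R e i)"
  have eB: "e i \<in> span B" if "i < ?k" for i
    using orthonormal_in[OF e that] .
  have p: "p \<in> span B" unfolding p_def by (intro span_sum span_scale eB) auto
  define b' where "b' = b - p"
  have "b' \<noteq> 0" using b p by (auto simp: b'_def)
  have orth: "ip (e j) b' = 0" if "j < ?k" for j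
  proof -
    have "ip (e j) p = (\<Sum>i<?k. if i = j then ip (e i) b else 0)"
      unfolding p_def ip_simps using e that by (intro sum.cong) (auto simp: orthonormal_basis_def)
    then show ?thesis using that by (simp add: b'_def ip_simps)
  qed
  define s where "s = sqrt (ip b' b')"
  have s: "s > 0" "s * s = ip b' b'" using ip_pos[OF \<open>b' \<noteq> 0\<close>] by (auto simp: s_def)
  define u where "u = (1 / s) *\<^sub>R b'"
  define e' where "e' = e(?k := u)"
  have img: "e' ` {..<Suc ?k} = insert u (e ` {..<?k})" by (auto simp: e'_def lessThan_Suc)
  have "ip u u = 1" using s ip_pos[OF \<open>b' \<noteq> 0\<close>] by (simp add: u_def ip_simps field_simps)
  moreover have "ip (e j) u = 0" "ip u (e j) = 0" if "j < ?k" for j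
    using orth[OF that] ip_commute by (auto simp: u_def ip_simps)
  ultimately have "\<forall>i<Suc ?k. \<forall>j<Suc ?k. ip (e' i) (e' j) = (if i = j then 1 else 0)"
    using e by (auto simp: e'_def orthonormal_basis_def less_Suc_eq)
  moreover have "span (e' ` {..<Suc ?k}) = span (insert b B)"
  proof -
    have sB: "span (e ` {..<?k}) = span B" using e by (simp add: orthonormal_basis_def)
    have "span (insert u (e ` {..<?k})) \<subseteq> span (insert b B)"
    proof (rule span_minimal)
      have "p \<in> span (insert b B)" using p span_mono[of B "insert b B"] by blast
      moreover have "b \<in> span (insert b B)" by (simp add: span_base)
      ultimately have "u \<in> span (insert b B)" unfolding u_def b'_def by (intro span_scale span_diff)
      moreover have "e ` {..<?k} \<subseteq> span (insert b B)" using eB span_mono[of B "insert b B"] by blast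
      ultimately show "insert u (e ` {..<?k}) \<subseteq> span (insert b B)" by simp
    qed simp
    moreover have "span (insert b B) \<subseteq> span (insert u (e ` {..<?k}))"
    proof (rule span_minimal)
      let ?S = "span (insert u (e ` {..<?k}))"
      have "span B \<subseteq> ?S" unfolding sB[symmetric] by (rule span_mono) auto
      moreover have "u \<in> ?S" by (simp add: span_base)
      moreover have "b = s *\<^sub>R u + p" using s by (simp add: u_def b'_def)
      ultimately have "b \<in> ?S" using p by (metis span_add span_scale subsetD)
      then show "insert b B \<subseteq> ?S" using \<open>span B \<subseteq> ?S\<close> span_superset by blast
    qed simp
    ultimately show ?thesis unfolding img by simp
  qed
  ultimately have "orthonormal_basis ip (Suc ?k) e' (span (insert b B))" by (simp add: orthonormal_basis_def)
  then show ?case using insert by auto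
qed

lemma det_orthonormal_change:
  assumes e: "orthonormal_basis ip k e V" and e': "orthonormal_basis ip k e' V"
  shows "\<bar>Determinant.det (Matrix.mat k k (\<lambda>(i, j). ip (e i) (e' j)))\<bar> = 1"
proof -
  let ?U = "Matrix.mat k k (\<lambda>(i, j). ip (e i) (e' j))"
  have U: "?U \<in> carrier_mat k k" by simp
  have e'V: "e' j \<in> V" if "j < k" for j using orthonormal_in[OF e' that] .
  have "transpose_mat ?U * ?U = 1\<^sub>m k"
  proof (rule eq_matI)
    fix i j assume "i < dim_row (1\<^sub>m k :: real mat)" "j < dim_col (1\<^sub>m k :: real mat)"
    then have ij: "i < k" "j < k" by auto
    have "(transpose_mat ?U * ?U) $$ (i, j) = (\<Sum>l<k. ip (e l) (e' i) * ip (e l) (e' j))"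
      using ij by (simp add: scalar_prod_def atLeast0LessThan)
    also have "\<dots> = ip (e' i) (e' j)" using orthonormal_parseval[OF e e'V[OF ij(1)]] by simp
    also have "\<dots> = (1\<^sub>m k :: real mat) $$ (i, j)" using e' ij by (auto simp: orthonormal_basis_def)
    finally show "(transpose_mat ?U * ?U) $$ (i, j) = (1\<^sub>m k :: real mat) $$ (i, j)" .
  qed auto
  then have "Determinant.det (transpose_mat ?U) * Determinant.det ?U = 1"
    using Determinant.det_mult[of "transpose_mat ?U" k ?U] U by simp
  then have "Determinant.det ?U * Determinant.det ?U = 1" using Determinant.det_transpose[OF U] by simp
  then show ?thesis by (metis abs_mult_self_eq abs_one abs_square_eq_1 power2_eq_square)
qed

end

lemma orthonormal_basis_exists:
  fixes V :: "'a::euclidean_space set"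
  assumes "inner_product ip" "subspace V"
  shows "\<exists>e. orthonormal_basis ip (dim V) e V"
proof -
  obtain B where B: "B \<subseteq> V" "independent B" "V \<subseteq> span B" "card B = dim V" using basis_exists by blast
  then have "span B = V" using assms(2) by (meson span_minimal subset_antisym)
  then show ?thesis using orthonormal_basis_exists_span[OF assms(1) independent_imp_finite[OF B(2)] B(2)] B by simp
qed

text \<open>This justifies the definite description in \<open>abs_det_on\<close>. Another choice of
  bases multiplies the matrix on both sides by orthogonal matrices, whose determinants have absolute
  value 1. Bases of equal size \<open>k\<close> for \<open>V\<close> and its image express that
  \<open>L\<close> is injective on \<open>V\<close>.\<close>

lemma abs_det_on_eq:
  fixes L :: "'a::euclidean_space \<Rightarrow> 'b::euclidean_space"
  assumes ip: "inner_product ip" "inner_product ip'" and L: "linear L"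
    and e: "orthonormal_basis ip k e V" and f: "orthonormal_basis ip' k f (L ` V)"
  shows "abs_det_on ip ip' L V = \<bar>Determinant.det (Matrix.mat k k (\<lambda>(i, j). ip' (f i) (L (e j))))\<bar>"
  unfolding abs_det_on_def
proof (rule the_equality)
  show "\<exists>k' e' f'. orthonormal_basis ip k' e' V \<and> orthonormal_basis ip' k' f' (L ` V) \<and>
    \<bar>Determinant.det (Matrix.mat k k (\<lambda>(i, j). ip' (f i) (L (e j))))\<bar> = \<bar>Determinant.det (Matrix.mat k' k' (\<lambda>(i, j). ip' (f' i) (L (e' j))))\<bar>"
    using e f by blast
  fix dd assume "\<exists>k' e' f'. orthonormal_basis ip k' e' V \<and> orthonormal_basis ip' k' f' (L ` V) \<and>
    dd = \<bar>Determinant.det (Matrix.mat k' k' (\<lambda>(i, j). ip' (f' i) (L (e' j))))\<bar>"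
  then obtain k' e' f' where *: "orthonormal_basis ip k' e' V" "orthonormal_basis ip' k' f' (L ` V)"
    "dd = \<bar>Determinant.det (Matrix.mat k' k' (\<lambda>(i, j). ip' (f' i) (L (e' j))))\<bar>" by blast
  have "k' = k" using orthonormal_inj_independent(3)[OF ip(1)] * e by metis
  note e' = *(1)[unfolded \<open>k' = k\<close>] and f' = *(2)[unfolded \<open>k' = k\<close>]
  let ?M = "Matrix.mat k k (\<lambda>(i, j). ip' (f i) (L (e j)))"
  let ?M' = "Matrix.mat k k (\<lambda>(i, j). ip' (f' i) (L (e' j)))"
  let ?U = "Matrix.mat k k (\<lambda>(i, j). ip (e i) (e' j))"
  let ?W = "Matrix.mat k k (\<lambda>(i, j). ip' (f' i) (f j))"
  have "?M' = ?W * (?M * ?U)"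
  proof (rule eq_matI)
    fix i j assume "i < dim_row (?W * (?M * ?U))" "j < dim_col (?W * (?M * ?U))"
    then have ij: "i < k" "j < k" by auto
    have e'V: "e' j \<in> V" using orthonormal_in[OF e' ij(2)] .
    have 1: "ip' (f m) (L (e' j)) = (\<Sum>l<k. ip' (f m) (L (e l)) * ip (e l) (e' j))" for m
    proof -
      have "L (e' j) = (\<Sum>l<k. ip (e l) (e' j) *\<^sub>R L (e l))"
        by (subst orthonormal_expansion[OF ip(1) e e'V]) (simp add: linear_sum[OF L] linear_cmul[OF L])
      then show ?thesis by (simp add: ip_simps[OF ip(2)] mult.commute)
    qed
    have "L (e' j) = (\<Sum>m<k. ip' (f m) (L (e' j)) *\<^sub>R f m)"
      by (rule orthonormal_expansion[OF ip(2) f]) (use e'V in blast)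
    then have "ip' (f' i) (L (e' j)) = ip' (f' i) (\<Sum>m<k. ip' (f m) (L (e' j)) *\<^sub>R f m)" by simp
    also have "\<dots> = (\<Sum>m<k. ip' (f' i) (f m) * ip' (f m) (L (e' j)))" by (simp add: ip_simps[OF ip(2)] mult.commute)
    also have "\<dots> = (\<Sum>m<k. ip' (f' i) (f m) * (\<Sum>l<k. ip' (f m) (L (e l)) * ip (e l) (e' j)))" unfolding 1 ..
    also have "\<dots> = (?W * (?M * ?U)) $$ (i, j)"
      using ij by (simp add: scalar_prod_def atLeast0LessThan)
    finally show "?M' $$ (i, j) = (?W * (?M * ?U)) $$ (i, j)" using ij by simp
  qed auto
  then have "Determinant.det ?M' = Determinant.det ?W * (Determinant.det ?M * Determinant.det ?U)"
    using Determinant.det_mult[of ?W k "?M * ?U"] Determinant.det_mult[of ?M k ?U] mult_carrier_mat[of ?M k k ?U k]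
    by simp
  then have "\<bar>Determinant.det ?M'\<bar> = \<bar>Determinant.det ?M\<bar>"
    using det_orthonormal_change[OF ip(1) e e'] det_orthonormal_change[OF ip(2) f' f] by (simp add: abs_mult)
  then show "dd = \<bar>Determinant.det ?M\<bar>" using *(3) \<open>k' = k\<close> by simp
qed


subsection \<open>Strict derivatives and their existence for flows\<close>

text \<open>Cones are tested on pairs of points near a centre, neither of which need be the centre.
  Hence increments between two moving points are compared with the derivative at \<open>a\<close>,
  not only increments starting at \<open>a\<close>.\<close>

definition has_strict_derivative ::
    "('a::real_normed_vector \<Rightarrow> 'b::real_normed_vector) \<Rightarrow> ('a \<Rightarrow> 'b) \<Rightarrow> 'a \<Rightarrow> bool" where
  "has_strict_derivative f L a \<longleftrightarrow> bounded_linear L \<and>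
     (\<forall>e>0. \<exists>r>0. \<forall>y\<in>ball a r. \<forall>z\<in>ball a r. norm (f y - f z - L (y - z)) \<le> e * norm (y - z))"

lemma has_strict_derivativeD:
  assumes "has_strict_derivative f L a" "e > 0"
  obtains r where "r > 0"
    "\<And>y z. y \<in> ball a r \<Longrightarrow> z \<in> ball a r \<Longrightarrow> norm (f y - f z - L (y - z)) \<le> e * norm (y - z)"
  using assms unfolding has_strict_derivative_def by meson

lemma has_strict_derivative_imp_has_derivative:
  assumes "has_strict_derivative f L a"
  shows "(f has_derivative L) (at a)"
  unfolding has_derivative_at_alt
proof (intro conjI allI impI)
  show "bounded_linear L" using assms by (simp add: has_strict_derivative_def)
  fix e :: real assume "e > 0"
  then obtain r where r: "r > 0" "\<And>y z. y \<in> ball a r \<Longrightarrow> z \<in> ball a r \<Longrightarrow> norm (f y - f z - L (y - z)) \<le> e * norm (y - z)"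
    using has_strict_derivativeD[OF assms] by metis
  then show "\<exists>d>0. \<forall>y. norm (y - a) < d \<longrightarrow> norm (f y - f a - L (y - a)) \<le> e * norm (y - a)"
    by (intro exI[of _ r]) (auto simp: dist_norm norm_minus_commute)
qed

lemma has_strict_derivative_lipschitz:
  assumes "has_strict_derivative f L a"
  obtains r K where "r > 0" "K > 0"
    "\<And>y z. y \<in> ball a r \<Longrightarrow> z \<in> ball a r \<Longrightarrow> norm (f y - f z) \<le> K * norm (y - z)"
proof -
  have "bounded_linear L" using assms by (simp add: has_strict_derivative_def)
  then obtain B where B: "B > 0" "\<And>v. norm (L v) \<le> norm v * B" using bounded_linear.pos_bounded by blast
  obtain r where r: "r > 0" "\<And>y z. y \<in> ball a r \<Longrightarrow> z \<in> ball a r \<Longrightarrow> norm (f y - f z - L (y - z)) \<le> 1 * norm (y - z)"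
    by (rule has_strict_derivativeD[OF assms, of 1]) auto
  have "norm (f y - f z) \<le> (B + 1) * norm (y - z)" if "y \<in> ball a r" "z \<in> ball a r" for y z
    using r(2)[OF that] B(2)[of "y - z"] norm_triangle_ineq2[of "f y - f z" "L (y - z)"]
    by (simp add: algebra_simps)
  then show ?thesis using \<open>r > 0\<close> B by (intro that[of r "B + 1"]) auto
qed

lemma has_strict_derivative_compose:
  assumes f: "has_strict_derivative f L a" and g: "has_strict_derivative g M (f a)"
  shows "has_strict_derivative (g \<circ> f) (M \<circ> L) a"
  unfolding has_strict_derivative_def
proof (intro conjI allI impI)
  have bl: "bounded_linear L" "bounded_linear M" using f g by (auto simp: has_strict_derivative_def)
  show "bounded_linear (M \<circ> L)" using bl by (simp add: o_def bounded_linear_compose)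
  fix e :: real assume e: "e > 0"
  obtain B where B: "B > 0" "\<And>v. norm (M v) \<le> norm v * B" using bl bounded_linear.pos_bounded by blast
  obtain r1 K where r1: "r1 > 0" "K > 0" "\<And>y z. y \<in> ball a r1 \<Longrightarrow> z \<in> ball a r1 \<Longrightarrow> norm (f y - f z) \<le> K * norm (y - z)"
    using has_strict_derivative_lipschitz[OF f] by metis
  have "e / (2 * K) > 0" using e r1 by simp
  then obtain r2 where r2: "r2 > 0" "\<And>y z. y \<in> ball (f a) r2 \<Longrightarrow> z \<in> ball (f a) r2 \<Longrightarrow> norm (g y - g z - M (y - z)) \<le> e / (2 * K) * norm (y - z)"
    using has_strict_derivativeD[OF g] by metis
  have "e / (2 * B) > 0" using e B by simp
  then obtain r3 where r3: "r3 > 0" "\<And>y z. y \<in> ball a r3 \<Longrightarrow> z \<in> ball a r3 \<Longrightarrow> norm (f y - f z - L (y - z)) \<le> e / (2 * B) * norm (y - z)"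
    using has_strict_derivativeD[OF f] by metis
  define r where "r = min (min r1 r3) (r2 / K)"
  have r: "r > 0" "r \<le> r1" "r \<le> r3" "r \<le> r2 / K" using r1 r2 r3 by (auto simp: r_def)
  then have Kr: "K * r \<le> r2" using r1(2) by (simp add: field_simps)
  have fb: "f y \<in> ball (f a) r2" if "y \<in> ball a r" for y
  proof -
    have "norm (f a - f y) \<le> K * norm (a - y)" using r1(3)[of a y] that r by auto
    also have "\<dots> < K * r" using that r1(2) by (simp add: dist_norm)
    finally show ?thesis using Kr by (simp add: dist_norm)
  qed
  have "norm ((g \<circ> f) y - (g \<circ> f) z - (M \<circ> L) (y - z)) \<le> e * norm (y - z)"
    if "y \<in> ball a r" "z \<in> ball a r" for y z
  proof -
    have "(g \<circ> f) y - (g \<circ> f) z - (M \<circ> L) (y - z) = (g (f y) - g (f z) - M (f y - f z)) + M (f y - f z - L (y - z))"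
      by (simp add: linear_diff[OF bounded_linear.linear[OF bl(2)]])
    then have "norm ((g \<circ> f) y - (g \<circ> f) z - (M \<circ> L) (y - z)) \<le> norm (g (f y) - g (f z) - M (f y - f z)) + norm (M (f y - f z - L (y - z)))"
      by (metis norm_triangle_ineq)
    also have "\<dots> \<le> e / (2 * K) * norm (f y - f z) + norm (f y - f z - L (y - z)) * B"
      by (intro add_mono r2 fb that B)
    also have "\<dots> \<le> e / (2 * K) * (K * norm (y - z)) + (e / (2 * B) * norm (y - z)) * B"
      using that r B e r1(2) by (intro add_mono mult_left_mono mult_right_mono r1 r3) auto
    also have "\<dots> = e * norm (y - z)" using B r1 by simp
    finally show ?thesis .
  qed
  then show "\<exists>r>0. \<forall>y\<in>ball a r. \<forall>z\<in>ball a r. norm ((g \<circ> f) y - (g \<circ> f) z - (M \<circ> L) (y - z)) \<le> e * norm (y - z)"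
    using r by blast
qed

lemma has_strict_derivative_transfer:
  assumes f: "has_strict_derivative f L a" and S: "open S" "a \<in> S" "\<And>y. y \<in> S \<Longrightarrow> f y = g y"
  shows "has_strict_derivative g L a"
  unfolding has_strict_derivative_def
proof (intro conjI allI impI)
  show "bounded_linear L" using f by (auto simp: has_strict_derivative_def)
  fix e :: real assume e: "e > 0"
  obtain r where r: "r > 0" "\<And>y z. y \<in> ball a r \<Longrightarrow> z \<in> ball a r \<Longrightarrow> norm (f y - f z - L (y - z)) \<le> e * norm (y - z)"
    using has_strict_derivativeD[OF f e] by metis
  obtain s where s: "s > 0" "ball a s \<subseteq> S" using S by (meson openE)
  show "\<exists>r>0. \<forall>y\<in>ball a r. \<forall>z\<in>ball a r. norm (g y - g z - L (y - z)) \<le> e * norm (y - z)"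
  proof (intro exI[of _ "min r s"] conjI ballI)
    fix y z assume "y \<in> ball a (min r s)" "z \<in> ball a (min r s)"
    then have "y \<in> ball a r" "z \<in> ball a r" "y \<in> S" "z \<in> S" using s by auto
    then show "norm (g y - g z - L (y - z)) \<le> e * norm (y - z)" using r(2)[of y z] S(3) by simp
  qed (use r s in auto)
qed

text \<open>Strictness at one point already contains continuity of the derivative there: near
  \<open>y\<close> an increment is approximated both by \<open>D\<close> and by \<open>L\<close>, so
  the two agree up to \<open>e\<close>.\<close>

lemma has_strict_derivative_nearby:
  assumes f: "has_strict_derivative f L a" and e: "e > 0"
  obtains r where "r > 0"
    "\<And>y D v. y \<in> ball a r \<Longrightarrow> (f has_derivative D) (at y) \<Longrightarrow> norm (D v - L v) \<le> e * norm v"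
proof -
  have bl: "bounded_linear L" using f by (auto simp: has_strict_derivative_def)
  obtain r where r: "r > 0" "\<And>y z. y \<in> ball a r \<Longrightarrow> z \<in> ball a r \<Longrightarrow> norm (f y - f z - L (y - z)) \<le> e * norm (y - z)"
    using has_strict_derivativeD[OF f e] by metis
  have "norm (D v - L v) \<le> e * norm v" if y: "y \<in> ball a r" and D: "(f has_derivative D) (at y)" for y D v
  proof (cases "v = 0")
    case True
    then show ?thesis using D bl by (simp add: bounded_linear.linear[THEN linear_0] has_derivative_bounded_linear)
  next
    case False
    show ?thesis
    proof (rule field_le_epsilon)
      fix e2 :: real assume "e2 > 0"
      define e1 where "e1 = e2 / norm v"
      have "e1 > 0" using \<open>e2 > 0\<close> False by (simp add: e1_def)
      then obtain d where d: "d > 0" "\<And>z. norm (z - y) < d \<Longrightarrow> norm (f z - f y - D (z - y)) \<le> e1 * norm (z - y)"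
        using D unfolding has_derivative_at_alt by meson
      have "0 < min d (r - dist a y)" using d y by simp
      \<comment> \<open>The increment along \<open>v\<close> must be short enough for the expansion
        of \<open>f\<close> at \<open>y\<close> and must keep \<open>z\<close> inside the ball
        around \<open>a\<close>.\<close>
      define t where "t = min d (r - dist a y) / (2 * norm v)"
      have t: "t > 0" using \<open>0 < min d _\<close> False by (simp add: t_def)
      have "t * norm v = min d (r - dist a y) / 2" using False by (simp add: t_def)
      then have tv: "t * norm v < d" "t * norm v < r - dist a y"
        using \<open>0 < min d _\<close> by (auto simp: min_def split: if_splits)
      define z where "z = y + t *\<^sub>R v"
      have nz: "norm (z - y) = t * norm v" using t by (simp add: z_def)
      have "dist a z \<le> dist a y + dist y z" by (rule dist_triangle)
      then have "z \<in> ball a r" using tv nz by (simp add: dist_norm norm_minus_commute)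
      have "norm (D (z - y) - L (z - y)) \<le> norm (f z - f y - L (z - y)) + norm (f z - f y - D (z - y))"
        using norm_triangle_ineq4[of "f z - f y - L (z - y)" "f z - f y - D (z - y)"] by simp
      also have "\<dots> \<le> e * (t * norm v) + e1 * (t * norm v)"
        using r(2)[OF \<open>z \<in> ball a r\<close> y] d(2)[of z] nz tv by simp
      finally have "norm (D (z - y) - L (z - y)) \<le> t * ((e + e1) * norm v)" by (simp add: algebra_simps)
      moreover have "D (z - y) - L (z - y) = t *\<^sub>R (D v - L v)"
        using bl D by (simp add: z_def bounded_linear.linear linear_cmul has_derivative_bounded_linear scaleR_diff_right)
      ultimately have "norm (D v - L v) \<le> (e + e1) * norm v" using t by simp
      then show "norm (D v - L v) \<le> e * norm v + e2" using False by (simp add: e1_def algebra_simps)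
    qed
  qed
  then show ?thesis using that r(1) by blast
qed

lemma linear_basis_expansion:
  fixes f :: "'a::euclidean_space \<Rightarrow> 'b::real_normed_vector"
  assumes "linear f"
  shows "f v = (\<Sum>b\<in>Basis. (v \<bullet> b) *\<^sub>R f b)"
  using linear_sum[OF assms, of "\<lambda>b. (v \<bullet> b) *\<^sub>R b" Basis] linear_cmul[OF assms]
  by (simp add: euclidean_representation)

lemma linear_bound_on_basis:
  fixes f :: "'a::euclidean_space \<Rightarrow> 'b::real_normed_vector"
  assumes "linear f" and e: "\<And>b. b \<in> Basis \<Longrightarrow> norm (f b) \<le> e"
  shows "norm (f v) \<le> real DIM('a) * e * norm v"
proof -
  have "norm (\<Sum>b\<in>Basis. (v \<bullet> b) *\<^sub>R f b) \<le> (\<Sum>b\<in>(Basis :: 'a set). norm v * e)"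
  proof (rule sum_norm_le)
    fix b :: 'a assume "b \<in> Basis"
    then show "norm ((v \<bullet> b) *\<^sub>R f b) \<le> norm v * e"
      using Basis_le_norm[of b v] e[of b] by (simp add: mult_mono)
  qed
  then show ?thesis using linear_basis_expansion[OF assms(1), of v] by (simp add: mult_ac)
qed

text \<open>The radius is uniform in the base point \<open>u\<close>. This is needed for flows,
  where the base point runs along an orbit.\<close>

lemma C1_uniform_linearization:
  fixes f :: "'a::euclidean_space \<Rightarrow> 'b::real_normed_vector"
  assumes der: "\<And>x. x \<in> cball a \<rho> \<Longrightarrow> (f has_derivative f' x) (at x)"
    and cont: "\<And>v. continuous_on (cball a \<rho>) (\<lambda>x. f' x v)" and e: "e > 0"
  shows "\<exists>r>0. \<forall>u\<in>cball a \<rho>. \<forall>y\<in>cball a \<rho>. \<forall>z\<in>cball a \<rho>. dist y u < r \<longrightarrow> dist z u < r \<longrightarrow>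
       norm (f y - f z - f' u (y - z)) \<le> e * norm (y - z)"
proof -
  have lin: "bounded_linear (f' x)" if "x \<in> cball a \<rho>" for x using der[OF that] by (rule has_derivative_bounded_linear)
  define e1 where "e1 = e / DIM('a)"
  have "e1 > 0" using e by (simp add: e1_def)
  have "\<exists>r>0. \<forall>x\<in>cball a \<rho>. \<forall>u\<in>cball a \<rho>. dist x u < r \<longrightarrow> dist (f' x b) (f' u b) < e1" for b
    using compact_uniformly_continuous[OF cont compact_cball, of b] \<open>e1 > 0\<close>
    unfolding uniformly_continuous_on_def by blast
  then obtain R where R: "\<And>b. R b > 0" "\<And>b x u. x \<in> cball a \<rho> \<Longrightarrow> u \<in> cball a \<rho> \<Longrightarrow> dist x u < R b \<Longrightarrow> dist (f' x b) (f' u b) < e1"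
    by metis
  \<comment> \<open>Continuity is given for each fixed direction; finitely many basis directions
    control the whole derivative.\<close>
  define r where "r = Min (R ` (Basis :: 'a set))"
  have r: "r > 0" "\<And>b. b \<in> Basis \<Longrightarrow> r \<le> R b" using R by (auto simp: r_def)
  have on: "norm (f' x v - f' u v) \<le> e * norm v" if x: "x \<in> cball a \<rho>" "u \<in> cball a \<rho>" "dist x u < r" for x u v
  proof -
    have l: "linear (\<lambda>v. f' x v - f' u v)" using lin x by (intro linear_compose_sub bounded_linear.linear)
    have "norm (f' x b - f' u b) \<le> e1" if b: "b \<in> Basis" for b
      using R(2)[OF x(1,2), of b] r(2)[OF b] x(3) by (simp add: dist_norm)
    from linear_bound_on_basis[OF l this] show ?thesis by (simp add: e1_def)
  qed
  have "norm (f y - f z - f' u (y - z)) \<le> e * norm (y - z)"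
    if u: "u \<in> cball a \<rho>" "y \<in> cball a \<rho>" "z \<in> cball a \<rho>" "dist y u < r" "dist z u < r" for u y z
  proof -
    have "norm (f y - f z - f' u (y - z)) \<le> norm (y - z) * e"
    proof (rule differentiable_bound_linearization[where S="cball a \<rho> \<inter> ball u r"])
      fix t :: real assume "t \<in> {0..1}"
      have "convex (cball a \<rho> \<inter> ball u r)" by (intro convex_Int convex_cball convex_ball)
      then have "(1 - t) *\<^sub>R z + t *\<^sub>R y \<in> cball a \<rho> \<inter> ball u r"
        by (rule convexD) (use u \<open>t \<in> {0..1}\<close> in \<open>auto simp: dist_commute\<close>)
      then show "z + t *\<^sub>R (y - z) \<in> cball a \<rho> \<inter> ball u r" by (simp add: algebra_simps)
    next
      fix x assume "x \<in> cball a \<rho> \<inter> ball u r"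
      then show "(f has_derivative f' x) (at x within cball a \<rho> \<inter> ball u r)"
        using der by (auto intro: has_derivative_at_withinI)
    next
      fix x assume x: "x \<in> cball a \<rho> \<inter> ball u r"
      show "onorm (f' x - f' u) \<le> e"
        using on[of x u] x u e by (intro onorm_le) (auto simp: dist_commute)
    next
      show "u \<in> cball a \<rho> \<inter> ball u r" using u r by auto
    qed
    then show ?thesis by (simp add: mult.commute)
  qed
  then show ?thesis using r(1) by blast
qed

lemma Ck_on_1_has_strict_derivative:
  fixes f :: "'a::euclidean_space \<Rightarrow> 'b::real_normed_vector"
  assumes f: "Ck_on (Suc 0) f S" and S: "open S" "a \<in> S"
  shows "has_strict_derivative f (frechet_derivative f (at a)) a"
proof -
  obtain f' where f': "\<And>x. x \<in> S \<Longrightarrow> (f has_derivative f' x) (at x)" "\<And>v. continuous_on S (\<lambda>x. f' x v)"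
    using f by auto
  obtain \<rho> where \<rho>: "\<rho> > 0" "cball a \<rho> \<subseteq> S" using S open_contains_cball by blast
  have "frechet_derivative f (at a) = f' a" using frechet_derivative_at[OF f'(1)[OF S(2)]] by simp
  have der: "(f has_derivative f' x) (at x)" if "x \<in> cball a \<rho>" for x using f' \<rho> that by blast
  have cont: "continuous_on (cball a \<rho>) (\<lambda>x. f' x v)" for v using f' \<rho> continuous_on_subset by blast
  have "has_strict_derivative f (f' a) a"
    unfolding has_strict_derivative_def
  proof (intro conjI allI impI)
    show "bounded_linear (f' a)" using f'(1)[OF S(2)] by (rule has_derivative_bounded_linear)
    fix e :: real assume "e > 0"
    obtain r where r: "r > 0" "\<forall>u\<in>cball a \<rho>. \<forall>y\<in>cball a \<rho>. \<forall>z\<in>cball a \<rho>. dist y u < r \<longrightarrow> dist z u < r \<longrightarrow>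
       norm (f y - f z - f' u (y - z)) \<le> e * norm (y - z)"
      using C1_uniform_linearization[OF der cont \<open>e > 0\<close>] by blast
    show "\<exists>r>0. \<forall>y\<in>ball a r. \<forall>z\<in>ball a r. norm (f y - f z - f' a (y - z)) \<le> e * norm (y - z)"
      using r \<rho>(1) by (intro exI[of _ "min r \<rho>"]) (auto simp: dist_commute)
  qed
  with \<open>frechet_derivative f (at a) = f' a\<close> show ?thesis by simp
qed

text \<open>A property of differences of \<open>f\<close> alone, so it can be checked before a
  derivative is known. Three increments are what additivity requires; the other uses fill up with
  trivial increments.\<close>

definition small_on_null_combinations ::
    "('a::real_normed_vector \<Rightarrow> 'b::real_normed_vector) \<Rightarrow> 'a set \<Rightarrow> real \<Rightarrow> bool" where
  "small_on_null_combinations f B e \<longleftrightarrow>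
     (\<forall>a1\<in>B. \<forall>b1\<in>B. \<forall>a2\<in>B. \<forall>b2\<in>B. \<forall>a3\<in>B. \<forall>b3\<in>B. \<forall>s1 s2 s3.
        s1 *\<^sub>R (a1 - b1) + s2 *\<^sub>R (a2 - b2) + s3 *\<^sub>R (a3 - b3) = 0 \<longrightarrow>
        norm (s1 *\<^sub>R (f a1 - f b1) + s2 *\<^sub>R (f a2 - f b2) + s3 *\<^sub>R (f a3 - f b3))
        \<le> e * (\<bar>s1\<bar> * norm (a1 - b1) + \<bar>s2\<bar> * norm (a2 - b2) + \<bar>s3\<bar> * norm (a3 - b3)))"

lemma small_on_null_combinationsD:
  assumes "small_on_null_combinations f B e" "a1 \<in> B" "b1 \<in> B" "a2 \<in> B" "b2 \<in> B" "a3 \<in> B" "b3 \<in> B"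
    "s1 *\<^sub>R (a1 - b1) + s2 *\<^sub>R (a2 - b2) + s3 *\<^sub>R (a3 - b3) = 0"
  shows "norm (s1 *\<^sub>R (f a1 - f b1) + s2 *\<^sub>R (f a2 - f b2) + s3 *\<^sub>R (f a3 - f b3))
        \<le> e * (\<bar>s1\<bar> * norm (a1 - b1) + \<bar>s2\<bar> * norm (a2 - b2) + \<bar>s3\<bar> * norm (a3 - b3))"
  using assms unfolding small_on_null_combinations_def by blast

text \<open>A Cauchy criterion: if all vanishing combinations of three increments are mapped to
  negligible ones, then difference quotients converge and the limit is additive, homogeneous and a
  strict derivative.\<close>

lemma strict_derivative_exists:
  fixes f :: "'a::euclidean_space \<Rightarrow> 'b::banach"
  assumes comb: "\<And>e. e > 0 \<Longrightarrow> \<exists>r>0. small_on_null_combinations f (ball a r) e"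
  shows "\<exists>L. has_strict_derivative f L a"
proof -
  define \<sigma> where "\<sigma> n = inverse (real (Suc n))" for n
  have \<sigma>: "\<sigma> n > 0" "\<sigma> \<longlonglongrightarrow> 0" for n unfolding \<sigma>_def by (simp, rule LIMSEQ_inverse_real_of_nat)
  define E where "E n h = (f (a + \<sigma> n *\<^sub>R h) - f a) /\<^sub>R \<sigma> n" for n h
  have near: "\<forall>\<^sub>F n in sequentially. a + \<sigma> n *\<^sub>R h \<in> ball a r" if "r > 0" for h r
  proof -
    have "(\<lambda>n. a + \<sigma> n *\<^sub>R h) \<longlonglongrightarrow> a + 0 *\<^sub>R h" by (intro tendsto_intros \<sigma>)
    then show ?thesis using tendstoD[OF _ that, of "\<lambda>n. a + \<sigma> n *\<^sub>R h" a sequentially] by (simp add: dist_commute)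
  qed
  have "Cauchy (\<lambda>n. E n h)" for h
  proof (rule metric_CauchyI)
    fix e :: real assume "e > 0"
    \<comment> \<open>The two quotients contribute \<open>2 * norm h\<close> to the error; adding 1
      keeps the divisor positive for \<open>h = 0\<close>.\<close>
    define d where "d = 2 * norm h + 1"
    have d: "d > 0" "2 * norm h < d" by (simp_all add: d_def add_nonneg_pos)
    define e1 where "e1 = e / d"
    have "e1 > 0" using \<open>e > 0\<close> d by (simp add: e1_def)
    then obtain r where r: "r > 0" "small_on_null_combinations f (ball a r) e1"
      using comb by blast
    obtain N where N: "\<And>n. n \<ge> N \<Longrightarrow> a + \<sigma> n *\<^sub>R h \<in> ball a r"
      using near[OF r(1), of h] unfolding eventually_sequentially by blast
    have "dist (E m h) (E n h) < e" if "m \<ge> N" "n \<ge> N" for m n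
    proof -
      have "norm ((1 / \<sigma> m) *\<^sub>R (f (a + \<sigma> m *\<^sub>R h) - f a) + (- 1 / \<sigma> n) *\<^sub>R (f (a + \<sigma> n *\<^sub>R h) - f a) + 0 *\<^sub>R (f a - f a))
          \<le> e1 * (\<bar>1 / \<sigma> m\<bar> * norm (a + \<sigma> m *\<^sub>R h - a) + \<bar>- 1 / \<sigma> n\<bar> * norm (a + \<sigma> n *\<^sub>R h - a) + \<bar>0\<bar> * norm (a - a))"
        by (rule small_on_null_combinationsD[OF r(2)]) (use N that r(1) \<sigma>(1) less_imp_neq[OF \<sigma>(1), symmetric] in simp_all)
      then have "norm (E m h - E n h) \<le> e1 * (2 * norm h)"
        using \<sigma>(1)[of m] \<sigma>(1)[of n] by (simp add: E_def divide_inverse_commute mult.assoc[symmetric])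
      also have "\<dots> < e1 * d" using \<open>e1 > 0\<close> d by simp
      also have "\<dots> = e" using d by (simp add: e1_def)
      finally show ?thesis by (simp add: dist_norm)
    qed
    then show "\<exists>M. \<forall>m\<ge>M. \<forall>n\<ge>M. dist (E m h) (E n h) < e" by blast
  qed
  then have "\<exists>l. (\<lambda>n. E n h) \<longlonglongrightarrow> l" for h using Cauchy_convergent_iff convergent_def by blast
  then obtain L where L: "\<And>h. (\<lambda>n. E n h) \<longlonglongrightarrow> L h" by metis
  \<comment> \<open>A vanishing combination of vectors gives a vanishing combination of limits: the
    error bound \<open>e * Q\<close> persists in the limit, and \<open>e\<close> is arbitrary.
    Additivity and homogeneity of \<open>L\<close> are special cases.\<close>
  have small: "norm (L k + c1 *\<^sub>R L h1 + c2 *\<^sub>R L h2) = 0" if k: "k + c1 *\<^sub>R h1 + c2 *\<^sub>R h2 = 0" for k h1 h2 c1 c2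
  proof -
    define Q where "Q = norm k + \<bar>c1\<bar> * norm h1 + \<bar>c2\<bar> * norm h2"
    have "norm (L k + c1 *\<^sub>R L h1 + c2 *\<^sub>R L h2) \<le> e * Q" if "e > 0" for e
    proof -
      obtain r where r: "r > 0" "small_on_null_combinations f (ball a r) e"
      using comb[OF \<open>e > 0\<close>] by blast
      show ?thesis
      proof (rule tendsto_upperbound)
        show "(\<lambda>n. norm (E n k + c1 *\<^sub>R E n h1 + c2 *\<^sub>R E n h2)) \<longlonglongrightarrow> norm (L k + c1 *\<^sub>R L h1 + c2 *\<^sub>R L h2)"
          by (intro tendsto_intros L)
        show "\<forall>\<^sub>F n in sequentially. norm (E n k + c1 *\<^sub>R E n h1 + c2 *\<^sub>R E n h2) \<le> e * Q"
          using near[OF r(1), of k] near[OF r(1), of h1] near[OF r(1), of h2]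
        proof eventually_elim
          case (elim n)
          have *: "norm ((1 / \<sigma> n) *\<^sub>R (f (a + \<sigma> n *\<^sub>R k) - f a) + (c1 / \<sigma> n) *\<^sub>R (f (a + \<sigma> n *\<^sub>R h1) - f a) + (c2 / \<sigma> n) *\<^sub>R (f (a + \<sigma> n *\<^sub>R h2) - f a))
            \<le> e * (\<bar>1 / \<sigma> n\<bar> * norm (a + \<sigma> n *\<^sub>R k - a) + \<bar>c1 / \<sigma> n\<bar> * norm (a + \<sigma> n *\<^sub>R h1 - a) + \<bar>c2 / \<sigma> n\<bar> * norm (a + \<sigma> n *\<^sub>R h2 - a))"
            by (rule small_on_null_combinationsD[OF r(2)]) (use elim r(1) less_imp_neq[OF \<sigma>(1), symmetric] k in auto)
          have "inverse (\<sigma> n) * (\<sigma> n * x) = x" for x using \<sigma>(1)[of n] by simp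
          with * show ?case using \<sigma>(1)[of n] by (simp add: E_def Q_def divide_inverse abs_mult mult.assoc)
        qed
      qed simp
    qed
    note * = this
    have "norm (L k + c1 *\<^sub>R L h1 + c2 *\<^sub>R L h2) \<le> 0 + e" if "e > 0" for e
    proof -
      have "Q \<ge> 0" by (simp add: Q_def)
      have "e / (Q + 1) * Q \<le> e" using \<open>e > 0\<close> \<open>Q \<ge> 0\<close> by (simp add: field_simps)
      then show ?thesis using *[of "e / (Q + 1)"] \<open>e > 0\<close> \<open>Q \<ge> 0\<close> by (simp add: order_trans)
    qed
    then have "norm (L k + c1 *\<^sub>R L h1 + c2 *\<^sub>R L h2) \<le> 0" by (rule field_le_epsilon)
    then show ?thesis by simp
  qed
  have "linear L"
  proof (rule linearI)
    fix x y
    have "norm (L (x + y) + (-1) *\<^sub>R L x + (-1) *\<^sub>R L y) = 0" by (rule small) simp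
    then show "L (x + y) = L x + L y" by (simp add: algebra_simps)
  next
    fix c x
    have "norm (L (c *\<^sub>R x) + (-c) *\<^sub>R L x + 0 *\<^sub>R L x) = 0" by (rule small) simp
    then show "L (c *\<^sub>R x) = c *\<^sub>R L x" by simp
  qed
  have "has_strict_derivative f L a"
    unfolding has_strict_derivative_def
  proof (intro conjI allI impI)
    show "bounded_linear L" using \<open>linear L\<close> by (simp add: linear_conv_bounded_linear)
    fix e :: real assume "e > 0"
    \<comment> \<open>The increment \<open>y - z\<close> and its rescaled copy at \<open>a\<close>
      each contribute \<open>norm (y - z)\<close>, which accounts for the half.\<close>
    then have "e / 2 > 0" by simp
    then obtain r where r: "r > 0" "small_on_null_combinations f (ball a r) (e/2)"
      using comb by blast
    have "norm (f y - f z - L (y - z)) \<le> e * norm (y - z)" if yz: "y \<in> ball a r" "z \<in> ball a r" for y z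
    proof (rule tendsto_upperbound)
      show "(\<lambda>n. norm (f y - f z - E n (y - z))) \<longlonglongrightarrow> norm (f y - f z - L (y - z))"
        by (intro tendsto_intros L)
      show "\<forall>\<^sub>F n in sequentially. norm (f y - f z - E n (y - z)) \<le> e * norm (y - z)"
        using near[OF r(1), of "y - z"]
      proof eventually_elim
        case (elim n)
        have nz: "\<sigma> n \<noteq> 0" "\<bar>\<sigma> n\<bar> = \<sigma> n" using \<sigma>(1)[of n] by simp_all
        have "norm (1 *\<^sub>R (f y - f z) + (- inverse (\<sigma> n)) *\<^sub>R (f (a + \<sigma> n *\<^sub>R (y - z)) - f a) + 0 *\<^sub>R (f a - f a))
          \<le> e/2 * (\<bar>1\<bar> * norm (y - z) + \<bar>- inverse (\<sigma> n)\<bar> * norm (a + \<sigma> n *\<^sub>R (y - z) - a) + \<bar>0\<bar> * norm (a - a))"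
          by (rule small_on_null_combinationsD[OF r(2)]) (use elim yz r(1) nz in simp_all)
        also have "\<dots> = e * norm (y - z)" using nz by simp
        finally show ?case by (simp add: E_def)
      qed
    qed simp
    then show "\<exists>r>0. \<forall>y\<in>ball a r. \<forall>z\<in>ball a r. norm (f y - f z - L (y - z)) \<le> e * norm (y - z)"
      using r(1) by blast
  qed
  then show ?thesis by blast
qed

section \<open>Short-time comparison and differentiability of local flows\<close>

lemma gronwall_short_time:
  fixes w :: "real \<Rightarrow> 'a::real_normed_vector"
  assumes der: "\<And>s. s \<in> {0..T} \<Longrightarrow> (w has_vector_derivative w' s) (at s within {0..T})"
    and bd: "\<And>s. s \<in> {0..T} \<Longrightarrow> norm (w' s) \<le> K * norm (w s) + \<eta>"
    and K: "K \<ge> 0" "K * T \<le> 1/2" "\<eta> \<ge> 0" and t: "t \<in> {0..T}"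
  shows "norm (w t) \<le> 2 * (norm (w 0) + \<eta> * T)"
proof -
  have "continuous_on {0..T} w"
    using der by (meson continuous_on_eq_continuous_within has_vector_derivative_continuous)
  then have "continuous_on {0..T} (\<lambda>s. norm (w s))" by (intro continuous_intros)
  \<comment> \<open>At the maximum of the norm, \<open>K * T \<le> 1/2\<close> lets the growth term
    be absorbed in half of the left-hand side. The factor 2 in the conclusion results from this and
    replaces the usual exponential.\<close>
  then obtain m where m: "m \<in> {0..T}" "\<And>s. s \<in> {0..T} \<Longrightarrow> norm (w s) \<le> norm (w m)"
    using continuous_attains_sup[of "{0..T}" "\<lambda>s. norm (w s)"] t by auto
  have "norm (w m - w 0) \<le> (K * norm (w m) + \<eta>) * norm (m - 0)"
  proof (rule differentiable_bound[where S="{0..T}" and f'="\<lambda>s h. h *\<^sub>R w' s"])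
    fix s assume s: "s \<in> {0..T}"
    show "(w has_derivative (\<lambda>h. h *\<^sub>R w' s)) (at s within {0..T})"
      using der[OF s] by (simp add: has_vector_derivative_def)
    have "norm (w' s) \<le> K * norm (w m) + \<eta>"
      using bd[OF s] mult_left_mono[OF m(2)[OF s] K(1)] by linarith
    then show "onorm (\<lambda>h. h *\<^sub>R w' s) \<le> K * norm (w m) + \<eta>"
      by (intro onorm_le) (simp add: mult.commute mult_left_mono)
  qed (use m t in auto)
  also have "\<dots> \<le> (K * norm (w m) + \<eta>) * T"
    using m(1) K by (intro mult_left_mono) auto
  also have "\<dots> = K * T * norm (w m) + \<eta> * T" by (simp add: algebra_simps)
  also have "\<dots> \<le> norm (w m) / 2 + \<eta> * T" using mult_right_mono[OF K(2), of "norm (w m)"] by simp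
  finally have "norm (w m) \<le> 2 * (norm (w 0) + \<eta> * T)"
    using norm_triangle_ineq2[of "w m" "w 0"] by (simp add: field_simps)
  then show ?thesis using m(2)[OF t] by linarith
qed

text \<open>The variational equation is not solved. A combination of solution differences that
  vanishes at time 0 satisfies a linear equation up to a small error, so it stays small by
  \<open>gronwall_short_time\<close>; \<open>strict_derivative_exists\<close> then produces the
  derivative.\<close>

lemma local_flow_strictly_differentiable:
  fixes Y :: "'a::euclidean_space \<Rightarrow> 'a" and u :: "'a \<Rightarrow> real \<Rightarrow> 'a"
  assumes der: "\<And>x. x \<in> cball c \<rho> \<Longrightarrow> (Y has_derivative DY x) (at x)"
    and cont: "\<And>v. continuous_on (cball c \<rho>) (\<lambda>x. DY x v)"
    and K: "\<And>x v. x \<in> cball c \<rho> \<Longrightarrow> norm (DY x v) \<le> K * norm v" "K \<ge> 0" "K * T \<le> 1/2"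
    and O: "open S"
    and u: "\<And>a s. a \<in> S \<Longrightarrow> s \<in> {0..T} \<Longrightarrow> u a s \<in> cball c \<rho>" "\<And>a. a \<in> S \<Longrightarrow> u a 0 = a"
      "\<And>a s. a \<in> S \<Longrightarrow> s \<in> {0..T} \<Longrightarrow> (u a has_vector_derivative Y (u a s)) (at s within {0..T})"
    and a: "a \<in> S" and t: "t \<in> {0..T}"
  shows "\<exists>L. has_strict_derivative (\<lambda>a. u a t) L a"
proof -
  have T: "T \<ge> 0" using t by simp
  have Ylip: "norm (Y x - Y y) \<le> K * norm (x - y)" if "x \<in> cball c \<rho>" "y \<in> cball c \<rho>" for x y
    by (rule differentiable_bound[where S="cball c \<rho>" and f'=DY])
      (use der K that in \<open>auto intro: has_derivative_at_withinI onorm_le\<close>)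
  have ulip: "norm (u x s - u y s) \<le> 2 * norm (x - y)" if xy: "x \<in> S" "y \<in> S" and s: "s \<in> {0..T}" for x y s
  proof -
    have "norm (u x s - u y s) \<le> 2 * (norm (u x 0 - u y 0) + 0 * T)"
    proof (rule gronwall_short_time[OF _ _ K(2,3) _ s])
      fix s assume s: "s \<in> {0..T}"
      show "((\<lambda>s. u x s - u y s) has_vector_derivative Y (u x s) - Y (u y s)) (at s within {0..T})"
        using u(3)[OF xy(1) s] u(3)[OF xy(2) s] by (rule has_vector_derivative_diff)
      show "norm (Y (u x s) - Y (u y s)) \<le> K * norm (u x s - u y s) + 0"
        using Ylip u(1) xy s by simp
    qed simp
    then show ?thesis using u(2) xy by simp
  qed
  show ?thesis
  proof (rule strict_derivative_exists)
    fix e :: real assume "e > 0"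
    \<comment> \<open>The comparison below ends with the bound \<open>4 * \<eta> * T * Q\<close>.
      The summand 1 covers \<open>T = 0\<close>.\<close>
    define \<eta> where "\<eta> = e / (4 * (T + 1))"
    have \<eta>: "\<eta> > 0" "4 * \<eta> * T \<le> e" using \<open>e > 0\<close> T by (auto simp: \<eta>_def field_simps)
    obtain r0 where r0: "r0 > 0" "\<forall>u\<in>cball c \<rho>. \<forall>y\<in>cball c \<rho>. \<forall>z\<in>cball c \<rho>. dist y u < r0 \<longrightarrow> dist z u < r0 \<longrightarrow>
       norm (Y y - Y z - DY u (y - z)) \<le> \<eta> * norm (y - z)"
      using C1_uniform_linearization[OF der cont \<eta>(1)] by blast
    obtain r1 where r1: "r1 > 0" "ball a r1 \<subseteq> S" using O a by (meson openE)
    \<comment> \<open>Solutions are 2-Lipschitz in the initial point by \<open>ulip\<close>, so half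
      of \<open>r0\<close> keeps them within \<open>r0\<close> of the base solution.\<close>
    define r where "r = min r1 (r0 / 2)"
    have r: "r > 0" "ball a r \<subseteq> S" "2 * r \<le> r0" using r0 r1 by (auto simp: r_def)
    have dist: "dist (u x s) (u a s) < r0" if "x \<in> ball a r" "s \<in> {0..T}" for x s
    proof -
      have "x \<in> S" using that r by auto
      then have "norm (u x s - u a s) \<le> 2 * norm (x - a)" using ulip a that by blast
      also have "\<dots> < 2 * r" using that by (simp add: dist_norm norm_minus_commute)
      finally show ?thesis using r(3) by (simp add: dist_norm)
    qed
    have lin: "norm (Y (u x s) - Y (u y s) - DY (u a s) (u x s - u y s)) \<le> 2 * \<eta> * norm (x - y)"
      if "x \<in> ball a r" "y \<in> ball a r" "s \<in> {0..T}" for x y s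
    proof -
      have S: "x \<in> S" "y \<in> S" using that r by auto
      have "norm (Y (u x s) - Y (u y s) - DY (u a s) (u x s - u y s)) \<le> \<eta> * norm (u x s - u y s)"
        using S that a by (intro r0(2)[rule_format] dist u)
      also have "\<dots> \<le> \<eta> * (2 * norm (x - y))" using ulip[OF S that(3)] \<eta> by (intro mult_left_mono) auto
      finally show ?thesis by simp
    qed
    show "\<exists>r>0. small_on_null_combinations (\<lambda>a. u a t) (ball a r) e"
      unfolding small_on_null_combinations_def
    proof (rule exI[of _ r], rule conjI[OF r(1)], intro ballI allI impI)
      fix a1 b1 a2 b2 a3 b3 s1 s2 s3
      assume ab: "a1 \<in> ball a r" "b1 \<in> ball a r" "a2 \<in> ball a r" "b2 \<in> ball a r" "a3 \<in> ball a r" "b3 \<in> ball a r"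
        and 0: "s1 *\<^sub>R (a1 - b1) + s2 *\<^sub>R (a2 - b2) + s3 *\<^sub>R (a3 - b3) = 0"
      define Q where "Q = \<bar>s1\<bar> * norm (a1 - b1) + \<bar>s2\<bar> * norm (a2 - b2) + \<bar>s3\<bar> * norm (a3 - b3)"
      have "Q \<ge> 0" by (simp add: Q_def)
      define w where "w s = s1 *\<^sub>R (u a1 s - u b1 s) + s2 *\<^sub>R (u a2 s - u b2 s) + s3 *\<^sub>R (u a3 s - u b3 s)" for s
      define w' where "w' s = s1 *\<^sub>R (Y (u a1 s) - Y (u b1 s)) + s2 *\<^sub>R (Y (u a2 s) - Y (u b2 s)) + s3 *\<^sub>R (Y (u a3 s) - Y (u b3 s))" for s
      have abS: "a1 \<in> S" "b1 \<in> S" "a2 \<in> S" "b2 \<in> S" "a3 \<in> S" "b3 \<in> S" using ab r(2) by auto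
      have "norm (w t) \<le> 2 * (norm (w 0) + (2 * \<eta> * Q) * T)"
      proof (rule gronwall_short_time[OF _ _ K(2,3) _ t])
        fix s assume s: "s \<in> {0..T}"
        show "(w has_vector_derivative w' s) (at s within {0..T})"
          unfolding w_def w'_def
          by (intro has_vector_derivative_add has_vector_derivative_diff
              bounded_linear.has_vector_derivative[OF bounded_linear_scaleR_right] u(3) abS s)
        \<comment> \<open>One linear map, taken along the base solution, serves all three
          increments; this makes it act on the combination \<open>w\<close> as a whole.\<close>
        define B where "B = DY (u a s)"
        have usc: "u a s \<in> cball c \<rho>" using u(1)[OF a s] .
        have B: "linear B" unfolding B_def using der[OF usc]
          by (intro bounded_linear.linear has_derivative_bounded_linear)
        define R where "R x y = Y (u x s) - Y (u y s) - B (u x s - u y s)" for x y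
        have R: "norm (c *\<^sub>R R x y) \<le> 2 * \<eta> * (\<bar>c\<bar> * norm (x - y))" if "x \<in> ball a r" "y \<in> ball a r" for x y c
          using mult_left_mono[OF lin[OF that s], of "\<bar>c\<bar>"] unfolding norm_scaleR R_def B_def by (simp only: ac_simps)
        have "w' s = B (w s) + (s1 *\<^sub>R R a1 b1 + s2 *\<^sub>R R a2 b2 + s3 *\<^sub>R R a3 b3)"
          unfolding w_def w'_def R_def by (simp add: linear_add[OF B] linear_diff[OF B] linear_cmul[OF B] algebra_simps)
        then have "norm (w' s) \<le> norm (B (w s)) + (norm (s1 *\<^sub>R R a1 b1) + norm (s2 *\<^sub>R R a2 b2) + norm (s3 *\<^sub>R R a3 b3))"
          using norm_triangle_ineq[of "B (w s)" "s1 *\<^sub>R R a1 b1 + s2 *\<^sub>R R a2 b2 + s3 *\<^sub>R R a3 b3"]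
            norm_triangle_ineq[of "s1 *\<^sub>R R a1 b1 + s2 *\<^sub>R R a2 b2" "s3 *\<^sub>R R a3 b3"]
            norm_triangle_ineq[of "s1 *\<^sub>R R a1 b1" "s2 *\<^sub>R R a2 b2"] by simp
        also have "\<dots> \<le> K * norm (w s) + (2 * \<eta> * (\<bar>s1\<bar> * norm (a1 - b1)) + 2 * \<eta> * (\<bar>s2\<bar> * norm (a2 - b2)) + 2 * \<eta> * (\<bar>s3\<bar> * norm (a3 - b3)))"
          unfolding B_def using ab by (intro add_mono R K(1) usc)
        finally show "norm (w' s) \<le> K * norm (w s) + 2 * \<eta> * Q" by (simp add: Q_def algebra_simps)
      qed (use \<eta> \<open>Q \<ge> 0\<close> in simp)
      moreover have "w 0 = 0" using 0 u(2) abS by (simp add: w_def)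
      moreover have "4 * \<eta> * T * Q \<le> e * Q" using \<eta>(2) \<open>Q \<ge> 0\<close> by (intro mult_right_mono)
      ultimately have "norm (w t) \<le> e * Q" by (simp add: algebra_simps)
      then show "norm (s1 *\<^sub>R (u a1 t - u b1 t) + s2 *\<^sub>R (u a2 t - u b2 t) + s3 *\<^sub>R (u a3 t - u b3 t))
        \<le> e * (\<bar>s1\<bar> * norm (a1 - b1) + \<bar>s2\<bar> * norm (a2 - b2) + \<bar>s3\<bar> * norm (a3 - b3))"
        by (simp add: w_def Q_def)
    qed
  qed
qed


subsection \<open>Differentiability of the flow on the manifold\<close>

abbreviation chart_rep :: "('m \<Rightarrow> 'm) \<Rightarrow> ('m, 'n::finite) chart \<Rightarrow> ('m, 'n) chart \<Rightarrow> real^'n \<Rightarrow> real^'n" where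
  "chart_rep f c d \<equiv> coord d \<circ> f \<circ> coord_inv c"

section \<open>Strict derivatives of maps between charts\<close>

locale atlas =
  fixes A :: "('m::metric_space, 'n::finite) chart set"
  assumes smooth_atlas: "smooth_atlas A"
begin

lemma chart_at: "chart_at A x \<in> A" "x \<in> chart_dom (chart_at A x)"
proof -
  have "\<exists>c. c \<in> A \<and> x \<in> chart_dom c" using smooth_atlas unfolding smooth_atlas_def by blast
  then have "chart_at A x \<in> A \<and> x \<in> chart_dom (chart_at A x)" unfolding chart_at_def by (rule someI_ex)
  then show "chart_at A x \<in> A" "x \<in> chart_dom (chart_at A x)" by auto
qed

lemma chart:
  assumes "c \<in> A"
  shows "open (chart_dom c)" and "open (chart_im c)"
    and cont_coord: "continuous_on (chart_dom c) (coord c)"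
    and cont_coord_inv: "continuous_on (chart_im c) (coord_inv c)"
    and coord_inv_coord: "x \<in> chart_dom c \<Longrightarrow> coord_inv c (coord c x) = x"
  using assms smooth_atlas unfolding smooth_atlas_def homeomorphism_def by auto

lemma coord_coord_inv: "p \<in> chart_im c \<Longrightarrow> coord c (coord_inv c p) = p"
  by (rule f_inv_into_f)

lemma coord_inv_in_dom: "p \<in> chart_im c \<Longrightarrow> coord_inv c p \<in> chart_dom c"
  by (rule inv_into_into)

lemma coord_image_eq:
  assumes "c \<in> A"
  shows "coord c ` (chart_dom c \<inter> W) = chart_im c \<inter> coord_inv c -` W"
  by (auto simp: coord_inv_coord[OF assms] coord_coord_inv coord_inv_in_dom image_iff)

lemma open_coord_image:
  assumes "c \<in> A" "open W"
  shows "open (coord c ` (chart_dom c \<inter> W))"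
  unfolding coord_image_eq[OF assms(1)]
  by (rule continuous_open_preimage) (use assms chart in auto)

lemma coord_inv_image_eq:
  assumes "c \<in> A" "V \<subseteq> chart_im c"
  shows "coord_inv c ` V = chart_dom c \<inter> coord c -` V"
proof (intro equalityI subsetI)
  fix y assume "y \<in> coord_inv c ` V"
  then obtain p where "p \<in> V" "y = coord_inv c p" by blast
  then show "y \<in> chart_dom c \<inter> coord c -` V"
    using assms(2) coord_coord_inv[of p c] coord_inv_in_dom[of p c] by auto
next
  fix y assume "y \<in> chart_dom c \<inter> coord c -` V"
  then show "y \<in> coord_inv c ` V" using coord_inv_coord[OF assms(1), of y] by force
qed

lemma open_coord_inv_image:
  assumes "c \<in> A" "V \<subseteq> chart_im c" "open V"
  shows "open (coord_inv c ` V)"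
  unfolding coord_inv_image_eq[OF assms(1,2)]
  by (rule continuous_open_preimage) (use assms chart in auto)

lemma isCont_coord: "c \<in> A \<Longrightarrow> x \<in> chart_dom c \<Longrightarrow> isCont (coord c) x"
  using chart(1,3) continuous_on_eq_continuous_at by blast

lemma isCont_coord_inv: "c \<in> A \<Longrightarrow> p \<in> chart_im c \<Longrightarrow> isCont (coord_inv c) p"
  using chart(2,4) continuous_on_eq_continuous_at by blast

lemma transition_strict:
  assumes "c \<in> A" "d \<in> A" "x \<in> chart_dom c" "x \<in> chart_dom d"
  shows "has_strict_derivative (coord d \<circ> coord_inv c) (chart_change c d x) (coord c x)"
  unfolding chart_change_def
proof (rule Ck_on_1_has_strict_derivative)
  show "Ck_on (Suc 0) (coord d \<circ> coord_inv c) (coord c ` (chart_dom c \<inter> chart_dom d))"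
    using assms smooth_atlas unfolding smooth_atlas_def smooth_on_def by blast
  show "open (coord c ` (chart_dom c \<inter> chart_dom d))"
    using assms by (intro open_coord_image chart)
qed (use assms in auto)

lemma transition_deriv:
  assumes "c \<in> A" "d \<in> A" "x \<in> chart_dom c" "x \<in> chart_dom d"
  shows "(coord d \<circ> coord_inv c has_derivative chart_change c d x) (at (coord c x))"
  using transition_strict[OF assms] by (rule has_strict_derivative_imp_has_derivative)

lemma chart_change_linear:
  assumes "c \<in> A" "d \<in> A" "x \<in> chart_dom c" "x \<in> chart_dom d"
  shows "linear (chart_change c d x)"
  using transition_deriv[OF assms] has_derivative_linear by blast

lemma isCont_nbhd:
  assumes "isCont f x" "open T" "f x \<in> T"
  shows "\<exists>W. open W \<and> x \<in> W \<and> (\<forall>y\<in>W. f y \<in> T)"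
  using assms unfolding continuous_at_open by meson

text \<open>The composed representatives agree with the new one only where all charts involved are
  defined. Continuity of \<open>f\<close> makes this an open neighbourhood.\<close>

lemma chart_rep_change:
  assumes f: "isCont f x" and c: "c \<in> A" "c' \<in> A" "x \<in> chart_dom c" "x \<in> chart_dom c'"
    and d: "d \<in> A" "d' \<in> A" "f x \<in> chart_dom d" "f x \<in> chart_dom d'"
    and L: "has_strict_derivative (chart_rep f c d) L (coord c x)"
  shows "has_strict_derivative (chart_rep f c' d') (chart_change d d' (f x) \<circ> L \<circ> chart_change c' c x) (coord c' x)"
proof -
  obtain W where W: "open W" "x \<in> W" "\<And>y. y \<in> W \<Longrightarrow> f y \<in> chart_dom d \<inter> chart_dom d'"
    using isCont_nbhd[OF f open_Int[OF chart(1)[OF d(1)] chart(1)[OF d(2)]]] d(3,4) by blast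
  have 1: "has_strict_derivative (coord c \<circ> coord_inv c') (chart_change c' c x) (coord c' x)"
    using c by (intro transition_strict)
  have 2: "has_strict_derivative (chart_rep f c d \<circ> (coord c \<circ> coord_inv c')) (L \<circ> chart_change c' c x) (coord c' x)"
    by (rule has_strict_derivative_compose[OF 1]) (use L c coord_inv_coord in auto)
  have 3: "has_strict_derivative ((coord d' \<circ> coord_inv d) \<circ> (chart_rep f c d \<circ> (coord c \<circ> coord_inv c'))) (chart_change d d' (f x) \<circ> (L \<circ> chart_change c' c x)) (coord c' x)"
    by (rule has_strict_derivative_compose[OF 2]) (use transition_strict[of d d' "f x"] c d coord_inv_coord in auto)
  show ?thesis
    unfolding comp_assoc[of "chart_change d d' (f x)"]
  proof (rule has_strict_derivative_transfer[OF 3])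
    show "open (coord c' ` (chart_dom c' \<inter> (chart_dom c \<inter> W)))"
      using c W by (intro open_coord_image open_Int chart)
    show "coord c' x \<in> coord c' ` (chart_dom c' \<inter> (chart_dom c \<inter> W))" using c W by auto
    fix a assume "a \<in> coord c' ` (chart_dom c' \<inter> (chart_dom c \<inter> W))"
    then show "((coord d' \<circ> coord_inv d) \<circ> (chart_rep f c d \<circ> (coord c \<circ> coord_inv c'))) a = chart_rep f c' d' a"
      using W(3) c d coord_inv_coord by auto
  qed
qed

text \<open>Continuity is demanded separately: coordinate maps have arbitrary values outside their
  domains, so control of the representative does not by itself keep \<open>f y\<close> near
  \<open>f x\<close>.\<close>

definition mdifferentiable :: "('m \<Rightarrow> 'm) \<Rightarrow> 'm \<Rightarrow> bool" where
  "mdifferentiable f x \<longleftrightarrow> isCont f x \<and>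
     (\<exists>L. has_strict_derivative (chart_rep f (chart_at A x) (chart_at A (f x))) L (coord (chart_at A x) x))"

lemma mdifferentiableI:
  assumes "isCont f x" "c \<in> A" "d \<in> A" "x \<in> chart_dom c" "f x \<in> chart_dom d"
    "has_strict_derivative (chart_rep f c d) L (coord c x)"
  shows "mdifferentiable f x"
  unfolding mdifferentiable_def using chart_rep_change[where c=c and d=d and L=L and f=f and x=x and c'="chart_at A x" and d'="chart_at A (f x)"]
    assms chart_at by blast

lemma mderiv_strict_at:
  assumes "mdifferentiable f x"
  shows "has_strict_derivative (chart_rep f (chart_at A x) (chart_at A (f x))) (mderiv A f x) (coord (chart_at A x) x)"
proof -
  obtain L where L: "has_strict_derivative (chart_rep f (chart_at A x) (chart_at A (f x))) L (coord (chart_at A x) x)"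
    using assms by (auto simp: mdifferentiable_def)
  then have "mderiv A f x = L" unfolding mderiv_def
    using frechet_derivative_at has_strict_derivative_imp_has_derivative by metis
  then show ?thesis using L by simp
qed

lemma mderiv_linear: "mdifferentiable f x \<Longrightarrow> linear (mderiv A f x)"
  using mderiv_strict_at bounded_linear.linear unfolding has_strict_derivative_def by blast

lemma mderiv_strict:
  assumes "mdifferentiable f x" "c \<in> A" "d \<in> A" "x \<in> chart_dom c" "f x \<in> chart_dom d"
  shows "has_strict_derivative (chart_rep f c d)
    (chart_change (chart_at A (f x)) d (f x) \<circ> mderiv A f x \<circ> chart_change c (chart_at A x) x) (coord c x)"
  by (rule chart_rep_change[OF _ _ _ _ _ _ _ _ _ mderiv_strict_at[OF assms(1)]])
    (use assms chart_at in \<open>auto simp: mdifferentiable_def\<close>)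

lemma mdifferentiable_compose:
  assumes f: "mdifferentiable f x" and g: "mdifferentiable g (f x)"
  shows "mdifferentiable (g \<circ> f) x"
proof -
  let ?c = "chart_at A x" and ?d = "chart_at A (f x)" and ?e = "chart_at A (g (f x))"
  have cont: "isCont f x" "isCont g (f x)" using f g by (auto simp: mdifferentiable_def)
  obtain W where W: "open W" "x \<in> W" "\<And>y. y \<in> W \<Longrightarrow> f y \<in> chart_dom ?d"
    using isCont_nbhd[OF cont(1) chart(1)[OF chart_at(1)] chart_at(2)] by blast
  have 1: "has_strict_derivative (chart_rep g ?d ?e) (mderiv A g (f x)) (chart_rep f ?c ?d (coord ?c x))"
    using mderiv_strict_at[OF g] coord_inv_coord chart_at by simp
  show ?thesis
  proof (rule mdifferentiableI[where c="?c" and d="?e"])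
    show "has_strict_derivative (chart_rep (g \<circ> f) ?c ?e) (mderiv A g (f x) \<circ> mderiv A f x) (coord ?c x)"
    proof (rule has_strict_derivative_transfer[OF has_strict_derivative_compose[OF mderiv_strict_at[OF f] 1]])
      show "open (coord ?c ` (chart_dom ?c \<inter> W))" using W chart_at by (intro open_coord_image)
      fix a assume "a \<in> coord ?c ` (chart_dom ?c \<inter> W)"
      then show "(chart_rep g ?d ?e \<circ> chart_rep f ?c ?d) a = chart_rep (g \<circ> f) ?c ?e a"
        using W(3) chart_at coord_inv_coord by auto
    qed (use W chart_at in auto)
  qed (use cont chart_at in \<open>auto simp: continuous_at_compose\<close>)
qed

end

section \<open>Spatial differentiability of the flow\<close>

locale C1_flow = atlas A for A :: "('m::metric_space, 'n::finite) chart set" +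
  fixes X :: "'m \<Rightarrow> real^'n" and \<phi> :: "real \<Rightarrow> 'm \<Rightarrow> 'm"
  assumes C1: "C1_vector_field A X" and flow: "flow_of A X \<phi>" and compact_UNIV: "compact (UNIV :: 'm set)"
begin

lemma flow_0: "\<phi> 0 x = x" and flow_add: "\<phi> (s + t) x = \<phi> s (\<phi> t x)"
  and flow_cont_time: "continuous_on UNIV (\<lambda>t. \<phi> t x)"
  and flow_deriv: "((\<lambda>s. coord (chart_at A (\<phi> t x)) (\<phi> s x)) has_vector_derivative X (\<phi> t x)) (at t)"
  using flow unfolding flow_of_def by blast+

text \<open>\<open>flow_of\<close> differentiates an orbit in the chart selected at its current
  point, which may change with time. In one fixed chart the orbit solves an ordinary differential
  equation.\<close>

lemma flow_chart_deriv:
  assumes c: "c \<in> A" "\<phi> t x \<in> chart_dom c"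
  shows "((\<lambda>s. coord c (\<phi> s x)) has_vector_derivative vf_in_chart A X c (coord c (\<phi> t x))) (at t)"
proof -
  let ?b = "chart_at A (\<phi> t x)"
  have "(coord c \<circ> coord_inv ?b has_derivative chart_change ?b c (\<phi> t x)) (at (coord ?b (\<phi> t x)))"
    using c chart_at by (intro transition_deriv) auto
  then have "((coord c \<circ> coord_inv ?b) \<circ> (\<lambda>s. coord ?b (\<phi> s x)) has_derivative chart_change ?b c (\<phi> t x) \<circ> (\<lambda>h. h *\<^sub>R X (\<phi> t x))) (at t)"
    using flow_deriv[of t x] unfolding has_vector_derivative_def by (intro diff_chain_at)
  moreover have "chart_change ?b c (\<phi> t x) \<circ> (\<lambda>h. h *\<^sub>R X (\<phi> t x)) = (\<lambda>h. h *\<^sub>R vf_in_chart A X c (coord c (\<phi> t x)))"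
    using chart_change_linear[of ?b c "\<phi> t x"] c chart_at coord_inv_coord
    by (auto simp: vf_in_chart_def tangent_coord_def linear_cmul fun_eq_iff Let_def)
  ultimately have "((coord c \<circ> coord_inv ?b) \<circ> (\<lambda>s. coord ?b (\<phi> s x)) has_vector_derivative vf_in_chart A X c (coord c (\<phi> t x))) (at t)"
    by (simp add: has_vector_derivative_def)
  moreover have "open ((\<lambda>s. \<phi> s x) -` chart_dom ?b)"
    using flow_cont_time[of x] chart(1) chart_at by (simp add: open_vimage)
  ultimately show ?thesis
    by (rule has_vector_derivative_transform_within_open) (use chart_at coord_inv_coord in auto)
qed

text \<open>Only continuity in time is available at this stage. A first-exit argument with the speed
  bound \<open>S\<close> gives a time that is uniform over the initial points of the half
  ball.\<close>

lemma flow_stays_in_ball: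
  assumes c: "c \<in> A" "cball a0 \<rho> \<subseteq> chart_im c" and S: "\<And>p. p \<in> cball a0 \<rho> \<Longrightarrow> norm (vf_in_chart A X c p) \<le> S"
    and \<tau>: "S * \<tau> < \<rho> / 2" and S0: "S \<ge> 0" and a: "a \<in> ball a0 (\<rho>/2)" and t: "t \<in> {0..\<tau>}"
  shows "\<phi> t (coord_inv c a) \<in> coord_inv c ` ball a0 \<rho>"
proof (rule ccontr)
  assume neg: "\<not> ?thesis"
  define y where "y = coord_inv c a"
  define G where "G = coord_inv c ` ball a0 \<rho>"
  have \<rho>: "\<rho> > 0" using a by (smt (verit) mem_ball zero_le_dist field_sum_of_halves)
  have sub: "ball a0 \<rho> \<subseteq> chart_im c" using c(2) ball_subset_cball by blast
  have "open G" unfolding G_def using c sub by (intro open_coord_inv_image) auto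
  have a_im: "a \<in> chart_im c" using a \<rho> sub by (auto simp: subset_iff)
  have "y \<in> G" unfolding G_def y_def using a \<rho> by auto
  \<comment> \<open>The exit times form a closed set, so its infimum \<open>s\<close> is itself an
    exit time.\<close>
  define B where "B = {0..\<tau>} \<inter> (\<lambda>s. \<phi> s y) -` (- G)"
  have "closed B" unfolding B_def
    using \<open>open G\<close> flow_cont_time[of y] by (intro closed_Int closed_vimage) (auto simp: closed_Compl)
  have "t \<in> B" using neg t by (simp add: B_def G_def y_def)
  have bb: "bdd_below B" unfolding B_def by (rule bdd_belowI[of _ 0]) auto
  define s where "s = Inf B"
  have "s \<in> B" unfolding s_def using \<open>closed B\<close> \<open>t \<in> B\<close> bb by (intro closed_contains_Inf) auto
  have s: "0 \<le> s" "s \<le> \<tau>" "\<phi> s y \<notin> G" using \<open>s \<in> B\<close> by (auto simp: B_def)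
  have "s \<noteq> 0" using s(3) \<open>y \<in> G\<close> flow_0 by auto
  have before: "\<phi> r y \<in> G" if "0 \<le> r" "r < s" for r
  proof (rule ccontr)
    assume "\<phi> r y \<notin> G"
    then have "r \<in> B" using that s by (auto simp: B_def)
    then have "s \<le> r" unfolding s_def using bb by (rule cInf_lower)
    then show False using that by simp
  qed
  \<comment> \<open>The orbit is in the open ball before time \<open>s\<close>. The compact closed
    ball ensures that it is still inside the chart at \<open>s\<close>, where the speed bound is
    applied.\<close>
  define C where "C = coord_inv c ` cball a0 \<rho>"
  have "compact C" unfolding C_def
    using c chart(4)[of c] by (intro compact_continuous_image) (auto intro: continuous_on_subset)
  have "{0..s} \<subseteq> (\<lambda>s. \<phi> s y) -` C"
  proof -
    have "{0..<s} \<subseteq> (\<lambda>s. \<phi> s y) -` C" using before unfolding G_def C_def by auto (meson ball_subset_cball image_mono subsetD)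
    moreover have "closed ((\<lambda>s. \<phi> s y) -` C)"
      using flow_cont_time[of y] compact_imp_closed[OF \<open>compact C\<close>] by (simp add: closed_vimage)
    ultimately have "closure {0..<s} \<subseteq> (\<lambda>s. \<phi> s y) -` C" by (rule closure_minimal)
    then show ?thesis using \<open>s \<noteq> 0\<close> s by simp
  qed
  have inC: "\<phi> r y \<in> chart_dom c" "coord c (\<phi> r y) \<in> cball a0 \<rho>" if r: "r \<in> {0..s}" for r
  proof -
    obtain p where p: "p \<in> cball a0 \<rho>" "\<phi> r y = coord_inv c p"
      using \<open>{0..s} \<subseteq> _\<close> r unfolding C_def by blast
    then have "p \<in> chart_im c" using c(2) by blast
    from coord_coord_inv[OF this] coord_inv_in_dom[OF this]
    show "\<phi> r y \<in> chart_dom c" "coord c (\<phi> r y) \<in> cball a0 \<rho>" using p by simp_all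
  qed
  have "norm (coord c (\<phi> s y) - coord c (\<phi> 0 y)) \<le> S * norm (s - 0)"
  proof (rule differentiable_bound[where S="{0..s}" and f'="\<lambda>r h. h *\<^sub>R vf_in_chart A X c (coord c (\<phi> r y))"])
    fix r assume r: "r \<in> {0..s}"
    show "((\<lambda>r. coord c (\<phi> r y)) has_derivative (\<lambda>h. h *\<^sub>R vf_in_chart A X c (coord c (\<phi> r y)))) (at r within {0..s})"
      using flow_chart_deriv[OF c(1) inC(1)[OF r]] unfolding has_vector_derivative_def by (rule has_derivative_at_withinI)
    show "onorm (\<lambda>h. h *\<^sub>R vf_in_chart A X c (coord c (\<phi> r y))) \<le> S"
      using S[OF inC(2)[OF r]] by (intro onorm_le) (simp add: mult.commute[of S] mult_left_mono)
  qed (use s in auto)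
  also have "\<dots> \<le> S * \<tau>" using s S0 by (intro mult_left_mono) auto
  finally have "norm (coord c (\<phi> s y) - a) < \<rho> / 2" using \<tau> flow_0 coord_coord_inv[OF a_im] by (simp add: y_def)
  then have "dist a (coord c (\<phi> s y)) < \<rho> / 2" by (simp add: dist_norm norm_minus_commute)
  then have "coord c (\<phi> s y) \<in> ball a0 \<rho>" using a dist_triangle[of a0 "coord c (\<phi> s y)" a] by simp
  then have "\<phi> s y \<in> G" unfolding G_def using coord_inv_coord[OF c(1) inC(1)[of s]] s by (metis atLeastAtMost_iff imageI order_refl)
  then show False using s by simp
qed

text \<open>The time \<tau> is uniform on the neighbourhood, so that compactness of the manifold
  later yields one time step for all points.\<close>

lemma flow_local_mdifferentiable:
  "\<exists>W \<tau>. open W \<and> x \<in> W \<and> \<tau> > 0 \<and> (\<forall>y\<in>W. \<forall>t\<in>{0..\<tau>}. mdifferentiable (\<phi> t) y)"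
proof -
  define c where "c = chart_at A x"
  have c: "c \<in> A" "x \<in> chart_dom c" unfolding c_def by (rule chart_at)+
  define a0 where "a0 = coord c x"
  define Y where "Y = vf_in_chart A X c"
  have "Ck_on 1 Y (chart_im c)" using C1 c unfolding C1_vector_field_def Y_def by blast
  then obtain DY where DY: "\<And>p. p \<in> chart_im c \<Longrightarrow> (Y has_derivative DY p) (at p)" "\<And>v. continuous_on (chart_im c) (\<lambda>p. DY p v)"
    by auto
  have "a0 \<in> chart_im c" using c by (simp add: a0_def)
  then obtain \<rho> where \<rho>: "\<rho> > 0" "cball a0 \<rho> \<subseteq> chart_im c"
    using chart(2)[OF c(1)] open_contains_cball by blast
  have der: "(Y has_derivative DY p) (at p)" if "p \<in> cball a0 \<rho>" for p using DY(1) \<rho> that by blast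
  have cont: "continuous_on (cball a0 \<rho>) (\<lambda>p. DY p v)" for v using DY(2) \<rho> continuous_on_subset by blast
  have bdd: "\<exists>M\<ge>0. \<forall>p\<in>cball a0 \<rho>. norm (f p) \<le> M" if "continuous_on (cball a0 \<rho>) f" for f :: "real^'n \<Rightarrow> real^'n"
  proof -
    have "bounded (f ` cball a0 \<rho>)" using that by (intro compact_imp_bounded compact_continuous_image) auto
    then show ?thesis unfolding bounded_pos by (auto intro: less_imp_le)
  qed
  have "continuous_on (cball a0 \<rho>) Y"
    using der by (meson has_derivative_continuous continuous_at_imp_continuous_on)
  then obtain S where S: "S \<ge> 0" "\<And>p. p \<in> cball a0 \<rho> \<Longrightarrow> norm (Y p) \<le> S" using bdd by blast
  have "\<forall>v. \<exists>M\<ge>0. \<forall>p\<in>cball a0 \<rho>. norm (DY p v) \<le> M" using bdd[OF cont] by blast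
  then obtain M where M: "\<And>v. M v \<ge> 0" "\<And>p v. p \<in> cball a0 \<rho> \<Longrightarrow> norm (DY p v) \<le> M v" by metis
  define K where "K = (\<Sum>b\<in>(Basis :: (real^'n) set). M b)"
  have K: "K \<ge> 0" "norm (DY p v) \<le> K * norm v" if p: "p \<in> cball a0 \<rho>" for p v
  proof -
    show "K \<ge> 0" unfolding K_def by (intro sum_nonneg M)
    have l: "linear (DY p)" using der[OF p] by (rule has_derivative_linear)
    have "DY p v = (\<Sum>b\<in>Basis. (v \<bullet> b) *\<^sub>R DY p b)" by (rule linear_basis_expansion[OF l])
    also have "norm \<dots> \<le> (\<Sum>b\<in>(Basis :: (real^'n) set). M b * norm v)"
    proof (rule sum_norm_le)
      fix b :: "real^'n" assume b: "b \<in> Basis"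
      show "norm ((v \<bullet> b) *\<^sub>R DY p b) \<le> M b * norm v"
        using Basis_le_norm[OF b, of v] M(1)[of b] M(2)[OF p, of b] by (simp add: mult_mono mult.commute[of "M b"])
    qed
    also have "\<dots> = K * norm v" by (simp add: K_def sum_distrib_right)
    finally show "norm (DY p v) \<le> K * norm v" .
  qed
  have K0: "K \<ge> 0" using K(1)[of a0] \<rho> by simp
  \<comment> \<open>The first bound makes \<open>gronwall_short_time\<close> applicable, the second
    keeps orbits from the half ball inside the chart ball.\<close>
  define \<tau> where "\<tau> = min (1 / (2 * (K + 1))) (\<rho> / (4 * (S + 1)))"
  have \<tau>: "\<tau> > 0" using K0 S \<rho> by (simp add: \<tau>_def)
  have K\<tau>: "K * \<tau> \<le> 1/2"
  proof -
    have "K * \<tau> \<le> K * (1 / (2 * (K + 1)))" using K0 by (intro mult_left_mono) (auto simp: \<tau>_def)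
    also have "\<dots> \<le> 1/2" using K0 by (simp add: field_simps)
    finally show ?thesis .
  qed
  have S\<tau>: "S * \<tau> < \<rho> / 2"
  proof -
    have "S * \<tau> \<le> S * (\<rho> / (4 * (S + 1)))" using S by (intro mult_left_mono) (auto simp: \<tau>_def)
    also have "\<dots> \<le> \<rho> / 4" using S \<rho> by (simp add: field_simps)
    finally show ?thesis using \<rho> by linarith
  qed
  define u where "u a t = coord c (\<phi> t (coord_inv c a))" for a t
  define B where "B = ball a0 (\<rho>/2)"
  have B_im: "B \<subseteq> chart_im c" using \<rho> unfolding B_def by (auto simp: subset_iff)
  have Bc: "coord c (coord_inv c a) = a" "coord_inv c a \<in> chart_dom c" if "a \<in> B" for a
    using coord_coord_inv[of a c] coord_inv_in_dom[of a c] B_im that by blast+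
  have stay: "\<phi> t (coord_inv c a) \<in> coord_inv c ` ball a0 \<rho>" if "a \<in> B" "t \<in> {0..\<tau>}" for a t
    by (rule flow_stays_in_ball[OF c(1) \<rho>(2) _ S\<tau> S(1)]) (use S that in \<open>auto simp: Y_def B_def\<close>)
  have sub: "ball a0 \<rho> \<subseteq> chart_im c" using \<rho>(2) ball_subset_cball by blast
  have stay2: "\<phi> t (coord_inv c a) \<in> chart_dom c" "u a t \<in> ball a0 \<rho>" if at: "a \<in> B" "t \<in> {0..\<tau>}" for a t
  proof -
    obtain p where p: "p \<in> ball a0 \<rho>" "\<phi> t (coord_inv c a) = coord_inv c p" using stay[OF at] by blast
    then have "p \<in> chart_im c" using sub by blast
    from coord_coord_inv[OF this] coord_inv_in_dom[OF this]
    show "\<phi> t (coord_inv c a) \<in> chart_dom c" "u a t \<in> ball a0 \<rho>"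
      using p unfolding u_def by simp_all
  qed
  have SD: "\<exists>L. has_strict_derivative (\<lambda>a. u a t) L a" if "a \<in> B" "t \<in> {0..\<tau>}" for a t
  proof (rule local_flow_strictly_differentiable[where S=B and u=u, OF der cont K(2) K0 K\<tau>])
    fix a s assume as: "a \<in> B" "s \<in> {0..\<tau>}"
    show "u a s \<in> cball a0 \<rho>" using stay2[OF as] by auto
    show "(u a has_vector_derivative Y (u a s)) (at s within {0..\<tau>})"
      unfolding u_def Y_def by (rule has_vector_derivative_at_within, rule flow_chart_deriv[OF c(1) stay2(1)[OF as]])
  next
    fix a assume "a \<in> B"
    then show "u a 0 = a" using Bc by (simp add: u_def flow_0)
  next
    show "open B" by (simp add: B_def)
  qed (use that in simp_all)
  define W where "W = coord_inv c ` B"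
  have "open W" unfolding W_def using c B_im by (intro open_coord_inv_image) (auto simp: B_def)
  moreover have "x \<in> W" 
  proof -
    have "a0 \<in> B" using \<rho>(1) by (simp add: B_def)
    then have "coord_inv c a0 \<in> W" unfolding W_def by blast
    then show ?thesis using coord_inv_coord[OF c] by (simp add: a0_def)
  qed
  moreover have "mdifferentiable (\<phi> t) y" if y: "y \<in> W" and t: "t \<in> {0..\<tau>}" for y t
  proof -
    define a where "a = coord c y"
    have a: "a \<in> B" "y = coord_inv c a" "y \<in> chart_dom c"
      using y Bc unfolding W_def a_def by auto
    obtain L where L: "has_strict_derivative (\<lambda>a. u a t) L a" using SD[OF a(1) t] by blast
    show ?thesis
    proof (rule mdifferentiableI[where c=c and d=c])
      show "has_strict_derivative (chart_rep (\<phi> t) c c) L (coord c y)"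
        using L by (simp add: u_def o_def a_def)
      \<comment> \<open>Continuity of the time map on the manifold is obtained from its coordinate
        expression, which is already known to remain in the chart.\<close>
      have "isCont (\<lambda>a. u a t) (coord c y)"
        using has_derivative_continuous[OF has_strict_derivative_imp_has_derivative[OF L]] by (simp add: a_def)
      then have "isCont (\<lambda>z. u (coord c z) t) y" by (rule isCont_o2[OF isCont_coord[OF c(1) a(3)]])
      moreover have "isCont (coord_inv c) (u (coord c y) t)"
        using stay2(2)[OF a(1) t] sub c by (intro isCont_coord_inv) (auto simp: a_def)
      ultimately have cont: "isCont (\<lambda>y. coord_inv c (u (coord c y) t)) y"
        by (rule isCont_o2)
      have ev: "\<forall>\<^sub>F z in nhds y. coord_inv c (u (coord c z) t) = \<phi> t z"
        using \<open>open W\<close> y unfolding eventually_nhds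
      proof (intro exI[of _ W] conjI ballI)
        fix z assume "z \<in> W"
        then obtain b where b: "b \<in> B" "z = coord_inv c b" by (auto simp: W_def)
        then have "coord c z = b" using Bc by auto
        then show "coord_inv c (u (coord c z) t) = \<phi> t z"
          using stay2(1)[OF b(1) t] coord_inv_coord[OF c(1)] b by (simp add: u_def)
      qed auto
      then have "\<forall>\<^sub>F z in at y. coord_inv c (u (coord c z) t) = \<phi> t z"
        by (auto simp: eventually_at_filter elim: eventually_mono)
      moreover have "coord_inv c (u (coord c y) t) = \<phi> t y" using ev by (rule eventually_nhds_x_imp_x)
      ultimately show "isCont (\<phi> t) y"
        using Lim_transform_eventually[OF cont[unfolded isCont_def]] unfolding isCont_def by simp
      show "\<phi> t y \<in> chart_dom c" using stay2(1)[OF a(1) t] a by simp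
    qed (use c a in auto)
  qed
  ultimately show ?thesis using \<tau> by blast
qed

text \<open>Compactness turns the local times into one positive \<open>T\<close>; a longer time is
  divided into equal steps of length at most \<open>T\<close> and composed.\<close>

lemma flow_mdifferentiable:
  assumes "t \<ge> 0"
  shows "mdifferentiable (\<phi> t) x"
proof -
  have "\<forall>x. \<exists>W \<tau>. open W \<and> x \<in> W \<and> \<tau> > 0 \<and> (\<forall>y\<in>W. \<forall>t\<in>{0..\<tau>}. mdifferentiable (\<phi> t) y)"
    using flow_local_mdifferentiable by blast
  from choice[OF this] obtain W where "\<forall>x. \<exists>\<tau>. open (W x) \<and> x \<in> W x \<and> \<tau> > 0 \<and> (\<forall>y\<in>W x. \<forall>t\<in>{0..\<tau>}. mdifferentiable (\<phi> t) y)"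
    by blast
  from choice[OF this] obtain \<tau> where "\<forall>x. open (W x) \<and> x \<in> W x \<and> \<tau> x > 0 \<and> (\<forall>y\<in>W x. \<forall>t\<in>{0..\<tau> x}. mdifferentiable (\<phi> t) y)"
    by blast
  then have W: "open (W x)" "x \<in> W x" "\<tau> x > 0" "y \<in> W x \<Longrightarrow> t \<in> {0..\<tau> x} \<Longrightarrow> mdifferentiable (\<phi> t) y" for x y t
    by blast+
  obtain F where F: "finite F" "UNIV \<subseteq> (\<Union>x\<in>F. W x)"
  proof (rule compactE_image[OF compact_UNIV, of UNIV W])
    show "open (W x)" for x by (rule W)
    show "UNIV \<subseteq> (\<Union>x\<in>UNIV. W x)" using W(2) by blast
  qed (rule that; assumption)
  have "F \<noteq> {}" using F by auto
  define T where "T = Min (\<tau> ` F)"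
  have T: "T > 0" "\<And>x. x \<in> F \<Longrightarrow> T \<le> \<tau> x" using F \<open>F \<noteq> {}\<close> W by (auto simp: T_def)
  have short: "mdifferentiable (\<phi> s) y" if "0 \<le> s" "s \<le> T" for s y
  proof -
    have "y \<in> (\<Union>x\<in>F. W x)" using F(2) by (rule subsetD) simp
    then obtain x where "x \<in> F" "y \<in> W x" by (rule UN_E)
    then show ?thesis using W(4)[of y x s] T(2)[of x] that by simp
  qed
  obtain n where n: "t / T < real n" using reals_Archimedean2 by blast
  have "n > 0" using n T assms by (metis divide_nonneg_pos linorder_not_less of_nat_0 gr0I)
  define s where "s = t / n"
  have s: "0 \<le> s" "s \<le> T" "t = n * s" using n T assms \<open>n > 0\<close> by (auto simp: s_def field_simps)
  have "mdifferentiable (\<phi> (real k * s)) x" for k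
  proof (induction k)
    case 0
    then show ?case using short[of 0] T by simp
  next
    case (Suc k)
    have "\<phi> (real (Suc k) * s) = \<phi> s \<circ> \<phi> (real k * s)"
      using flow_add[of s "real k * s"] by (auto simp: algebra_simps fun_eq_iff)
    then show ?case using mdifferentiable_compose[OF Suc short[OF s(1,2)]] by (simp only:)
  qed
  then show ?thesis using s(3) by simp
qed

lemma flow_cont: "t \<ge> 0 \<Longrightarrow> isCont (\<phi> t) x"
  using flow_mdifferentiable by (auto simp: mdifferentiable_def)

end


subsection \<open>From expansion on cones to separated sets\<close>

lemma isCont_funpow:
  fixes f :: "'m::metric_space \<Rightarrow> 'm"
  assumes "\<And>x. isCont f x"
  shows "isCont (f ^^ k) x"
proof (induction k)
  case (Suc k)
  then show ?case using continuous_at_compose[OF Suc assms] by (simp add: o_def)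
qed (simp add: id_def)

text \<open>A point of \<Lambda> not shadowed by \<open>S\<close> could be added to \<open>S\<close>
  without destroying separation.\<close>

lemma maximal_separated_spans:
  assumes S: "finite S" "S \<subseteq> \<Lambda>" "separated f m \<epsilon> S"
    and max: "\<And>T. finite T \<Longrightarrow> T \<subseteq> \<Lambda> \<Longrightarrow> separated f m \<epsilon> T \<Longrightarrow> card T \<le> card S"
    and x: "x \<in> \<Lambda>" and \<epsilon>: "\<epsilon> \<ge> 0"
  shows "\<exists>s\<in>S. \<forall>i<m. dist ((f ^^ i) x) ((f ^^ i) s) \<le> \<epsilon>"
proof (rule ccontr)
  assume neg: "\<not> ?thesis"
  then have "x \<notin> S" using \<epsilon> by (metis dist_self)
  have far: "\<exists>i<m. dist ((f ^^ i) x) ((f ^^ i) s) > \<epsilon>" if "s \<in> S" for s using neg that by (meson not_le)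
  have "separated f m \<epsilon> (insert x S)"
    unfolding separated_def
  proof (intro ballI impI)
    fix y z assume yz: "y \<in> insert x S" "z \<in> insert x S" "y \<noteq> z"
    consider "y = x" "z \<in> S" | "z = x" "y \<in> S" | "y \<in> S" "z \<in> S" using yz by blast
    then show "\<exists>i<m. dist ((f ^^ i) y) ((f ^^ i) z) > \<epsilon>"
    proof cases
      case 1 then show ?thesis using far by blast
    next
      case 2 then show ?thesis using far[of y] by (simp add: dist_commute)
    next
      case 3 then show ?thesis using S(3) yz(3) unfolding separated_def by blast
    qed
  qed
  then have "card (insert x S) \<le> card S" using max[of "insert x S"] S x by simp
  then show False using \<open>x \<notin> S\<close> S(1) by simp
qed

text \<open>The abstract expansion mechanism: \<open>P p\<close> is a \<open>d\<close>-dimensional coordinate near \<open>p\<close>, in which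
  \<open>f\<close> acts on pairs of points in the cone approximately as the matrix \<open>M p\<close>.  Pieces of a disc
  that follow a common itinerary of centres in \<open>\<Lambda>\<close> therefore have exponentially small volume, and
  there are at most \<open>card S ^ n\<close> itineraries if \<open>S\<close> is a maximal separated set.\<close>

locale cone_expansion =
  fixes f :: "'m::metric_space \<Rightarrow> 'm" and \<Lambda> \<Lambda>d :: "'m set" and \<delta> a :: real
    and P :: "'m \<Rightarrow> 'm \<Rightarrow> real^'k::{finite,wellorder}" and M :: "'m \<Rightarrow> real^'k::_^'k::_"
    and cone :: "'m \<Rightarrow> 'm \<Rightarrow> 'm \<Rightarrow> bool" and I :: "'k set" and x0 :: 'm
  assumes cont: "\<And>x. isCont f x" and inv: "f ` \<Lambda> \<subseteq> \<Lambda>" and sub: "\<Lambda>d \<subseteq> \<Lambda>" and x0: "x0 \<in> \<Lambda>d"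
    and stable: "\<And>U. open U \<Longrightarrow> \<Lambda> \<subseteq> U \<Longrightarrow> \<exists>V. open V \<and> \<Lambda> \<subseteq> V \<and> (\<forall>x\<in>V. \<forall>i. (f ^^ i) x \<in> U)"
    and \<delta>: "\<delta> > 0" and a: "a > 0"
    and step: "\<And>p q y z. p \<in> \<Lambda>d \<Longrightarrow> q \<in> \<Lambda> \<Longrightarrow> y \<in> ball p \<delta> \<Longrightarrow> z \<in> ball p \<delta> \<Longrightarrow> f y \<in> ball q \<delta> \<Longrightarrow> f z \<in> ball q \<delta> \<Longrightarrow>
      cone p y z \<Longrightarrow> q \<in> \<Lambda>d \<and> cone q (f y) (f z) \<and>
        norm (M p *v (P p y - P p z)) \<le> 2 * norm (P q (f y) - P q (f z))"
    and det: "\<And>p. p \<in> \<Lambda>d \<Longrightarrow> \<bar>det (M p)\<bar> \<ge> a"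
    and P_bdd: "\<And>p y z. p \<in> \<Lambda>d \<Longrightarrow> y \<in> ball p \<delta> \<Longrightarrow> z \<in> ball p \<delta> \<Longrightarrow> norm (P p y - P p z) \<le> 1"
    and P_cont: "\<And>p. p \<in> \<Lambda>d \<Longrightarrow> continuous_on (ball p \<delta>) (P p)"
    and P_supp: "\<And>p y j. p \<in> \<Lambda>d \<Longrightarrow> j \<notin> I \<Longrightarrow> P p y $ j = 0"
    and M_block: "\<And>p b j. p \<in> \<Lambda>d \<Longrightarrow> (\<And>i. i \<notin> I \<Longrightarrow> b $ i = 0) \<Longrightarrow> j \<notin> I \<Longrightarrow> (M p *v b) $ j = 0"
      "\<And>p b. p \<in> \<Lambda>d \<Longrightarrow> (\<And>i. i \<in> I \<Longrightarrow> b $ i = 0) \<Longrightarrow> M p *v b = b"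
    and disc: "\<And>U. open U \<Longrightarrow> x0 \<in> U \<Longrightarrow> \<exists>D r c. compact D \<and> D \<subseteq> U \<and> D \<subseteq> ball x0 \<delta> \<and>
      (\<forall>y\<in>D. \<forall>z\<in>D. cone x0 y z) \<and> r > 0 \<and>
      (\<forall>b. (\<forall>j. j \<notin> I \<longrightarrow> b $ j = 0) \<longrightarrow> norm b \<le> r \<longrightarrow> c + b \<in> P x0 ` D)"
begin

text \<open>The guaranteed volume growth per step: determinant at least \<open>a\<close>, less the
  loss in \<open>measure_thicken_expand\<close>.\<close>

definition \<beta> :: real where "\<beta> = a / 4 ^ CARD('k)"

lemma \<beta>_pos: "\<beta> > 0" using a by (simp add: \<beta>_def)

text \<open>The thickened volume, seen in coordinates at the current centre, grows by
  \<open>\<beta>\<close> at each step but is bounded at the end because all points are then near one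
  centre. The centres need not form an orbit.\<close>

lemma itinerary_volume:
  assumes C: "compact C" "C \<noteq> {}" and q0: "q 0 = x0" and q: "\<And>k. k \<le> n \<Longrightarrow> q k \<in> \<Lambda>"
    and near: "\<And>k z. k \<le> n \<Longrightarrow> z \<in> C \<Longrightarrow> (f ^^ k) z \<in> ball (q k) \<delta>"
    and cone0: "\<And>y z. y \<in> C \<Longrightarrow> z \<in> C \<Longrightarrow> cone x0 y z"
  shows "\<beta> ^ n * measure lebesgue (thicken I (P x0) C) \<le> measure lebesgue (cball (0::real^'k::_) 2)"
proof -
  have contC: "continuous_on C (\<lambda>z. P (q k) ((f ^^ k) z))" if "q k \<in> \<Lambda>d" "k \<le> n" for k
  proof (rule continuous_on_compose2[OF P_cont[OF that(1)]])
    show "continuous_on C (f ^^ k)" using isCont_funpow[OF cont] by (simp add: continuous_at_imp_continuous_on)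
    show "(f ^^ k) ` C \<subseteq> ball (q k) \<delta>" using near[OF that(2)] by blast
  qed
  have *: "k \<le> n \<Longrightarrow> q k \<in> \<Lambda>d \<and> (\<forall>y\<in>C. \<forall>z\<in>C. cone (q k) ((f ^^ k) y) ((f ^^ k) z)) \<and>
    \<beta> ^ k * measure lebesgue (thicken I (P x0) C) \<le> measure lebesgue (thicken I (\<lambda>z. P (q k) ((f ^^ k) z)) C)" for k
  proof (induction k)
    case 0
    then show ?case using q0 x0 cone0 by simp
  next
    case (Suc k)
    then have k: "k \<le> n" "Suc k \<le> n" by auto
    have qk: "q k \<in> \<Lambda>d" and ck: "\<And>y z. y \<in> C \<Longrightarrow> z \<in> C \<Longrightarrow> cone (q k) ((f ^^ k) y) ((f ^^ k) z)"
      and vol: "\<beta> ^ k * measure lebesgue (thicken I (P x0) C) \<le> measure lebesgue (thicken I (\<lambda>z. P (q k) ((f ^^ k) z)) C)"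
      using Suc.IH[OF k(1)] by blast+
    have st: "q (Suc k) \<in> \<Lambda>d \<and> cone (q (Suc k)) ((f ^^ Suc k) y) ((f ^^ Suc k) z) \<and>
        norm (M (q k) *v (P (q k) ((f ^^ k) y) - P (q k) ((f ^^ k) z)))
        \<le> 2 * norm (P (q (Suc k)) ((f ^^ Suc k) y) - P (q (Suc k)) ((f ^^ Suc k) z))" if yz: "y \<in> C" "z \<in> C" for y z
      using step[OF qk q[OF k(2)] near[OF k(1) yz(1)] near[OF k(1) yz(2)] _ _ ck[OF yz]]
        near[OF k(2) yz(1)] near[OF k(2) yz(2)] by simp
    \<comment> \<open>Nonemptiness of \<open>C\<close> matters: it is the points near both centres
      that transfer membership in \<open>\<Lambda>d\<close> to the next centre.\<close>
    have qS: "q (Suc k) \<in> \<Lambda>d" using st C(2) by blast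
    have "\<bar>det (M (q k))\<bar> * measure lebesgue (thicken I (\<lambda>z. P (q k) ((f ^^ k) z)) C)
        \<le> 4 ^ CARD('k) * measure lebesgue (thicken I (\<lambda>z. P (q (Suc k)) ((f ^^ Suc k) z)) C)"
      by (rule measure_thicken_expand[OF C(1) contC[OF qk k(1)] contC[OF qS k(2)]])
        (use P_supp[OF qk] P_supp[OF qS] M_block[OF qk] st in blast)+
    moreover have "a * measure lebesgue (thicken I (\<lambda>z. P (q k) ((f ^^ k) z)) C)
        \<le> \<bar>det (M (q k))\<bar> * measure lebesgue (thicken I (\<lambda>z. P (q k) ((f ^^ k) z)) C)"
      using det[OF qk] by (intro mult_right_mono) auto
    ultimately have "\<beta> * measure lebesgue (thicken I (\<lambda>z. P (q k) ((f ^^ k) z)) C)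
        \<le> measure lebesgue (thicken I (\<lambda>z. P (q (Suc k)) ((f ^^ Suc k) z)) C)"
      by (simp add: \<beta>_def field_simps)
    moreover have "\<beta> * (\<beta> ^ k * measure lebesgue (thicken I (P x0) C)) \<le> \<beta> * measure lebesgue (thicken I (\<lambda>z. P (q k) ((f ^^ k) z)) C)"
      using vol \<beta>_pos by (intro mult_left_mono) auto
    ultimately have "\<beta> ^ Suc k * measure lebesgue (thicken I (P x0) C) \<le> measure lebesgue (thicken I (\<lambda>z. P (q (Suc k)) ((f ^^ Suc k) z)) C)"
      by simp
    then show ?case using qS st by blast
  qed
  then have qn: "q n \<in> \<Lambda>d" and vol: "\<beta> ^ n * measure lebesgue (thicken I (P x0) C) \<le> measure lebesgue (thicken I (\<lambda>z. P (q n) ((f ^^ n) z)) C)"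
    by blast+
  have "measure lebesgue (thicken I (\<lambda>z. P (q n) ((f ^^ n) z)) C) \<le> measure lebesgue (cball (0::real^'k::_) 2)"
    by (rule measure_thicken_le[OF C(1) contC[OF qn order_refl]]) (intro P_bdd qn near order_refl)
  then show ?thesis using vol by simp
qed

text \<open>If fewer than \<open>\<beta> ^ m\<close> points were possible, a maximal set
  \<open>S\<close> would provide at most \<open>card S ^ n\<close> itineraries of length
  \<open>n * m\<close>, each carrying volume of order \<open>\<beta> ^ -(n * m)\<close>. Their total
  would tend to 0 with \<open>n\<close>, although they cover a disc of positive volume.\<close>

lemma many_separated:
  assumes m: "m > 0"
  shows "\<exists>S. finite S \<and> S \<subseteq> \<Lambda> \<and> separated f m (\<delta>/4) S \<and> real (card S) \<ge> \<beta> ^ m"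
proof (rule ccontr)
  assume neg: "\<not> ?thesis"
  define Q where "Q S \<longleftrightarrow> finite S \<and> S \<subseteq> \<Lambda> \<and> separated f m (\<delta>/4) S" for S
  have small: "real (card S) < \<beta> ^ m" if "Q S" for S using neg that unfolding Q_def by (meson not_le)
  have bdd: "card S < nat \<lceil>\<beta> ^ m\<rceil>" if "Q S" for S using small[OF that] by linarith
  have "Q {}" by (simp add: Q_def separated_def)
  then obtain S where S: "Q S" "\<forall>T. Q T \<longrightarrow> card T \<le> card S"
    using ex_has_greatest_nat[of Q "{}" card "nat \<lceil>\<beta> ^ m\<rceil>"] bdd by blast
  have span: "\<exists>s\<in>S. \<forall>i<m. dist ((f ^^ i) x) ((f ^^ i) s) \<le> \<delta>/4" if "x \<in> \<Lambda>" for x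
    by (rule maximal_separated_spans[of S \<Lambda>]) (use S that \<delta> in \<open>auto simp: Q_def\<close>)
  have fS: "finite S" "S \<subseteq> \<Lambda>" using S by (auto simp: Q_def)
  \<comment> \<open>An open set shadowed by \<open>S\<close>. Spanning gives distances at most
    \<open>\<delta>/4\<close>; the slack up to \<open>\<delta>/2\<close> gives openness.\<close>
  define U where "U = (\<Union>s\<in>S. \<Inter>i\<in>{..<m}. {x. dist ((f ^^ i) x) ((f ^^ i) s) < \<delta>/2})"
  have cf: "continuous_on UNIV (f ^^ i)" for i using isCont_funpow[OF cont] by (simp add: continuous_at_imp_continuous_on)
  have openU: "open U" unfolding U_def
    by (intro open_UN ballI open_INT finite_lessThan open_Collect_less continuous_on_dist cf continuous_on_const)
  have \<Lambda>U: "\<Lambda> \<subseteq> U"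
  proof
    fix x assume "x \<in> \<Lambda>"
    then obtain s where s: "s \<in> S" "\<And>i. i < m \<Longrightarrow> dist ((f ^^ i) x) ((f ^^ i) s) \<le> \<delta>/4" using span by blast
    have "dist ((f ^^ i) x) ((f ^^ i) s) < \<delta>/2" if "i < m" for i using s(2)[OF that] \<delta> by linarith
    then show "x \<in> U" unfolding U_def using s(1) by blast
  qed
  obtain V where V: "open V" "\<Lambda> \<subseteq> V" "\<And>x i. x \<in> V \<Longrightarrow> (f ^^ i) x \<in> U"
    using stable[OF openU \<Lambda>U] by blast
  have "x0 \<in> V" using V(2) sub x0 by blast
  obtain D r c where D: "compact D" "D \<subseteq> V" "D \<subseteq> ball x0 \<delta>" "\<And>y z. y \<in> D \<Longrightarrow> z \<in> D \<Longrightarrow> cone x0 y z" "r > 0"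
    "\<And>b. (\<forall>j. j \<notin> I \<longrightarrow> b $ j = 0) \<Longrightarrow> norm b \<le> r \<Longrightarrow> c + b \<in> P x0 ` D"
    using disc[OF V(1) \<open>x0 \<in> V\<close>] by (elim exE conjE) blast
  have PD: "continuous_on D (P x0)" using P_cont[OF x0] D(3) continuous_on_subset by blast
  define m0 where "m0 = measure lebesgue (thicken I (P x0) D)"
  have m0: "m0 > 0" unfolding m0_def by (rule measure_thicken_pos[OF D(1) PD D(5)]) (use D(6) in blast)
  define M0 where "M0 = measure lebesgue (cball (0::real^'k::_) 2)"
  define code where "code x = (SOME s. s \<in> S \<and> (\<forall>i<m. dist ((f ^^ i) x) ((f ^^ i) s) < \<delta>/2))" for x
  have code: "code x \<in> S \<and> (\<forall>i<m. dist ((f ^^ i) x) ((f ^^ i) (code x)) < \<delta>/2)" if "x \<in> U" for x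
  proof -
    have "\<exists>s. s \<in> S \<and> (\<forall>i<m. dist ((f ^^ i) x) ((f ^^ i) s) < \<delta>/2)" using that unfolding U_def by blast
    then show ?thesis unfolding code_def by (rule someI_ex)
  qed
  \<comment> \<open>The non-strict inequality makes the pieces compact. Position \<open>k\<close>
    belongs to block \<open>k div m\<close> and to the place \<open>k mod m\<close> within its
    block.\<close>
  define C where "C n w = {z \<in> D. \<forall>k\<in>{..<n * m}. dist ((f ^^ k) z) ((f ^^ (k mod m)) (w (k div m))) \<le> \<delta>/2}" for n and w :: "nat \<Rightarrow> 'm"
  have compC: "compact (C n w)" for n w
  proof -
    have "C n w = D \<inter> (\<Inter>k\<in>{..<n * m}. {z. dist ((f ^^ k) z) ((f ^^ (k mod m)) (w (k div m))) \<le> \<delta>/2})"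
      by (auto simp: C_def)
    then show ?thesis
      by (simp only:) (intro compact_Int_closed D closed_INT ballI closed_Collect_le continuous_on_dist cf continuous_on_const)
  qed
  have cover: "D = (\<Union>w\<in>PiE {..<n} (\<lambda>_. S). C n w)" for n
  proof (intro equalityI subsetI)
    fix z assume z: "z \<in> D"
    define w where "w = (\<lambda>j\<in>{..<n}. code ((f ^^ (j * m)) z))"
    have zU: "(f ^^ i) z \<in> U" for i using V(3) D(2) z by blast
    have "w \<in> PiE {..<n} (\<lambda>_. S)" unfolding w_def using code[OF zU] by (intro restrict_PiE[THEN iffD2] PiE_I Pi_I) auto
    moreover have "dist ((f ^^ k) z) ((f ^^ (k mod m)) (w (k div m))) \<le> \<delta>/2" if "k < n * m" for k
    proof -
      have "k div m < n" using that m by (simp add: less_mult_imp_div_less)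
      then have w: "w (k div m) = code ((f ^^ (k div m * m)) z)" by (simp add: w_def)
      have "(f ^^ k) z = (f ^^ (k mod m)) ((f ^^ (k div m * m)) z)"
        by (metis add.commute comp_apply div_mult_mod_eq funpow_add)
      moreover have "dist ((f ^^ (k mod m)) ((f ^^ (k div m * m)) z)) ((f ^^ (k mod m)) (code ((f ^^ (k div m * m)) z))) < \<delta>/2"
        using code[OF zU] m by simp
      ultimately show ?thesis unfolding w by simp
    qed
    ultimately show "z \<in> (\<Union>w\<in>PiE {..<n} (\<lambda>_. S). C n w)" using z by (auto simp: C_def)
  qed (auto simp: C_def)
  \<comment> \<open>An itinerary with \<open>n * m\<close> positions has \<open>n * m - 1\<close>
    steps, hence the exponent.\<close>
  have piece: "\<beta> ^ (n * m - 1) * measure lebesgue (thicken I (P x0) (C n w)) \<le> M0"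
    if n: "n > 0" and w: "w \<in> PiE {..<n} (\<lambda>_. S)" for n w
  proof (cases "C n w = {}")
    case True
    then show ?thesis by (simp add: thicken_def M0_def)
  next
    case False
    \<comment> \<open>At time 0 the centre is \<open>x0\<close> instead of the first code point,
      because the cone condition and the volume of the disc refer to \<open>x0\<close>.\<close>
    define q where "q k = (if k = 0 then x0 else (f ^^ (k mod m)) (w (k div m)))" for k
    have inv': "(f ^^ i) x \<in> \<Lambda>" if "x \<in> \<Lambda>" for i x using that inv by (induction i) auto
    have lt: "k < n * m" if "k \<le> n * m - 1" for k using that m n by (metis One_nat_def Suc_pred le_imp_less_Suc nat_0_less_mult_iff)
    show ?thesis unfolding M0_def
    proof (rule itinerary_volume[where q=q])
      fix k assume k: "k \<le> n * m - 1"
      show "q k \<in> \<Lambda>"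
      proof (cases "k = 0")
        case True then show ?thesis using x0 sub by (auto simp: q_def)
      next
        case False
        have "k div m < n" using lt[OF k] by (simp add: less_mult_imp_div_less)
        then have "w (k div m) \<in> S" using w by (auto simp: PiE_iff)
        then show ?thesis using False fS inv' by (auto simp: q_def)
      qed
      fix z assume z: "z \<in> C n w"
      show "(f ^^ k) z \<in> ball (q k) \<delta>"
      proof (cases "k = 0")
        case True then show ?thesis using z D(3) by (auto simp: q_def C_def)
      next
        case False
        have "dist ((f ^^ k) z) ((f ^^ (k mod m)) (w (k div m))) \<le> \<delta>/2" using z lt[OF k] by (auto simp: C_def)
        also have "\<dots> < \<delta>" using \<delta> by simp
        finally show ?thesis using False by (simp add: q_def dist_commute)
      qed
    next
      fix y z assume "y \<in> C n w" "z \<in> C n w"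
      then show "cone x0 y z" using D(4) by (auto simp: C_def)
    qed (use compC False in \<open>auto simp: q_def\<close>)
  qed
  have total: "m0 * \<beta> ^ (n * m) \<le> \<beta> * M0 * real (card S) ^ n" if n: "n > 0" for n
  proof -
    let ?W = "PiE {..<n} (\<lambda>_. S)"
    have fW: "finite ?W" using fS by (intro finite_PiE) auto
    have meas: "thicken I (P x0) (C n w) \<in> lmeasurable" for w
    proof (rule lmeasurable_compact, rule compact_thicken[OF compC])
      show "continuous_on (C n w) (P x0)" using PD by (rule continuous_on_subset) (auto simp: C_def)
    qed
    have "m0 \<le> (\<Sum>w\<in>?W. measure lebesgue (thicken I (P x0) (C n w)))"
      unfolding m0_def by (subst cover[of n], unfold thicken_UN, rule measure_UNION_le) (use fW meas in auto)
    then have "\<beta> ^ (n * m - 1) * m0 \<le> \<beta> ^ (n * m - 1) * (\<Sum>w\<in>?W. measure lebesgue (thicken I (P x0) (C n w)))"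
      using \<beta>_pos by (intro mult_left_mono) auto
    also have "\<dots> = (\<Sum>w\<in>?W. \<beta> ^ (n * m - 1) * measure lebesgue (thicken I (P x0) (C n w)))" by (rule sum_distrib_left)
    also have "\<dots> \<le> (\<Sum>w\<in>?W. M0)" by (intro sum_mono piece n)
    also have "\<dots> = real (card S) ^ n * M0" by (simp add: card_PiE)
    finally have "\<beta> * (\<beta> ^ (n * m - 1) * m0) \<le> \<beta> * (real (card S) ^ n * M0)" using \<beta>_pos by (intro mult_left_mono) auto
    \<comment> \<open>The missing step is restored by one factor \<open>\<beta>\<close>, at the
      price of a constant independent of \<open>n\<close>.\<close>
    moreover have "\<beta> * \<beta> ^ (n * m - 1) = \<beta> ^ (n * m)" using m n by (metis nat_0_less_mult_iff power_minus_mult mult.commute)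
    ultimately show ?thesis by (simp add: mult.assoc[symmetric]) (simp add: mult_ac)
  qed
  \<comment> \<open>The ratio is below 1, so its powers eventually fall below the fixed quantity
    \<open>m0 / (\<beta> * M0)\<close>.\<close>
  define x where "x = real (card S) / \<beta> ^ m"
  have x: "0 \<le> x" "x < 1" using small[OF S(1)] \<beta>_pos by (auto simp: x_def)
  have M0: "M0 > 0" using content_cball_pos[of 2 "0::real^'k::_"] by (simp add: M0_def)
  have "m0 / (\<beta> * M0) > 0" using m0 M0 \<beta>_pos by simp
  then obtain n where n: "x ^ n < m0 / (\<beta> * M0)" using real_arch_pow_inv x by blast
  have "x ^ Suc n \<le> x ^ n" using x by (intro power_decreasing) auto
  with n have "x ^ Suc n < m0 / (\<beta> * M0)" by simp
  moreover have "m0 / (\<beta> * M0) \<le> x ^ Suc n"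
  proof -
    have "m0 * (\<beta> ^ m) ^ Suc n \<le> \<beta> * M0 * real (card S) ^ Suc n"
      using total[of "Suc n"] unfolding power_mult[symmetric] by (simp add: mult.commute)
    moreover have "(\<beta> ^ m) ^ Suc n > 0" using \<beta>_pos by simp
    moreover have "m0 / B \<le> v / u" if "m0 * u \<le> B * v" "u > 0" "B > 0" for u v B :: real
      using that by (simp add: field_simps)
    ultimately show ?thesis using M0 \<beta>_pos unfolding x_def power_divide by simp
  qed
  ultimately show False by simp
qed

end

text \<open>Orbits of \<open>f\<close> sample orbits of \<phi> at multiples of \<open>N\<close>, so
  separation carries over with length multiplied by \<open>N\<close>. Only these lengths are
  controlled, which is enough for a limit superior.\<close>

lemma topological_entropy_ge:
  fixes \<phi> f :: "'m::metric_space \<Rightarrow> 'm"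
  assumes N: "N > 0" and f: "f = \<phi> ^^ N" and \<beta>: "\<beta> > 0" and \<epsilon>: "\<epsilon> > 0"
    and sep: "\<And>m. m > 0 \<Longrightarrow> \<exists>S. finite S \<and> S \<subseteq> \<Lambda> \<and> separated f m \<epsilon> S \<and> real (card S) \<ge> \<beta> ^ m"
  shows "topological_entropy \<phi> \<Lambda> \<ge> ereal (ln \<beta> / real N)"
proof -
  define H where "H n = (SUP S\<in>{S. finite S \<and> S \<subseteq> \<Lambda> \<and> separated \<phi> n \<epsilon> S}. ereal (ln (real (card S)) / real n))" for n
  have H: "ereal (ln \<beta> / real N) \<le> H (N * Suc m)" for m
  proof -
    obtain S where S: "finite S" "S \<subseteq> \<Lambda>" "separated f (Suc m) \<epsilon> S" "real (card S) \<ge> \<beta> ^ Suc m"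
      using sep[of "Suc m"] by blast
    have "separated \<phi> (N * Suc m) \<epsilon> S"
      unfolding separated_def
    proof (intro ballI impI)
      fix x y assume xy: "x \<in> S" "y \<in> S" "x \<noteq> y"
      obtain i where i: "i < Suc m" "dist ((f ^^ i) x) ((f ^^ i) y) > \<epsilon>"
        using S(3)[unfolded separated_def, rule_format, OF xy] by (elim exE conjE)
      have "f ^^ i = \<phi> ^^ (i * N)" unfolding f by (simp add: funpow_mult mult.commute)
      then show "\<exists>i<N * Suc m. \<epsilon> < dist ((\<phi> ^^ i) x) ((\<phi> ^^ i) y)"
        using i mult_less_cancel1[of N i "Suc m"] N by (intro exI[of _ "N * i"]) (simp add: mult.commute)
    qed
    then have "ereal (ln (real (card S)) / real (N * Suc m)) \<le> H (N * Suc m)"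
      unfolding H_def using S by (intro SUP_upper) auto
    moreover have "ln \<beta> / real N \<le> ln (real (card S)) / real (N * Suc m)"
    proof -
      have pos: "\<beta> ^ Suc m > 0" using \<beta> by (rule zero_less_power)
      then have "ln (\<beta> ^ Suc m) \<le> ln (real (card S))"
        using S(4) ln_le_cancel_iff[OF pos less_le_trans[OF pos S(4)]] by blast
      then have "real (Suc m) * ln \<beta> \<le> ln (real (card S))" unfolding ln_realpow .
      moreover have "x / n \<le> y / (n * s)" if "s * x \<le> y" "n > 0" "s > 0" for x y n s :: real
        using that by (simp add: field_simps)
      ultimately show ?thesis using N unfolding of_nat_mult by simp
    qed
    ultimately show ?thesis by (meson ereal_less_eq(3) order_trans)
  qed
  have "ereal (ln \<beta> / real N) \<le> limsup (H \<circ> (\<lambda>m. N * Suc m))"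
    by (rule le_Limsup) (use H in auto)
  also have "\<dots> \<le> limsup H"
    by (rule limsup_subseq_mono) (use N in \<open>auto simp: strict_mono_def\<close>)
  also have "\<dots> \<le> topological_entropy \<phi> \<Lambda>"
    unfolding topological_entropy_def H_def by (rule SUP_upper) (use \<epsilon> in simp)
  finally show ?thesis .
qed


subsection \<open>Continuity of the splitting\<close>

text \<open>Uniform closeness from \<open>has_strict_derivative_nearby\<close> allows base point and
  vector to move at the same time.\<close>

lemma has_strict_derivative_tendsto:
  assumes f: "has_strict_derivative f L a" and y: "y \<longlonglongrightarrow> a" and w: "w \<longlonglongrightarrow> w0"
    and D: "\<forall>\<^sub>F m in sequentially. (f has_derivative D m) (at (y m))"
  shows "(\<lambda>m. D m (w m)) \<longlonglongrightarrow> L w0"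
proof -
  have bl: "bounded_linear L" using f by (simp add: has_strict_derivative_def)
  obtain B where B: "B > 0" "\<And>m. norm (w m) \<le> B"
    using convergent_imp_Bseq[of w] w unfolding convergent_def Bseq_def by blast
  have "(\<lambda>m. D m (w m) - L (w m)) \<longlonglongrightarrow> 0"
  proof (rule tendstoI)
    fix e :: real assume "e > 0"
    then have "e / (2 * B) > 0" using B by simp
    then obtain r where r: "r > 0" "\<And>y D v. y \<in> ball a r \<Longrightarrow> (f has_derivative D) (at y) \<Longrightarrow> norm (D v - L v) \<le> e / (2 * B) * norm v"
      using has_strict_derivative_nearby[OF f] by metis
    have "\<forall>\<^sub>F m in sequentially. y m \<in> ball a r" using tendstoD[OF y r(1)] by (simp add: dist_commute)
    then show "\<forall>\<^sub>F m in sequentially. dist (D m (w m) - L (w m)) 0 < e"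
      using D
    proof eventually_elim
      case (elim m)
      have "norm (D m (w m) - L (w m)) \<le> e / (2 * B) * norm (w m)" by (rule r(2)[OF elim])
      also have "\<dots> \<le> e / (2 * B) * B" using B \<open>e > 0\<close> by (intro mult_left_mono) auto
      also have "\<dots> < e" using B \<open>e > 0\<close> by simp
      finally show ?case by simp
    qed
  qed
  moreover have "(\<lambda>m. L (w m)) \<longlonglongrightarrow> L w0" by (rule bounded_linear.tendsto[OF bl w])
  ultimately have "(\<lambda>m. (D m (w m) - L (w m)) + L (w m)) \<longlonglongrightarrow> 0 + L w0" by (rule tendsto_add)
  then show ?thesis by simp
qed

lemma linear_maps_tendsto:
  fixes B :: "nat \<Rightarrow> 'a::euclidean_space \<Rightarrow> 'b::real_normed_vector"
  assumes B: "\<And>v. (\<lambda>m. B m v) \<longlonglongrightarrow> B0 v" and lin: "\<And>m. linear (B m)" "linear B0" and v: "v \<longlonglongrightarrow> v0"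
  shows "(\<lambda>m. B m (v m)) \<longlonglongrightarrow> B0 v0"
proof -
  have "(\<lambda>m. \<Sum>b\<in>Basis. (v m \<bullet> b) *\<^sub>R B m b) \<longlonglongrightarrow> (\<Sum>b\<in>Basis. (v0 \<bullet> b) *\<^sub>R B0 b)"
    by (intro tendsto_sum tendsto_scaleR tendsto_inner v B tendsto_const)
  moreover have "B m (v m) = (\<Sum>b\<in>Basis. (v m \<bullet> b) *\<^sub>R B m b)" for m by (rule linear_basis_expansion[OF lin(1)])
  moreover have "B0 v0 = (\<Sum>b\<in>Basis. (v0 \<bullet> b) *\<^sub>R B0 b)" by (rule linear_basis_expansion[OF lin(2)])
  ultimately show ?thesis by (simp only:)
qed

text \<open>An injective limit map is bounded below by some \<open>c\<close>, and the approximating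
  maps are eventually bounded below by \<open>c / 2\<close>. Convergence of the right-hand sides
  therefore forces convergence of the solutions.\<close>

lemma linear_solutions_tendsto:
  fixes B :: "nat \<Rightarrow> 'a::euclidean_space \<Rightarrow> 'b::euclidean_space"
  assumes B: "\<And>v. (\<lambda>m. B m v) \<longlonglongrightarrow> B0 v" and lin: "\<And>m. linear (B m)" "linear B0" and inj: "inj B0"
    and s: "(\<lambda>m. B m (\<xi> m)) \<longlonglongrightarrow> B0 \<xi>0"
  shows "\<xi> \<longlonglongrightarrow> \<xi>0"
proof -
  obtain c where c: "c > 0" "\<And>v. c * norm v \<le> norm (B0 v)"
    using linear_inj_bounded_below_pos[OF lin(2) inj] by blast
  \<comment> \<open>The dimension compensates for the passage from basis vectors to all
    vectors.\<close>
  define e where "e = c / (2 * DIM('a))"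
  have "e > 0" using c by (simp add: e_def)
  have "\<forall>\<^sub>F m in sequentially. \<forall>b\<in>(Basis :: 'a set). norm (B m b - B0 b) < e"
    using tendstoD[OF B \<open>e > 0\<close>] by (intro eventually_ball_finite) (auto simp: dist_norm)
  then have "\<forall>\<^sub>F m in sequentially. norm (\<xi> m - \<xi>0) \<le> (2 / c) * norm (B m (\<xi> m) - B m \<xi>0)"
  proof eventually_elim
    case (elim m)
    define w where "w = \<xi> m - \<xi>0"
    have l: "linear (\<lambda>v. B m v - B0 v)" by (intro linear_compose_sub lin)
    have "norm (B m w - B0 w) \<le> DIM('a) * e * norm w"
      by (rule linear_bound_on_basis[OF l]) (use elim in \<open>auto intro: less_imp_le\<close>)
    then have "norm (B m w - B0 w) \<le> c / 2 * norm w" by (simp add: e_def)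
    moreover have "c * norm w \<le> norm (B0 w)" by (rule c)
    moreover have "norm (B0 w) \<le> norm (B m w) + norm (B m w - B0 w)"
      using norm_triangle_ineq4[of "B m w" "B m w - B0 w"] by simp
    ultimately have "c / 2 * norm w \<le> norm (B m w)" by simp
    then have "norm w \<le> (2 / c) * norm (B m w)" using c by (simp add: field_simps)
    then show ?case by (simp add: w_def linear_diff[OF lin(1)])
  qed
  moreover have "(\<lambda>m. (2 / c) * norm (B m (\<xi> m) - B m \<xi>0)) \<longlonglongrightarrow> (2 / c) * norm (B0 \<xi>0 - B0 \<xi>0)"
    by (intro tendsto_intros s B)
  then have "(\<lambda>m. (2 / c) * norm (B m (\<xi> m) - B m \<xi>0)) \<longlonglongrightarrow> 0" by simp
  ultimately have "(\<lambda>m. \<xi> m - \<xi>0) \<longlonglongrightarrow> 0" by (rule Lim_null_comparison)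
  then show ?thesis by (simp add: LIM_zero_iff)
qed

lemma tendsto_in_open: "y \<longlonglongrightarrow> x \<Longrightarrow> open W \<Longrightarrow> x \<in> W \<Longrightarrow> \<forall>\<^sub>F m in sequentially. y m \<in> W"
  by (rule topological_tendstoD)

section \<open>Convergence of chart changes, derivatives and norms\<close>

context atlas
begin

lemma chart_change_cocycle:
  assumes "c \<in> A" "d \<in> A" "e \<in> A" "x \<in> chart_dom c" "x \<in> chart_dom d" "x \<in> chart_dom e"
  shows "chart_change d e x (chart_change c d x v) = chart_change c e x v"
proof -
  have 1: "has_strict_derivative (coord e \<circ> coord_inv d) (chart_change d e x) ((coord d \<circ> coord_inv c) (coord c x))"
    using transition_strict[of d e x] assms coord_inv_coord[of c x] by simp
  have "has_strict_derivative ((coord e \<circ> coord_inv d) \<circ> (coord d \<circ> coord_inv c)) (chart_change d e x \<circ> chart_change c d x) (coord c x)"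
    using assms by (intro has_strict_derivative_compose 1 transition_strict)
  then have "has_strict_derivative (coord e \<circ> coord_inv c) (chart_change d e x \<circ> chart_change c d x) (coord c x)"
  proof (rule has_strict_derivative_transfer)
    show "open (coord c ` (chart_dom c \<inter> chart_dom d))" using assms by (intro open_coord_image chart)
    fix p assume "p \<in> coord c ` (chart_dom c \<inter> chart_dom d)"
    then obtain y where "y \<in> chart_dom c" "y \<in> chart_dom d" "p = coord c y" by blast
    then show "((coord e \<circ> coord_inv d) \<circ> (coord d \<circ> coord_inv c)) p = (coord e \<circ> coord_inv c) p"
      using coord_inv_coord[of c y] coord_inv_coord[of d y] assms by simp
  qed (use assms in auto)
  from has_derivative_unique[OF has_strict_derivative_imp_has_derivative[OF this] transition_deriv[of c e x]]
  show ?thesis using assms by (metis comp_apply)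
qed

lemma chart_change_id:
  assumes "c \<in> A" "x \<in> chart_dom c"
  shows "chart_change c c x v = v"
proof -
  have "has_strict_derivative id (chart_change c c x) (coord c x)"
  proof (rule has_strict_derivative_transfer[OF transition_strict[of c c x]])
    show "open (chart_im c)" using assms chart by blast
    fix p assume "p \<in> chart_im c"
    then show "(coord c \<circ> coord_inv c) p = id p" using coord_coord_inv[of p c] by simp
  qed (use assms in auto)
  from has_derivative_unique[OF has_strict_derivative_imp_has_derivative[OF this] has_derivative_id]
  show ?thesis by simp
qed

text \<open>The reference chart of a tangent space may jump with \<open>p\<close>. Limits are
  therefore taken in a fixed chart \<open>c\<close>, and these maps translate between
  \<open>c\<close> and the reference coordinates in which \<open>g\<close>, \<open>E\<close> and
  \<open>F\<close> are given.\<close>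

abbreviation from_chart :: "('m, 'n) chart \<Rightarrow> 'm \<Rightarrow> real^'n \<Rightarrow> real^'n" where
  "from_chart c p \<equiv> chart_change c (chart_at A p) p"

abbreviation to_chart :: "('m, 'n) chart \<Rightarrow> 'm \<Rightarrow> real^'n \<Rightarrow> real^'n" where
  "to_chart c p \<equiv> chart_change (chart_at A p) c p"

lemma from_to_chart: "c \<in> A \<Longrightarrow> p \<in> chart_dom c \<Longrightarrow> from_chart c p (to_chart c p v) = v"
  and to_from_chart: "c \<in> A \<Longrightarrow> p \<in> chart_dom c \<Longrightarrow> to_chart c p (from_chart c p v) = v"
  using chart_change_cocycle chart_change_id chart_at by metis+

lemma from_chart_linear: "c \<in> A \<Longrightarrow> p \<in> chart_dom c \<Longrightarrow> linear (from_chart c p)"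
  and to_chart_linear: "c \<in> A \<Longrightarrow> p \<in> chart_dom c \<Longrightarrow> linear (to_chart c p)"
  using chart_change_linear chart_at by metis+

lemma coord_tendsto: "c \<in> A \<Longrightarrow> x \<in> chart_dom c \<Longrightarrow> y \<longlonglongrightarrow> x \<Longrightarrow> (\<lambda>m. coord c (y m)) \<longlonglongrightarrow> coord c x"
  using isCont_tendsto_compose[OF isCont_coord] .

lemma chart_change_tendsto:
  assumes "c \<in> A" "d \<in> A" "x \<in> chart_dom c" "x \<in> chart_dom d" "y \<longlonglongrightarrow> x" "w \<longlonglongrightarrow> w0"
  shows "(\<lambda>m. chart_change c d (y m) (w m)) \<longlonglongrightarrow> chart_change c d x w0"
proof (rule has_strict_derivative_tendsto[OF transition_strict[OF assms(1-4)] coord_tendsto[OF assms(1,3,5)] assms(6)])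
  have "\<forall>\<^sub>F m in sequentially. y m \<in> chart_dom c \<inter> chart_dom d"
    by (rule tendsto_in_open[OF assms(5) open_Int[OF chart(1)[OF assms(1)] chart(1)[OF assms(2)]]]) (use assms in auto)
  then show "\<forall>\<^sub>F m in sequentially. (coord d \<circ> coord_inv c has_derivative chart_change c d (y m)) (at (coord c (y m)))"
    by eventually_elim (use assms transition_deriv in auto)
qed

lemma chart_rep_deriv_tendsto:
  assumes f: "\<And>x. mdifferentiable f x" and c: "c \<in> A" "x \<in> chart_dom c" and d: "d \<in> A" "f x \<in> chart_dom d"
    and y: "y \<longlonglongrightarrow> x" "w \<longlonglongrightarrow> w0"
  shows "(\<lambda>m. to_chart d (f (y m)) (mderiv A f (y m) (from_chart c (y m) (w m))))
    \<longlonglongrightarrow> to_chart d (f x) (mderiv A f x (from_chart c x w0))"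
proof -
  have cont: "isCont f x" using f by (simp add: mdifferentiable_def)
  have "\<forall>\<^sub>F m in sequentially. y m \<in> chart_dom c" using c chart(1) y(1) tendsto_in_open by blast
  moreover have "\<forall>\<^sub>F m in sequentially. f (y m) \<in> chart_dom d"
    using d chart(1) tendsto_in_open[OF isCont_tendsto_compose[OF cont y(1)]] by blast
  ultimately have "\<forall>\<^sub>F m in sequentially. (chart_rep f c d has_derivative (to_chart d (f (y m)) \<circ> mderiv A f (y m) \<circ> from_chart c (y m))) (at (coord c (y m)))"
    by eventually_elim (rule has_strict_derivative_imp_has_derivative[OF mderiv_strict[OF f c(1) d(1)]])
  from has_strict_derivative_tendsto[OF mderiv_strict[OF f c(1) d(1) c(2) d(2)] coord_tendsto[OF c y(1)] y(2) this]
  show ?thesis by simp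
qed

lemma metric_tendsto:
  assumes g: "riemannian_metric A g" and c: "c \<in> A" "x \<in> chart_dom c" and y: "y \<longlonglongrightarrow> x" and u: "u \<longlonglongrightarrow> u0"
  shows "(\<lambda>m. gnorm g (y m) (from_chart c (y m) (u m))) \<longlonglongrightarrow> gnorm g x (from_chart c x u0)"
proof -
  have ip: "inner_product (g p)" for p using g by (simp add: riemannian_metric_def)
  have cont: "continuous_on (chart_im c) (\<lambda>p. g (coord_inv c p) (from_chart c (coord_inv c p) a) (from_chart c (coord_inv c p) b))" for a b
  proof -
    have "smooth_on (\<lambda>p. let x = coord_inv c p; T = from_chart c x in g x (T a) (T b)) (chart_im c)"
      using g c unfolding riemannian_metric_def by blast
    then have "Ck_on 0 (\<lambda>p. let x = coord_inv c p; T = from_chart c x in g x (T a) (T b)) (chart_im c)"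
      unfolding smooth_on_def by blast
    then show ?thesis by (simp add: Let_def)
  qed
  have ev: "\<forall>\<^sub>F m in sequentially. y m \<in> chart_dom c" using c chart(1) y(1) tendsto_in_open by blast
  have ab: "(\<lambda>m. g (y m) (from_chart c (y m) a) (from_chart c (y m) b)) \<longlonglongrightarrow> g x (from_chart c x a) (from_chart c x b)" for a b
  proof -
    have "isCont (\<lambda>p. g (coord_inv c p) (from_chart c (coord_inv c p) a) (from_chart c (coord_inv c p) b)) (coord c x)"
      using cont chart(2)[OF c(1)] c(2) by (simp add: continuous_on_eq_continuous_at)
    from isCont_tendsto_compose[OF this coord_tendsto[OF c y]]
    have "(\<lambda>m. g (coord_inv c (coord c (y m))) (from_chart c (coord_inv c (coord c (y m))) a) (from_chart c (coord_inv c (coord c (y m))) b))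
      \<longlonglongrightarrow> g x (from_chart c x a) (from_chart c x b)" using coord_inv_coord[OF c] by simp
    moreover have "\<forall>\<^sub>F m in sequentially. g (coord_inv c (coord c (y m))) (from_chart c (coord_inv c (coord c (y m))) a) (from_chart c (coord_inv c (coord c (y m))) b)
      = g (y m) (from_chart c (y m) a) (from_chart c (y m) b)"
      using ev by eventually_elim (simp add: coord_inv_coord[OF c(1)])
    ultimately show ?thesis by (rule Lim_transform_eventually)
  qed
  \<comment> \<open>Regularity of the metric is given for constant chart vectors; the bilinear
    expansion extends it to convergent ones.\<close>
  have exp: "g p (from_chart c p v) (from_chart c p v) =
    (\<Sum>i\<in>Basis. \<Sum>j\<in>Basis. (v \<bullet> i) * (v \<bullet> j) * g p (from_chart c p j) (from_chart c p i))" if "p \<in> chart_dom c" for p v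
  proof -
    have l: "linear (from_chart c p)" by (rule from_chart_linear[OF c(1) that])
    have eq: "from_chart c p v = (\<Sum>b\<in>Basis. (v \<bullet> b) *\<^sub>R from_chart c p b)"
      by (rule linear_basis_expansion[OF l])
    have "g p (from_chart c p v) (from_chart c p v) =
      g p (\<Sum>b\<in>Basis. (v \<bullet> b) *\<^sub>R from_chart c p b) (\<Sum>b\<in>Basis. (v \<bullet> b) *\<^sub>R from_chart c p b)"
      by (rule arg_cong2[OF eq eq])
    also have "\<dots> = (\<Sum>i\<in>Basis. \<Sum>j\<in>Basis. (v \<bullet> i) * (v \<bullet> j) * g p (from_chart c p j) (from_chart c p i))"
      by (simp add: ip_simps[OF ip] sum_distrib_left mult.assoc)
    finally show ?thesis .
  qed
  have "(\<lambda>m. \<Sum>i\<in>Basis. \<Sum>j\<in>Basis. (u m \<bullet> i) * (u m \<bullet> j) * g (y m) (from_chart c (y m) j) (from_chart c (y m) i))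
    \<longlonglongrightarrow> (\<Sum>i\<in>Basis. \<Sum>j\<in>Basis. (u0 \<bullet> i) * (u0 \<bullet> j) * g x (from_chart c x j) (from_chart c x i))"
    by (intro tendsto_sum tendsto_mult tendsto_inner u tendsto_const ab)
  then have "(\<lambda>m. sqrt (\<Sum>i\<in>Basis. \<Sum>j\<in>Basis. (u m \<bullet> i) * (u m \<bullet> j) * g (y m) (from_chart c (y m) j) (from_chart c (y m) i)))
    \<longlonglongrightarrow> gnorm g x (from_chart c x u0)"
    unfolding gnorm_def exp[OF c(2)] by (rule tendsto_real_sqrt)
  moreover have "\<forall>\<^sub>F m in sequentially. sqrt (\<Sum>i\<in>Basis. \<Sum>j\<in>Basis. (u m \<bullet> i) * (u m \<bullet> j) * g (y m) (from_chart c (y m) j) (from_chart c (y m) i))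
    = gnorm g (y m) (from_chart c (y m) (u m))"
    using ev by eventually_elim (simp add: gnorm_def exp)
  ultimately show ?thesis by (rule Lim_transform_eventually)
qed

end

section \<open>The projection along a dominated splitting\<close>

locale splitting = C1_flow A X \<phi>
  for A :: "('m::metric_space, 'n::finite) chart set" and X :: "'m \<Rightarrow> real^'n" and \<phi> :: "real \<Rightarrow> 'm \<Rightarrow> 'm" +
  fixes g :: "'m \<Rightarrow> real^'n \<Rightarrow> real^'n \<Rightarrow> real" and \<Lambda> :: "'m set" and E F :: "'m \<Rightarrow> (real^'n) set"
  assumes metric: "riemannian_metric A g" and invariant: "compact_invariant \<phi> \<Lambda>"
    and splitting: "dominated_splitting A g \<phi> \<Lambda> E F"
begin

lemma ip: "inner_product (g p)"
  using metric by (simp add: riemannian_metric_def)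

lemma subspace_E: "p \<in> \<Lambda> \<Longrightarrow> subspace (E p)" and subspace_F: "p \<in> \<Lambda> \<Longrightarrow> subspace (F p)"
  and E_Int_F: "p \<in> \<Lambda> \<Longrightarrow> E p \<inter> F p = {0}" and E_plus_F: "p \<in> \<Lambda> \<Longrightarrow> {u + v | u v. u \<in> E p \<and> v \<in> F p} = UNIV"
  using splitting unfolding dominated_splitting_def by blast+

lemma mderiv_E: "p \<in> \<Lambda> \<Longrightarrow> mderiv A (\<phi> t) p ` E p = E (\<phi> t p)"
  and mderiv_F: "p \<in> \<Lambda> \<Longrightarrow> mderiv A (\<phi> t) p ` F p = F (\<phi> t p)"
  using splitting unfolding dominated_splitting_def by blast+

lemma flow_in: "p \<in> \<Lambda> \<Longrightarrow> \<phi> t p \<in> \<Lambda>" and compact_\<Lambda>: "compact \<Lambda>"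
  using invariant unfolding compact_invariant_def by blast+

definition projF :: "'m \<Rightarrow> real^'n \<Rightarrow> real^'n" where
  "projF p v = (THE u. u \<in> F p \<and> v - u \<in> E p)"

lemma projF_unique:
  assumes p: "p \<in> \<Lambda>" and u: "u \<in> F p" "v - u \<in> E p"
  shows "projF p v = u"
  unfolding projF_def
proof (rule the_equality)
  fix u' assume u': "u' \<in> F p \<and> v - u' \<in> E p"
  have "u - u' \<in> F p" using u u' subspace_diff[OF subspace_F[OF p]] by blast
  moreover have "(v - u') - (v - u) \<in> E p" using u u' subspace_diff[OF subspace_E[OF p]] by blast
  ultimately have "u - u' \<in> E p \<inter> F p" by simp
  then show "u' = u" using E_Int_F[OF p] by simp
qed (use u in simp)

lemma projF:
  assumes "p \<in> \<Lambda>"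
  shows projF_in: "projF p v \<in> F p" and projF_diff: "v - projF p v \<in> E p"
proof -
  have "v \<in> {u + v | u v. u \<in> E p \<and> v \<in> F p}" using E_plus_F[OF assms] by simp
  then obtain u w where uw: "u \<in> E p" "w \<in> F p" "v = u + w" by blast
  then have "projF p v = w" by (intro projF_unique[OF assms]) simp_all
  then show "projF p v \<in> F p" "v - projF p v \<in> E p" using uw by simp_all
qed

lemma projF_id: "p \<in> \<Lambda> \<Longrightarrow> v \<in> F p \<Longrightarrow> projF p v = v"
  using projF_unique[of p v v] subspace_0[OF subspace_E] by simp

lemma projF_linear:
  assumes p: "p \<in> \<Lambda>"
  shows "linear (projF p)"
proof (rule linearI)
  fix u v
  have "(u - projF p u) + (v - projF p v) \<in> E p"
    by (rule subspace_add[OF subspace_E[OF p] projF_diff[OF p] projF_diff[OF p]])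
  then show "projF p (u + v) = projF p u + projF p v"
    by (intro projF_unique[OF p] subspace_add[OF subspace_F[OF p]] projF_in[OF p]) (simp add: algebra_simps)
next
  fix c v
  have "c *\<^sub>R (v - projF p v) \<in> E p" by (rule subspace_scale[OF subspace_E[OF p] projF_diff[OF p]])
  then show "projF p (c *\<^sub>R v) = c *\<^sub>R projF p v"
    by (intro projF_unique[OF p] subspace_scale[OF subspace_F[OF p]] projF_in[OF p]) (simp add: algebra_simps)
qed

text \<open>A single frame indexed by \<open>'n\<close> makes the passage from coefficients to
  vectors an isomorphism of \<open>real^'n\<close>, in which projecting onto \<open>F\<close> means
  deleting the coefficients outside \<open>I\<close>. Each frame vector has its own chart because
  the frames of \<open>E\<close> and \<open>F\<close> may be given in different ones.\<close>

definition frame_on :: "'m set \<Rightarrow> 'n set \<Rightarrow> ('n \<Rightarrow> 'm \<Rightarrow> real^'n) \<Rightarrow> bool" where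
  "frame_on U I fr \<longleftrightarrow>
    (\<forall>y\<in>\<Lambda> \<inter> U. (\<forall>j\<in>I. fr j y \<in> F y) \<and> (\<forall>j\<in>-I. fr j y \<in> E y) \<and> span (range (\<lambda>j. fr j y)) = UNIV \<and> dim (F y) = card I) \<and>
    (\<forall>j. \<exists>c\<in>A. U \<subseteq> chart_dom c \<and> continuous_on (\<Lambda> \<inter> U) (\<lambda>y. tangent_coord A c y (fr j y)))"

lemma frame_exists:
  assumes x: "x \<in> \<Lambda>"
  shows "\<exists>U I fr. open U \<and> x \<in> U \<and> frame_on U I fr"
proof -
  have "continuous_distribution A \<Lambda> F" "continuous_distribution A \<Lambda> E"
    using splitting unfolding dominated_splitting_def by blast+
  note cd = this[unfolded continuous_distribution_def, rule_format, OF x]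
  obtain c1 U1 k and e :: "nat \<Rightarrow> 'm \<Rightarrow> real^'n" where c1: "c1 \<in> A"
    and *: "open U1 \<and> x \<in> U1 \<and> U1 \<subseteq> chart_dom c1 \<and>
      (\<forall>i<k. continuous_on (\<Lambda> \<inter> U1) (\<lambda>y. tangent_coord A c1 y (e i y))) \<and>
      (\<forall>y\<in>\<Lambda> \<inter> U1. inj_on (\<lambda>i. e i y) {..<k} \<and> independent ((\<lambda>i. e i y) ` {..<k}) \<and>
         span ((\<lambda>i. e i y) ` {..<k}) = F y)"
    using cd(1) by (elim bexE exE) (rule that)
  have U1: "open U1" "x \<in> U1" "U1 \<subseteq> chart_dom c1" using * by simp_all
  have e: "\<And>i. i < k \<Longrightarrow> continuous_on (\<Lambda> \<inter> U1) (\<lambda>y. tangent_coord A c1 y (e i y))"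
      "\<And>y. y \<in> \<Lambda> \<inter> U1 \<Longrightarrow> inj_on (\<lambda>i. e i y) {..<k}" "\<And>y. y \<in> \<Lambda> \<inter> U1 \<Longrightarrow> independent ((\<lambda>i. e i y) ` {..<k})"
      "\<And>y. y \<in> \<Lambda> \<inter> U1 \<Longrightarrow> span ((\<lambda>i. e i y) ` {..<k}) = F y"
    using * by simp_all
  obtain c2 U2 l and e' :: "nat \<Rightarrow> 'm \<Rightarrow> real^'n" where c2: "c2 \<in> A"
    and *: "open U2 \<and> x \<in> U2 \<and> U2 \<subseteq> chart_dom c2 \<and>
      (\<forall>i<l. continuous_on (\<Lambda> \<inter> U2) (\<lambda>y. tangent_coord A c2 y (e' i y))) \<and>
      (\<forall>y\<in>\<Lambda> \<inter> U2. inj_on (\<lambda>i. e' i y) {..<l} \<and> independent ((\<lambda>i. e' i y) ` {..<l}) \<and>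
         span ((\<lambda>i. e' i y) ` {..<l}) = E y)"
    using cd(2) by (elim bexE exE) (rule that)
  have U2: "open U2" "x \<in> U2" "U2 \<subseteq> chart_dom c2" using * by simp_all
  have e': "\<And>i. i < l \<Longrightarrow> continuous_on (\<Lambda> \<inter> U2) (\<lambda>y. tangent_coord A c2 y (e' i y))"
      "\<And>y. y \<in> \<Lambda> \<inter> U2 \<Longrightarrow> inj_on (\<lambda>i. e' i y) {..<l}" "\<And>y. y \<in> \<Lambda> \<inter> U2 \<Longrightarrow> independent ((\<lambda>i. e' i y) ` {..<l})"
      "\<And>y. y \<in> \<Lambda> \<inter> U2 \<Longrightarrow> span ((\<lambda>i. e' i y) ` {..<l}) = E y"
    using * by simp_all
  have dimF: "dim (F y) = k" if "y \<in> \<Lambda> \<inter> U1" for y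
    using dim_span_eq_card_independent[OF e(3)[OF that]] card_image[OF e(2)[OF that]] e(4)[OF that] by simp
  have dimE: "dim (E y) = l" if "y \<in> \<Lambda> \<inter> U2" for y
    using dim_span_eq_card_independent[OF e'(3)[OF that]] card_image[OF e'(2)[OF that]] e'(4)[OF that] by simp
  \<comment> \<open>Complementary subspaces: their dimensions add up to the full one, so the two
    local frames fill the index type exactly.\<close>
  have kl: "k + l = CARD('n)"
    using dim_sums_Int[OF subspace_E[OF x] subspace_F[OF x]] E_plus_F[OF x] E_Int_F[OF x] dimF[of x] dimE[of x] x U1 U2
    by simp
  obtain h :: "'n \<Rightarrow> nat" where h: "bij_betw h UNIV {0..<CARD('n)}"
    using ex_bij_betw_finite_nat[of "UNIV :: 'n set"] by auto
  define I where "I = {j. h j < k}"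
  have "h ` I = {0..<k}"
  proof (intro equalityI subsetI)
    fix i assume "i \<in> {0..<k}"
    then have "i \<in> range h" using h kl by (auto simp: bij_betw_def)
    then show "i \<in> h ` I" using \<open>i \<in> {0..<k}\<close> by (auto simp: I_def)
  qed (auto simp: I_def)
  moreover have "inj_on h I" using h by (auto simp: bij_betw_def intro: inj_on_subset)
  ultimately have cI: "card I = k" using card_image[of h I] by simp
  define fr where "fr j y = (if h j < k then e (h j) y else e' (h j - k) y)" for j y
  have hl: "h j - k < l" if "\<not> h j < k" for j
  proof -
    have "h j \<in> {0..<CARD('n)}" using h by (auto simp: bij_betw_def)
    then show ?thesis using kl that by auto
  qed
  have "frame_on (U1 \<inter> U2) I fr"
    unfolding frame_on_def
  proof (intro conjI ballI allI)
    fix y assume y: "y \<in> \<Lambda> \<inter> (U1 \<inter> U2)"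
    then have y1: "y \<in> \<Lambda> \<inter> U1" and y2: "y \<in> \<Lambda> \<inter> U2" and yL: "y \<in> \<Lambda>" by auto
    have eF: "e i y \<in> F y" if "i < k" for i unfolding e(4)[OF y1, symmetric] using that by (intro span_base) auto
    have eE: "e' i y \<in> E y" if "i < l" for i unfolding e'(4)[OF y2, symmetric] using that by (intro span_base) auto
    show "fr j y \<in> F y" if "j \<in> I" for j using that eF by (simp add: fr_def I_def)
    show "fr j y \<in> E y" if "j \<in> - I" for j using that eE hl[of j] by (simp add: fr_def I_def)
    let ?S = "span (range (\<lambda>j. fr j y))"
    have "e i y \<in> ?S" if "i < k" for i
    proof -
      have "i \<in> range h" using h kl that by (auto simp: bij_betw_def)
      then obtain j where "h j = i" by blast
      then have "fr j y = e i y" using that by (simp add: fr_def)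
      then show ?thesis by (metis rangeI span_base)
    qed
    then have "F y \<subseteq> ?S" unfolding e(4)[OF y1, symmetric] by (intro span_minimal) auto
    have "e' i y \<in> ?S" if "i < l" for i
    proof -
      have "k + i \<in> range h" using h kl that by (auto simp: bij_betw_def)
      then obtain j where "h j = k + i" by (metis rangeE)
      then have "fr j y = e' i y" by (simp add: fr_def)
      then show ?thesis by (metis rangeI span_base)
    qed
    then have "E y \<subseteq> ?S" unfolding e'(4)[OF y2, symmetric] by (intro span_minimal) auto
    show "?S = UNIV"
    proof (intro equalityI subset_UNIV subsetI)
      fix v :: "real^'n"
      have "v = (v - projF y v) + projF y v" by simp
      moreover have "v - projF y v \<in> ?S" "projF y v \<in> ?S"
        using projF[OF yL, of v] \<open>F y \<subseteq> ?S\<close> \<open>E y \<subseteq> ?S\<close> by blast+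
      ultimately show "v \<in> ?S" by (metis span_add)
    qed
    show "dim (F y) = card I" using dimF[OF y1] cI by simp
  next
    fix j
    show "\<exists>c\<in>A. U1 \<inter> U2 \<subseteq> chart_dom c \<and> continuous_on (\<Lambda> \<inter> (U1 \<inter> U2)) (\<lambda>y. tangent_coord A c y (fr j y))"
    proof (cases "h j < k")
      case True
      have "continuous_on (\<Lambda> \<inter> (U1 \<inter> U2)) (\<lambda>y. tangent_coord A c1 y (e (h j) y))"
        by (rule continuous_on_subset[OF e(1)[OF True]]) auto
      then show ?thesis using c1 U1 True by (intro bexI[of _ c1]) (auto simp: fr_def)
    next
      case False
      have "continuous_on (\<Lambda> \<inter> (U1 \<inter> U2)) (\<lambda>y. tangent_coord A c2 y (e' (h j - k) y))"
        by (rule continuous_on_subset[OF e'(1)[OF hl[OF False]]]) auto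
      then show ?thesis using c2 U2 False by (intro bexI[of _ c2]) (auto simp: fr_def)
    qed
  qed
  then show ?thesis using U1 U2 by (intro exI[of _ "U1 \<inter> U2"] exI[of _ I] exI[of _ fr]) auto
qed

lemma dim_F_eventually:
  assumes "x \<in> \<Lambda>"
  shows "\<exists>U. open U \<and> x \<in> U \<and> (\<forall>y\<in>\<Lambda> \<inter> U. dim (F y) = dim (F x))"
proof -
  obtain U I fr where U: "open U" "x \<in> U" and "frame_on U I fr"
    using frame_exists[OF assms] by blast
  then have U': "\<forall>y\<in>\<Lambda> \<inter> U. dim (F y) = card I" unfolding frame_on_def by simp
  then have "dim (F x) = card I" using assms U by simp
  then show ?thesis using U U' by auto
qed

text \<open>The fibre dimension is locally constant on \<Lambda> and an orbit is connected. This
  will yield injectivity of the derivative on \<open>F\<close>.\<close>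

lemma dim_F_flow:
  assumes x: "x \<in> \<Lambda>"
  shows "dim (F (\<phi> t x)) = dim (F x)"
proof -
  have "dim (F (\<phi> t x)) = dim (F (\<phi> 0 x))"
  proof (rule connected_local_const[where A=UNIV and f="\<lambda>s. dim (F (\<phi> s x))" and a=t and b=0])
    show "\<forall>a\<in>UNIV. eventually (\<lambda>b. dim (F (\<phi> a x)) = dim (F (\<phi> b x))) (at a within UNIV)"
    proof
      fix a
      obtain U where U: "open U" "\<phi> a x \<in> U" "\<forall>y\<in>\<Lambda> \<inter> U. dim (F y) = dim (F (\<phi> a x))"
        using dim_F_eventually[OF flow_in[OF x]] by blast
      have "open ((\<lambda>s. \<phi> s x) -` U)" using flow_cont_time U(1) by (simp add: open_vimage)
      then have "\<forall>\<^sub>F b in at a. b \<in> (\<lambda>s. \<phi> s x) -` U" using U(2) by (intro eventually_at_in_open') auto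
      then show "eventually (\<lambda>b. dim (F (\<phi> a x)) = dim (F (\<phi> b x))) (at a within UNIV)"
        by eventually_elim (use U(3) flow_in[OF x] in auto)
    qed
  qed auto
  then show ?thesis by (simp add: flow_0)
qed

text \<open>In frame coefficients the projection is a constant matrix. It remains to see that the
  coefficients converge, which is stability of solutions of linear systems.\<close>

lemma projF_tendsto:
  assumes x: "x \<in> \<Lambda>" and c: "c \<in> A" "x \<in> chart_dom c" and p: "p \<longlonglongrightarrow> x" "\<And>m. p m \<in> \<Lambda>" and v: "v \<longlonglongrightarrow> v0"
  shows "(\<lambda>m. to_chart c (p m) (projF (p m) (from_chart c (p m) (v m)))) \<longlonglongrightarrow> to_chart c x (projF x (from_chart c x v0))"
proof -
  obtain U I fr where U: "open U" "x \<in> U" and frame: "frame_on U I fr"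
    using frame_exists[OF x] by blast
  note fr = frame[unfolded frame_on_def, THEN conjunct1] and cont = frame[unfolded frame_on_def, THEN conjunct2]
  have "\<forall>\<^sub>F m in sequentially. p m \<in> U \<inter> chart_dom c"
    by (rule tendsto_in_open[OF p(1) open_Int[OF U(1) chart(1)[OF c(1)]]]) (use U c in auto)
  then obtain M where M: "\<And>m. m \<ge> M \<Longrightarrow> p m \<in> U \<inter> chart_dom c" unfolding eventually_sequentially by blast
  define q where "q m = p (m + M)" for m
  define w where "w m = v (m + M)" for m
  have q: "q m \<in> U" "q m \<in> chart_dom c" "q m \<in> \<Lambda>" for m using M[of "m + M"] p(2) by (auto simp: q_def)
  have qx: "q \<longlonglongrightarrow> x" unfolding q_def by (rule LIMSEQ_ignore_initial_segment[OF p(1)])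
  have w: "w \<longlonglongrightarrow> v0" unfolding w_def by (rule LIMSEQ_ignore_initial_segment[OF v])
  \<comment> \<open>\<open>Bf\<close> turns coefficients into vectors, and \<open>R\<close> deletes
    the coefficients of the frame vectors in \<open>E\<close>.\<close>
  define Bf where "Bf y \<xi> = (\<Sum>j\<in>UNIV. (\<xi> $ j) *\<^sub>R fr j y)" for y and \<xi> :: "real^'n"
  define R where "R \<xi> = (\<chi> j. if j \<in> I then \<xi> $ j else 0)" for \<xi> :: "real^'n"
  have linBf: "linear (Bf y)" for y unfolding Bf_def
    by (rule linearI) (simp_all add: scaleR_left_distrib sum.distrib scaleR_sum_right)
  have linR: "linear R" unfolding R_def by (rule linearI) (auto simp: vec_eq_iff)
  define B where "B y \<xi> = to_chart c y (Bf y \<xi>)" for y \<xi>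
  have linB: "linear (B y)" if "y \<in> chart_dom c" for y
  proof -
    have "B y = to_chart c y \<circ> Bf y" by (simp add: B_def fun_eq_iff)
    then show ?thesis using linear_compose[OF linBf to_chart_linear[OF c(1) that]] by simp
  qed
  have surjBf: "surj (Bf y)" if "y \<in> \<Lambda>" "y \<in> U" for y
  proof -
    have "fr j y \<in> range (Bf y)" for j
    proof -
      have "Bf y (axis j 1) = (\<Sum>i\<in>UNIV. if i = j then fr i y else 0)"
        unfolding Bf_def by (intro sum.cong) (auto simp: axis_def)
      then have "Bf y (axis j 1) = fr j y" by simp
      then show ?thesis by (metis rangeI)
    qed
    then have "span (range (\<lambda>j. fr j y)) \<subseteq> range (Bf y)"
      by (intro span_minimal linear_subspace_image[OF linBf] subspace_UNIV) auto
    then show ?thesis using fr that by blast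
  qed
  have surjB: "\<exists>\<xi>. B y \<xi> = u" if y: "y \<in> \<Lambda>" "y \<in> U" "y \<in> chart_dom c" for y u
  proof -
    obtain \<xi> where "Bf y \<xi> = from_chart c y u" using surjBf[OF y(1,2)] by (metis surjD)
    then have "B y \<xi> = u" unfolding B_def using to_from_chart[OF c(1) y(3)] by simp
    then show ?thesis by blast
  qed
  have projB: "projF y (from_chart c y (B y \<xi>)) = Bf y (R \<xi>)" if y: "y \<in> \<Lambda>" "y \<in> U" "y \<in> chart_dom c" for y \<xi>
  proof (rule projF_unique[OF y(1)])
    have frF: "fr j y \<in> F y" if "j \<in> I" for j using fr y that by blast
    have frE: "fr j y \<in> E y" if "j \<notin> I" for j using fr y that by blast
    show "Bf y (R \<xi>) \<in> F y" unfolding Bf_def R_def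
      by (intro subspace_sum[OF subspace_F[OF y(1)]]) (auto intro: subspace_scale[OF subspace_F[OF y(1)]] subspace_0[OF subspace_F[OF y(1)]] frF)
    have "from_chart c y (B y \<xi>) - Bf y (R \<xi>) = Bf y (\<xi> - R \<xi>)"
      unfolding B_def from_to_chart[OF c(1) y(3)] by (rule linear_diff[OF linBf, symmetric])
    also have "\<dots> \<in> E y" unfolding Bf_def R_def
      by (intro subspace_sum[OF subspace_E[OF y(1)]]) (auto intro: subspace_scale[OF subspace_E[OF y(1)]] subspace_0[OF subspace_E[OF y(1)]] frE)
    finally show "from_chart c y (B y \<xi>) - Bf y (R \<xi>) \<in> E y" .
  qed
  have frlim: "(\<lambda>m. to_chart c (q m) (fr j (q m))) \<longlonglongrightarrow> to_chart c x (fr j x)" for j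
  proof -
    obtain d where d: "d \<in> A" "U \<subseteq> chart_dom d" "continuous_on (\<Lambda> \<inter> U) (\<lambda>y. tangent_coord A d y (fr j y))"
      using cont by blast
    have "(\<lambda>m. tangent_coord A d (q m) (fr j (q m))) \<longlonglongrightarrow> tangent_coord A d x (fr j x)"
      by (rule continuous_on_tendsto_compose[OF d(3) qx]) (use x U q in auto)
    then have "(\<lambda>m. to_chart d (q m) (fr j (q m))) \<longlonglongrightarrow> to_chart d x (fr j x)" unfolding tangent_coord_def .
    from chart_change_tendsto[OF d(1) c(1) _ c(2) qx this]
    have "(\<lambda>m. chart_change d c (q m) (to_chart d (q m) (fr j (q m)))) \<longlonglongrightarrow> chart_change d c x (to_chart d x (fr j x))"
      using d(2) U(2) by blast
    moreover have "chart_change d c y (to_chart d y u) = to_chart c y u" if "y \<in> U" "y \<in> chart_dom c" for y u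
      using chart_change_cocycle[of "chart_at A y" d c y u] chart_at[of y] c(1) d that by blast
    ultimately show ?thesis using q U(2) c(2) by simp
  qed
  have Bexp: "B y \<xi> = (\<Sum>j\<in>UNIV. (\<xi> $ j) *\<^sub>R to_chart c y (fr j y))" if "y \<in> chart_dom c" for y \<xi>
    unfolding B_def Bf_def by (simp add: linear_sum[OF to_chart_linear[OF c(1) that]] linear_cmul[OF to_chart_linear[OF c(1) that]])
  have Blim: "(\<lambda>m. B (q m) \<xi>) \<longlonglongrightarrow> B x \<xi>" for \<xi>
    unfolding Bexp[OF q(2)] Bexp[OF c(2)] by (intro tendsto_sum tendsto_scaleR tendsto_const frlim)
  have "\<forall>m. \<exists>\<xi>. B (q m) \<xi> = w m" using surjB q by blast
  then obtain \<xi> where \<xi>: "\<And>m. B (q m) (\<xi> m) = w m" by metis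
  obtain \<xi>0 where \<xi>0: "B x \<xi>0 = v0" using surjB[OF x U(2) c(2)] by blast
  have "surj (B x)" using surjB[OF x U(2) c(2)] by (metis surjI)
  then have inj: "inj (B x)" using linear_surjective_imp_injective[OF linB[OF c(2)]] by blast
  have "\<xi> \<longlonglongrightarrow> \<xi>0"
    by (rule linear_solutions_tendsto[where B="\<lambda>m. B (q m)", OF Blim linB[OF q(2)] linB[OF c(2)] inj]) (simp add: \<xi> \<xi>0 w)
  then have "(\<lambda>m. R (\<xi> m)) \<longlonglongrightarrow> R \<xi>0"
    by (rule linear_maps_tendsto[where B="\<lambda>_. R", OF tendsto_const linR linR])
  then have "(\<lambda>m. B (q m) (R (\<xi> m))) \<longlonglongrightarrow> B x (R \<xi>0)"
    by (rule linear_maps_tendsto[where B="\<lambda>m. B (q m)", OF Blim linB[OF q(2)] linB[OF c(2)]])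
  moreover have "B (q m) (R (\<xi> m)) = to_chart c (q m) (projF (q m) (from_chart c (q m) (w m)))" for m
    unfolding \<xi>[of m, symmetric] projB[OF q(3,1,2)] by (simp add: B_def)
  moreover have "B x (R \<xi>0) = to_chart c x (projF x (from_chart c x v0))"
    unfolding \<xi>0[symmetric] projB[OF x U(2) c(2)] by (simp add: B_def)
  ultimately have "(\<lambda>m. to_chart c (q m) (projF (q m) (from_chart c (q m) (w m)))) \<longlonglongrightarrow> to_chart c x (projF x (from_chart c x v0))"
    by simp
  then show ?thesis unfolding q_def w_def by (rule LIMSEQ_offset)
qed

end


subsection \<open>Cones are invariant and expanded\<close>

lemma linear_inj_on_if_dim_preserved:
  fixes D :: "'a::euclidean_space \<Rightarrow> 'b::euclidean_space"
  assumes D: "linear D" and S: "subspace S" and dim: "dim (D ` S) = dim S" and v: "v \<in> S" "D v = 0"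
  shows "v = 0"
proof (rule ccontr)
  assume "v \<noteq> 0"
  then have "independent {v}" by simp
  then obtain B where B: "{v} \<subseteq> B" "B \<subseteq> S" "independent B" "S \<subseteq> span B"
    using maximal_independent_subset_extend[of "{v}" S] v(1) by blast
  have fB: "finite B" by (rule independent_imp_finite[OF B(3)])
  have "D ` S \<subseteq> span (D ` (B - {v}))"
  proof -
    have "D ` S \<subseteq> D ` span B" using B(4) by (rule image_mono)
    also have "\<dots> = span (D ` B)" by (rule linear_span_image[OF D, symmetric])
    also have "D ` B = insert 0 (D ` (B - {v}))" using B(1) v(2) by auto
    also have "span (insert 0 (D ` (B - {v}))) = span (D ` (B - {v}))" by (rule span_insert_0)
    finally show ?thesis .
  qed
  then have "dim (D ` S) \<le> card (D ` (B - {v}))" using fB by (intro dim_le_card) auto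
  also have "\<dots> \<le> card (B - {v})" using fB by (intro card_image_le) auto
  also have "\<dots> < card B" using fB B(1) by (intro psubset_card_mono) auto
  also have "card B = dim S"
    using B by (intro dim_unique[symmetric]) (auto simp: span_superset)
  finally show False using dim by simp
qed

text \<open>Both endpoints move and neither need equal \<open>a\<close>; an ordinary derivative at
  \<open>a\<close> would not control this quotient.\<close>

lemma has_strict_derivative_quotient_tendsto:
  assumes f: "has_strict_derivative f L a" and y: "y \<longlonglongrightarrow> a" and z: "z \<longlonglongrightarrow> a"
    and u: "(\<lambda>m. (y m - z m) /\<^sub>R norm (y m - z m)) \<longlonglongrightarrow> u"
  shows "(\<lambda>m. (f (y m) - f (z m)) /\<^sub>R norm (y m - z m)) \<longlonglongrightarrow> L u"
proof -
  have bl: "bounded_linear L" using f by (simp add: has_strict_derivative_def)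
  have "(\<lambda>m. (f (y m) - f (z m) - L (y m - z m)) /\<^sub>R norm (y m - z m)) \<longlonglongrightarrow> 0"
  proof (rule tendstoI)
    fix e :: real assume "e > 0"
    then have "e / 2 > 0" by simp
    from has_strict_derivativeD[OF f this] obtain r where r: "r > 0"
      "\<And>y z. y \<in> ball a r \<Longrightarrow> z \<in> ball a r \<Longrightarrow> norm (f y - f z - L (y - z)) \<le> e / 2 * norm (y - z)" by blast
    have "\<forall>\<^sub>F m in sequentially. y m \<in> ball a r" "\<forall>\<^sub>F m in sequentially. z m \<in> ball a r"
      using tendstoD[OF y r(1)] tendstoD[OF z r(1)] by (simp_all add: dist_commute)
    then show "\<forall>\<^sub>F m in sequentially. dist ((f (y m) - f (z m) - L (y m - z m)) /\<^sub>R norm (y m - z m)) 0 < e"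
    proof eventually_elim
      case (elim m)
      define n where "n = norm (y m - z m)"
      define R where "R = norm (f (y m) - f (z m) - L (y m - z m))"
      have "R \<le> e / 2 * n" unfolding R_def n_def by (rule r(2)[OF elim])
      then have "R / n \<le> e / 2" using \<open>e > 0\<close> by (cases "n = 0") (simp_all add: pos_divide_le_eq n_def)
      moreover have "norm ((f (y m) - f (z m) - L (y m - z m)) /\<^sub>R norm (y m - z m)) = R / n"
        unfolding R_def n_def by (simp add: divide_inverse)
      ultimately show ?case using \<open>e > 0\<close> unfolding dist_norm diff_0_right by linarith
    qed
  qed
  moreover have "(\<lambda>m. L ((y m - z m) /\<^sub>R norm (y m - z m))) \<longlonglongrightarrow> L u" by (rule bounded_linear.tendsto[OF bl u])
  ultimately have "(\<lambda>m. (f (y m) - f (z m) - L (y m - z m)) /\<^sub>R norm (y m - z m) + L ((y m - z m) /\<^sub>R norm (y m - z m))) \<longlonglongrightarrow> 0 + L u"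
    by (rule tendsto_add)
  moreover have "(f (y m) - f (z m) - L (y m - z m)) /\<^sub>R norm (y m - z m) + L ((y m - z m) /\<^sub>R norm (y m - z m))
    = (f (y m) - f (z m)) /\<^sub>R norm (y m - z m)" for m
    unfolding linear_cmul[OF bounded_linear.linear[OF bl]] by (simp only: scaleR_add_right[symmetric] diff_add_cancel)
  ultimately show ?thesis by simp
qed

context splitting
begin

text \<open>The argument \<open>v\<close> is typically a coordinate difference of two points near
  \<open>p\<close>, treated as a tangent vector at \<open>p\<close>. The cone used throughout is
  \<open>nE \<le> nF\<close>.\<close>

definition nF :: "('m, 'n) chart \<Rightarrow> 'm \<Rightarrow> real^'n \<Rightarrow> real" where
  "nF c p v = gnorm g p (projF p (from_chart c p v))"

definition nE :: "('m, 'n) chart \<Rightarrow> 'm \<Rightarrow> real^'n \<Rightarrow> real" where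
  "nE c p v = gnorm g p (from_chart c p v - projF p (from_chart c p v))"

lemma gnorm_scale: "gnorm g p (r *\<^sub>R v) = \<bar>r\<bar> * gnorm g p v"
  unfolding gnorm_def by (simp add: ip_simps[OF ip] real_sqrt_mult mult.assoc[symmetric] flip: power2_eq_square)

lemma gnorm_nonneg: "gnorm g p v \<ge> 0"
  unfolding gnorm_def by (simp add: ip_nonneg[OF ip])

lemma gnorm_0: "gnorm g p 0 = 0"
  unfolding gnorm_def by (simp add: ip_simps[OF ip])

lemma gnorm_pos: "v \<noteq> 0 \<Longrightarrow> gnorm g p v > 0"
  unfolding gnorm_def by (simp add: ip_pos[OF ip])

lemma nF_scale: "p \<in> \<Lambda> \<Longrightarrow> c \<in> A \<Longrightarrow> p \<in> chart_dom c \<Longrightarrow> nF c p (r *\<^sub>R v) = \<bar>r\<bar> * nF c p v"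
  and nE_scale: "p \<in> \<Lambda> \<Longrightarrow> c \<in> A \<Longrightarrow> p \<in> chart_dom c \<Longrightarrow> nE c p (r *\<^sub>R v) = \<bar>r\<bar> * nE c p v"
  unfolding nF_def nE_def
  by (simp_all add: linear_cmul[OF from_chart_linear] linear_cmul[OF projF_linear] gnorm_scale flip: scaleR_diff_right)

lemma nF_tendsto:
  assumes x: "x \<in> \<Lambda>" and c: "c \<in> A" "x \<in> chart_dom c" and p: "p \<longlonglongrightarrow> x" "\<And>m. p m \<in> \<Lambda>" and v: "v \<longlonglongrightarrow> v0"
  shows "(\<lambda>m. nF c (p m) (v m)) \<longlonglongrightarrow> nF c x v0"
proof -
  have "(\<lambda>m. gnorm g (p m) (from_chart c (p m) (to_chart c (p m) (projF (p m) (from_chart c (p m) (v m))))))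
    \<longlonglongrightarrow> gnorm g x (from_chart c x (to_chart c x (projF x (from_chart c x v0))))"
    by (rule metric_tendsto[OF metric c p(1) projF_tendsto[OF assms]])
  moreover have "\<forall>\<^sub>F m in sequentially. p m \<in> chart_dom c" using tendsto_in_open[OF p(1) chart(1)[OF c(1)] c(2)] .
  then have "\<forall>\<^sub>F m in sequentially. gnorm g (p m) (from_chart c (p m) (to_chart c (p m) (projF (p m) (from_chart c (p m) (v m)))))
    = nF c (p m) (v m)"
    by eventually_elim (simp add: from_to_chart[OF c(1)] nF_def)
  ultimately have "(\<lambda>m. nF c (p m) (v m)) \<longlonglongrightarrow> gnorm g x (from_chart c x (to_chart c x (projF x (from_chart c x v0))))"
    by (rule Lim_transform_eventually)
  then show ?thesis by (simp add: from_to_chart[OF c] nF_def)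
qed

lemma nE_tendsto:
  assumes x: "x \<in> \<Lambda>" and c: "c \<in> A" "x \<in> chart_dom c" and p: "p \<longlonglongrightarrow> x" "\<And>m. p m \<in> \<Lambda>" and v: "v \<longlonglongrightarrow> v0"
  shows "(\<lambda>m. nE c (p m) (v m)) \<longlonglongrightarrow> nE c x v0"
proof -
  have eq: "gnorm g y (from_chart c y (u - to_chart c y (projF y (from_chart c y u)))) = nE c y u" if "y \<in> chart_dom c" for y u
    by (simp add: linear_diff[OF from_chart_linear[OF c(1) that]] from_to_chart[OF c(1) that] nE_def)
  have "(\<lambda>m. gnorm g (p m) (from_chart c (p m) (v m - to_chart c (p m) (projF (p m) (from_chart c (p m) (v m))))))
    \<longlonglongrightarrow> gnorm g x (from_chart c x (v0 - to_chart c x (projF x (from_chart c x v0))))"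
    by (rule metric_tendsto[OF metric c p(1) tendsto_diff[OF v projF_tendsto[OF assms]]])
  moreover have "\<forall>\<^sub>F m in sequentially. p m \<in> chart_dom c" using tendsto_in_open[OF p(1) chart(1)[OF c(1)] c(2)] .
  then have "\<forall>\<^sub>F m in sequentially. gnorm g (p m) (from_chart c (p m) (v m - to_chart c (p m) (projF (p m) (from_chart c (p m) (v m)))))
    = nE c (p m) (v m)"
    by eventually_elim (rule eq)
  ultimately have "(\<lambda>m. nE c (p m) (v m)) \<longlonglongrightarrow> gnorm g x (from_chart c x (v0 - to_chart c x (projF x (from_chart c x v0))))"
    by (rule Lim_transform_eventually)
  then show ?thesis by (simp add: eq[OF c(2)])
qed

text \<open>Differentiability was obtained for nonnegative times, so injectivity is not drawn from
  an inverse derivative. It follows from the equal dimensions of a fibre and its image.\<close>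

lemma mderiv_inj_on_F:
  assumes "p \<in> \<Lambda>" "t \<ge> 0" "v \<in> F p" "mderiv A (\<phi> t) p v = 0"
  shows "v = 0"
  by (rule linear_inj_on_if_dim_preserved[OF mderiv_linear[OF flow_mdifferentiable[OF assms(2)]] subspace_F[OF assms(1)] _ assms(3,4)])
    (simp add: mderiv_F[OF assms(1)] dim_F_flow[OF assms(1)])

lemma projF_mderiv:
  assumes p: "p \<in> \<Lambda>" and t: "t \<ge> 0"
  shows "projF (\<phi> t p) (mderiv A (\<phi> t) p v) = mderiv A (\<phi> t) p (projF p v)"
proof (rule projF_unique[OF flow_in[OF p]])
  show "mderiv A (\<phi> t) p (projF p v) \<in> F (\<phi> t p)" unfolding mderiv_F[OF p, symmetric] using projF_in[OF p] by blast
  have "mderiv A (\<phi> t) p v - mderiv A (\<phi> t) p (projF p v) = mderiv A (\<phi> t) p (v - projF p v)"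
    by (rule linear_diff[OF mderiv_linear[OF flow_mdifferentiable[OF t]], symmetric])
  also have "\<dots> \<in> E (\<phi> t p)" unfolding mderiv_E[OF p, symmetric] using projF_diff[OF p] by blast
  finally show "mderiv A (\<phi> t) p v - mderiv A (\<phi> t) p (projF p v) \<in> E (\<phi> t p)" .
qed

text \<open>Domination at a single time with a factor below 1. The constant in
  \<open>dominated_splitting\<close> may exceed 1, so this holds only once the time is
  large.\<close>

definition dominates_at :: "real \<Rightarrow> bool" where
  "dominates_at t \<longleftrightarrow> (\<exists>\<kappa><1. \<forall>x\<in>\<Lambda>. \<forall>u\<in>E x. \<forall>v\<in>F x. gnorm g x u = 1 \<longrightarrow> gnorm g x v = 1 \<longrightarrow>
     gnorm g (\<phi> t x) (mderiv A (\<phi> t) x u) \<le> \<kappa> * gnorm g (\<phi> t x) (mderiv A (\<phi> t) x v))"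

text \<open>The closed cone, without zero, goes into the open cone. Strictness is what survives when
  the tangent vector is replaced by nearby pairs of points.\<close>

lemma cone_strictly_invariant:
  assumes dom: "dominates_at t" and t: "t \<ge> 0" and x: "x \<in> \<Lambda>" and P: "P \<in> F x" and Q: "Q \<in> E x"
    and le: "gnorm g x Q \<le> gnorm g x P" and P0: "P \<noteq> 0"
  shows "gnorm g (\<phi> t x) (mderiv A (\<phi> t) x Q) < gnorm g (\<phi> t x) (mderiv A (\<phi> t) x P)"
proof -
  let ?D = "mderiv A (\<phi> t) x"
  have lin: "linear ?D" by (rule mderiv_linear[OF flow_mdifferentiable[OF t]])
  have "?D P \<noteq> 0" using mderiv_inj_on_F[OF x t P] P0 by blast
  then have DP: "gnorm g (\<phi> t x) (?D P) > 0" by (rule gnorm_pos)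
  show ?thesis
  proof (cases "Q = 0")
    case True
    then show ?thesis using DP linear_0[OF lin] gnorm_0 by simp
  next
    case False
    \<comment> \<open>Domination is stated for unit vectors, so both components are normalised; this
      is why \<open>Q = 0\<close> is treated separately.\<close>
    obtain \<kappa> where \<kappa>: "\<kappa> < 1" "\<forall>x\<in>\<Lambda>. \<forall>u\<in>E x. \<forall>v\<in>F x. gnorm g x u = 1 \<longrightarrow> gnorm g x v = 1 \<longrightarrow>
     gnorm g (\<phi> t x) (mderiv A (\<phi> t) x u) \<le> \<kappa> * gnorm g (\<phi> t x) (mderiv A (\<phi> t) x v)"
      using dom unfolding dominates_at_def by blast
    define q where "q = gnorm g x Q"
    define s where "s = gnorm g x P"
    have q: "q > 0" and s: "s > 0" using gnorm_pos False P0 by (auto simp: q_def s_def)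
    have "gnorm g (\<phi> t x) (?D ((1/q) *\<^sub>R Q)) \<le> \<kappa> * gnorm g (\<phi> t x) (?D ((1/s) *\<^sub>R P))"
      by (rule \<kappa>(2)[rule_format, OF x])
        (use q s P Q subspace_scale[OF subspace_E[OF x]] subspace_scale[OF subspace_F[OF x]] in \<open>simp_all add: gnorm_scale flip: q_def s_def\<close>)
    then have "gnorm g (\<phi> t x) (?D Q) / q \<le> \<kappa> * (gnorm g (\<phi> t x) (?D P) / s)"
      using q s by (simp add: linear_cmul[OF lin] gnorm_scale)
    also have "\<dots> < 1 * (gnorm g (\<phi> t x) (?D P) / s)"
      using \<kappa>(1) DP s by (intro mult_strict_right_mono divide_pos_pos) auto
    also have "\<dots> \<le> gnorm g (\<phi> t x) (?D P) / q"
      using le DP q by (simp add: q_def s_def frac_le)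
    finally show ?thesis using q by (simp add: divide_less_cancel)
  qed
qed

text \<open>A blow-up argument: divided by their length, the coordinate differences subconverge to a
  unit vector in the cone at \<open>x\<close>, and the strict inequalities for its image hold for
  the pairs far along the sequence. One good index suffices, since the lemma serves a proof by
  contradiction.\<close>

lemma pair_sequences:
  assumes dom: "dominates_at t" and t: "t \<ge> 0" and x: "x \<in> \<Lambda>"
    and c: "c \<in> A" "x \<in> chart_dom c" and d: "d \<in> A" "\<phi> t x \<in> chart_dom d"
    and p: "p \<longlonglongrightarrow> x" "\<And>m. p m \<in> \<Lambda>" and q: "q \<longlonglongrightarrow> \<phi> t x" "\<And>m. q m \<in> \<Lambda>"
    and y: "y \<longlonglongrightarrow> x" and z: "z \<longlonglongrightarrow> x"
    and cone: "\<And>m. nE c (p m) (coord c (y m) - coord c (z m)) \<le> nF c (p m) (coord c (y m) - coord c (z m))"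
  shows "\<exists>m. nE d (q m) (coord d (\<phi> t (y m)) - coord d (\<phi> t (z m))) \<le> nF d (q m) (coord d (\<phi> t (y m)) - coord d (\<phi> t (z m))) \<and>
    gnorm g (\<phi> t (p m)) (mderiv A (\<phi> t) (p m) (projF (p m) (from_chart c (p m) (coord c (y m) - coord c (z m)))))
      \<le> 2 * nF d (q m) (coord d (\<phi> t (y m)) - coord d (\<phi> t (z m)))"
proof -
  let ?f = "\<phi> t"
  have md: "mdifferentiable ?f x" for x by (rule flow_mdifferentiable[OF t])
  have cf: "isCont ?f x" for x by (rule flow_cont[OF t])
  have fp: "(\<lambda>m. ?f (p m)) \<longlonglongrightarrow> ?f x"
    by (rule isCont_tendsto_compose[OF cf p(1)])
  define v where "v m = coord c (y m) - coord c (z m)" for m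
  define w where "w m = coord d (?f (y m)) - coord d (?f (z m))" for m
  define nD where "nD m u = gnorm g (?f (p m)) (mderiv A ?f (p m) (projF (p m) (from_chart c (p m) u)))" for m u
  have "\<forall>\<^sub>F m in sequentially. y m \<in> chart_dom c \<and> z m \<in> chart_dom c \<and> p m \<in> chart_dom c \<and> q m \<in> chart_dom d \<and> ?f (p m) \<in> chart_dom d"
    using tendsto_in_open[OF y chart(1)[OF c(1)] c(2)] tendsto_in_open[OF z chart(1)[OF c(1)] c(2)] tendsto_in_open[OF p(1) chart(1)[OF c(1)] c(2)]
      tendsto_in_open[OF q(1) chart(1)[OF d(1)] d(2)] tendsto_in_open[OF fp chart(1)[OF d(1)] d(2)]
    by eventually_elim simp
  then obtain M where M: "\<And>m. m \<ge> M \<Longrightarrow> y m \<in> chart_dom c \<and> z m \<in> chart_dom c \<and> p m \<in> chart_dom c \<and> q m \<in> chart_dom d \<and> ?f (p m) \<in> chart_dom d"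
    unfolding eventually_sequentially by blast
  have linD: "linear (mderiv A ?f p)" for p by (rule mderiv_linear[OF md])
  have nD_scale: "nD m (r *\<^sub>R u) = \<bar>r\<bar> * nD m u" if "m \<ge> M" for m r u
    using M[OF that] p(2)[of m] unfolding nD_def
    by (simp add: linear_cmul[OF from_chart_linear[OF c(1)]] linear_cmul[OF projF_linear] linear_cmul[OF linD] gnorm_scale)
  have goal: "\<exists>m. nE d (q m) (w m) \<le> nF d (q m) (w m) \<and> nD m (v m) \<le> 2 * nF d (q m) (w m)"
  proof (cases "\<exists>m\<ge>M. v m = 0")
    \<comment> \<open>Here the two points coincide, and both inequalities read
      \<open>0 \<le> 0\<close>.\<close>
    case True
    then obtain m where m: "m \<ge> M" "v m = 0" by blast
    have inD: "y m \<in> chart_dom c" "z m \<in> chart_dom c" using M[OF m(1)] by simp_all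
    have eq: "coord c (y m) = coord c (z m)" using m(2) by (simp add: v_def)
    have "y m = coord_inv c (coord c (y m))" by (rule coord_inv_coord[OF c(1) inD(1), symmetric])
    also have "\<dots> = coord_inv c (coord c (z m))" by (simp only: eq)
    also have "\<dots> = z m" by (rule coord_inv_coord[OF c(1) inD(2)])
    finally have "y m = z m" .
    then have "w m = 0" by (simp add: w_def)
    have "nE d (q m) 0 = 0" "nF d (q m) 0 = 0"
      using nE_scale[OF q(2) d(1), of m 0 0] nF_scale[OF q(2) d(1), of m 0 0] M[OF m(1)] by simp_all
    moreover have "nD m 0 = 0" using nD_scale[OF m(1), of 0 0] by simp
    ultimately show ?thesis using \<open>w m = 0\<close> m(2) by (intro exI[of _ m]) simp
  next
    case False
    define u where "u m = v (m + M) /\<^sub>R norm (v (m + M))" for m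
    have vnz: "v (m + M) \<noteq> 0" for m using False by simp
    have "u m \<in> sphere 0 1" for m using vnz by (simp add: u_def)
    then obtain u0 r where u0: "u0 \<in> sphere 0 1" "strict_mono r" "(u \<circ> r) \<longlonglongrightarrow> u0"
      using compact_sphere[of "0::real^'n" 1, unfolded compact_def] by metis
    define s where "s m = r m + M" for m
    have s: "strict_mono s" "\<And>m. s m \<ge> M" using u0(2) by (auto simp: s_def strict_mono_def)
    have sub: "(\<lambda>m. a (s m)) \<longlonglongrightarrow> l" if "a \<longlonglongrightarrow> l" for a :: "nat \<Rightarrow> 'm" and l
      using LIMSEQ_subseq_LIMSEQ[OF that s(1)] by (simp add: o_def)
    define \<nu> where "\<nu> m = norm (v (s m))" for m
    have \<nu>: "\<nu> m > 0" for m using vnz[of "r m"] by (simp add: \<nu>_def s_def)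
    have ulim: "(\<lambda>m. v (s m) /\<^sub>R \<nu> m) \<longlonglongrightarrow> u0" using u0(3) by (simp add: o_def u_def s_def \<nu>_def)
    define L where "L = to_chart d (?f x) \<circ> mderiv A ?f x \<circ> from_chart c x"
    have SD: "has_strict_derivative (chart_rep ?f c d) L (coord c x)"
      unfolding L_def by (rule mderiv_strict[OF md c(1) d(1) c(2) d(2)])
    have "(\<lambda>m. (chart_rep ?f c d (coord c (y (s m))) - chart_rep ?f c d (coord c (z (s m)))) /\<^sub>R norm (coord c (y (s m)) - coord c (z (s m)))) \<longlonglongrightarrow> L u0"
      by (rule has_strict_derivative_quotient_tendsto[OF SD coord_tendsto[OF c sub[OF y]] coord_tendsto[OF c sub[OF z]]])
        (use ulim in \<open>simp add: v_def \<nu>_def\<close>)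
    moreover have "chart_rep ?f c d (coord c (y (s m))) = coord d (?f (y (s m)))" "chart_rep ?f c d (coord c (z (s m))) = coord d (?f (z (s m)))" for m
      using M[OF s(2)[of m]] coord_inv_coord[OF c(1)] by simp_all
    ultimately have wlim: "(\<lambda>m. w (s m) /\<^sub>R \<nu> m) \<longlonglongrightarrow> L u0" by (simp add: w_def \<nu>_def v_def)
    have "nE c x u0 \<le> nF c x u0"
    proof (rule LIMSEQ_le)
      show "(\<lambda>m. nE c (p (s m)) (v (s m) /\<^sub>R \<nu> m)) \<longlonglongrightarrow> nE c x u0"
        by (rule nE_tendsto[OF x c sub[OF p(1)] p(2) ulim])
      show "(\<lambda>m. nF c (p (s m)) (v (s m) /\<^sub>R \<nu> m)) \<longlonglongrightarrow> nF c x u0"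
        by (rule nF_tendsto[OF x c sub[OF p(1)] p(2) ulim])
      have "nE c (p (s m)) (v (s m) /\<^sub>R \<nu> m) \<le> nF c (p (s m)) (v (s m) /\<^sub>R \<nu> m)" for m
        using nE_scale[OF p(2) c(1), of "s m" "inverse (\<nu> m)" "v (s m)"] nF_scale[OF p(2) c(1), of "s m" "inverse (\<nu> m)" "v (s m)"]
          M[OF s(2)[of m]] cone[of "s m"] \<nu>[of m] by (simp add: v_def)
      then show "\<exists>N. \<forall>m\<ge>N. nE c (p (s m)) (v (s m) /\<^sub>R \<nu> m) \<le> nF c (p (s m)) (v (s m) /\<^sub>R \<nu> m)" by blast
    qed
    define V where "V = from_chart c x u0"
    define Pv where "Pv = projF x V"
    have le: "gnorm g x (V - Pv) \<le> gnorm g x Pv" using \<open>nE c x u0 \<le> nF c x u0\<close> by (simp add: nE_def nF_def V_def Pv_def)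
    have "V \<noteq> 0"
    proof
      assume "V = 0"
      then have "u0 = to_chart c x 0" using to_from_chart[OF c, of u0] by (simp add: V_def)
      then show False using u0(1) linear_0[OF to_chart_linear[OF c]] by simp
    qed
    have "Pv \<noteq> 0"
    proof
      assume "Pv = 0"
      then have "gnorm g x V \<le> 0" using le gnorm_0 by simp
      then show False using gnorm_pos[OF \<open>V \<noteq> 0\<close>, of x] by simp
    qed
    have PF: "Pv \<in> F x" "V - Pv \<in> E x" unfolding Pv_def by (rule projF_in[OF x] projF_diff[OF x])+
    have fL: "from_chart d (?f x) (L u0) = mderiv A ?f x V" by (simp add: L_def from_to_chart[OF d] V_def)
    have nFL: "nF d (?f x) (L u0) = gnorm g (?f x) (mderiv A ?f x Pv)"
      unfolding nF_def fL projF_mderiv[OF x t] Pv_def ..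
    have nEL: "nE d (?f x) (L u0) = gnorm g (?f x) (mderiv A ?f x (V - Pv))"
      unfolding nE_def fL projF_mderiv[OF x t] Pv_def by (simp add: linear_diff[OF linD])
    have strict: "nE d (?f x) (L u0) < nF d (?f x) (L u0)"
      unfolding nFL nEL by (rule cone_strictly_invariant[OF dom t x PF le \<open>Pv \<noteq> 0\<close>])
    have pos: "nF d (?f x) (L u0) > 0"
      using strict gnorm_nonneg[of "?f x"] unfolding nE_def by (rule le_less_trans[rotated])
    have qE: "(\<lambda>m. nE d (q (s m)) (w (s m) /\<^sub>R \<nu> m)) \<longlonglongrightarrow> nE d (?f x) (L u0)"
      by (rule nE_tendsto[OF flow_in[OF x] d sub[OF q(1)] q(2) wlim])
    have qF: "(\<lambda>m. nF d (q (s m)) (w (s m) /\<^sub>R \<nu> m)) \<longlonglongrightarrow> nF d (?f x) (L u0)"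
      by (rule nF_tendsto[OF flow_in[OF x] d sub[OF q(1)] q(2) wlim])
    have "(\<lambda>m. to_chart d (?f (p (s m))) (mderiv A ?f (p (s m)) (from_chart c (p (s m)) (v (s m) /\<^sub>R \<nu> m)))) \<longlonglongrightarrow> L u0"
      unfolding L_def o_def by (rule chart_rep_deriv_tendsto[OF md c d sub[OF p(1)] ulim])
    from nF_tendsto[OF flow_in[OF x] d sub[OF fp] flow_in[OF p(2)] this]
    have "(\<lambda>m. nF d (?f (p (s m))) (to_chart d (?f (p (s m))) (mderiv A ?f (p (s m)) (from_chart c (p (s m)) (v (s m) /\<^sub>R \<nu> m))))) \<longlonglongrightarrow> nF d (?f x) (L u0)" .
    moreover have "nF d (?f (p (s m))) (to_chart d (?f (p (s m))) (mderiv A ?f (p (s m)) (from_chart c (p (s m)) u))) = nD (s m) u" for m u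
      using from_to_chart[OF d(1)] M[OF s(2)[of m]] unfolding nF_def nD_def by (simp add: projF_mderiv[OF p(2) t])
    ultimately have qD: "(\<lambda>m. nD (s m) (v (s m) /\<^sub>R \<nu> m)) \<longlonglongrightarrow> nF d (?f x) (L u0)" by simp
    have "\<forall>\<^sub>F m in sequentially. nE d (q (s m)) (w (s m) /\<^sub>R \<nu> m) < nF d (q (s m)) (w (s m) /\<^sub>R \<nu> m)"
      using order_tendstoD(1)[OF tendsto_diff[OF qF qE], of 0] strict by simp
    \<comment> \<open>Both sides, without the factor 2, tend to the same positive number. The factor
      2 creates the gap that makes the inequality hold before the limit.\<close>
    moreover have "\<forall>\<^sub>F m in sequentially. nD (s m) (v (s m) /\<^sub>R \<nu> m) < 2 * nF d (q (s m)) (w (s m) /\<^sub>R \<nu> m)"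
      using order_tendstoD(1)[OF tendsto_diff[OF tendsto_mult[OF tendsto_const[of 2] qF] qD], of 0] pos by simp
    ultimately have "\<forall>\<^sub>F m in sequentially. nE d (q (s m)) (w (s m) /\<^sub>R \<nu> m) < nF d (q (s m)) (w (s m) /\<^sub>R \<nu> m) \<and>
        nD (s m) (v (s m) /\<^sub>R \<nu> m) < 2 * nF d (q (s m)) (w (s m) /\<^sub>R \<nu> m)"
      by (rule eventually_conj)
    then obtain m where m: "nE d (q (s m)) (w (s m) /\<^sub>R \<nu> m) < nF d (q (s m)) (w (s m) /\<^sub>R \<nu> m)"
        "nD (s m) (v (s m) /\<^sub>R \<nu> m) < 2 * nF d (q (s m)) (w (s m) /\<^sub>R \<nu> m)"
      unfolding eventually_sequentially by blast
    have "q (s m) \<in> chart_dom d" using M[OF s(2)[of m]] by simp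
    then have "nE d (q (s m)) (w (s m)) \<le> nF d (q (s m)) (w (s m))" "nD (s m) (v (s m)) \<le> 2 * nF d (q (s m)) (w (s m))"
      using m \<nu>[of m] nE_scale[OF q(2) d(1), of "s m"] nF_scale[OF q(2) d(1), of "s m"] nD_scale[OF s(2), of m]
      by (simp_all add: field_simps)
    then show ?thesis by blast
  qed
  then show ?thesis unfolding v_def w_def nD_def .
qed

end


subsection \<open>Uniform estimates and adapted coordinates\<close>

text \<open>Finitely many complements together with \<open>W\<close> cover \<open>U 0\<close>; the
  smallest of the corresponding sets lies in \<open>W\<close>.\<close>

lemma nested_compact_subset_open:
  fixes U :: "nat \<Rightarrow> 'm::metric_space set"
  assumes U: "\<And>i. compact (U i)" "\<And>i. U (Suc i) \<subseteq> U i" and W: "open W" "(\<Inter>i. U i) \<subseteq> W"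
  shows "\<exists>i. U i \<subseteq> W"
proof -
  have anti: "U n \<subseteq> U m" if "m \<le> n" for m n by (rule lift_Suc_antimono_le[of U, OF U(2) that])
  have op: "open (- U i \<union> W)" for i using U(1) W(1) by (simp add: compact_imp_closed open_Compl open_Un)
  obtain C where C: "finite C" "U 0 \<subseteq> (\<Union>i\<in>C. - U i \<union> W)"
  proof (rule compactE_image[OF U(1), of UNIV "\<lambda>i. - U i \<union> W" 0])
    show "U 0 \<subseteq> (\<Union>i\<in>UNIV. - U i \<union> W)" using W(2) by blast
    show "open (- U i \<union> W)" for i by (rule op)
  qed (rule that; assumption)
  define n where "n = Max (insert 0 C)"
  have "i \<le> n" if "i \<in> C" for i using C(1) that by (simp add: n_def)
  then have "U 0 \<subseteq> - U n \<union> W" using C(2) anti by blast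
  then show ?thesis using anti[of 0 n] by blast
qed

context C1_flow
begin

text \<open>Finitely many charts, so that along a subsequence one chart is used throughout. The last
  property ensures that this chart also contains the limit.\<close>

lemma chart_selection:
  "\<exists>b :: 'm \<Rightarrow> 'm. \<exists>\<delta>>0. finite (range b) \<and> (\<forall>p. ball p \<delta> \<subseteq> chart_dom (chart_at A (b p))) \<and>
    (\<forall>b0 p x. p \<longlonglongrightarrow> x \<longrightarrow> (\<forall>m::nat. b (p m) = b0) \<longrightarrow> x \<in> chart_dom (chart_at A b0))"
proof -
  have "\<forall>x. \<exists>e>0. cball x e \<subseteq> chart_dom (chart_at A x)"
    using chart(1) chart_at open_contains_cball by blast
  from choice[OF this] obtain e where e: "\<And>x. e x > 0" "\<And>x. cball x (e x) \<subseteq> chart_dom (chart_at A x)" by blast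
  \<comment> \<open>Half radii leave room both for a uniform ball around \<open>p\<close> and for
    limits of the points assigned to one centre.\<close>
  obtain Z where Z: "finite Z" "UNIV \<subseteq> (\<Union>x\<in>Z. ball x (e x / 2))"
  proof (rule compactE_image[OF compact_UNIV, of UNIV "\<lambda>x. ball x (e x / 2)"])
    have "x \<in> ball x (e x / 2)" for x using e(1)[of x] by simp
    then show "UNIV \<subseteq> (\<Union>x\<in>UNIV. ball x (e x / 2))" by blast
    show "open (ball x (e x / 2))" for x by simp
  qed (rule that; assumption)
  have "Z \<noteq> {}" using Z(2) by auto
  have "\<forall>p. \<exists>x. x \<in> Z \<and> p \<in> ball x (e x / 2)" using Z(2) by blast
  from choice[OF this] obtain b where b: "\<And>p. b p \<in> Z" "\<And>p. p \<in> ball (b p) (e (b p) / 2)" by blast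
  define \<delta> where "\<delta> = Min ((\<lambda>x. e x / 2) ` Z)"
  have \<delta>: "\<delta> > 0" "\<And>x. x \<in> Z \<Longrightarrow> \<delta> \<le> e x / 2"
  proof -
    show "\<delta> > 0" unfolding \<delta>_def using Z(1) \<open>Z \<noteq> {}\<close> e(1) by simp
    show "\<delta> \<le> e x / 2" if "x \<in> Z" for x unfolding \<delta>_def by (rule Min_le) (use Z(1) that in auto)
  qed
  show ?thesis
  proof (intro exI[of _ b] exI[of _ \<delta>] conjI allI impI)
    show "finite (range b)" by (rule finite_subset[OF _ Z(1)]) (use b(1) in blast)
    fix p
    show "ball p \<delta> \<subseteq> chart_dom (chart_at A (b p))"
    proof
      fix y assume "y \<in> ball p \<delta>"
      then have "dist (b p) y \<le> e (b p)" using b(2)[of p] \<delta>(2)[OF b(1), of p] dist_triangle[of "b p" y p] by simp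
      then show "y \<in> chart_dom (chart_at A (b p))" using e(2)[of "b p"] by auto
    qed
  next
    fix b0 x and p :: "nat \<Rightarrow> 'm" assume p: "p \<longlonglongrightarrow> x" "\<forall>m. b (p m) = b0"
    have "x \<in> cball b0 (e b0 / 2)"
    proof (rule closed_sequentially[OF closed_cball _ p(1)])
      show "p m \<in> cball b0 (e b0 / 2)" for m using b(2)[of "p m"] p(2) by simp
    qed
    then have "x \<in> cball b0 (e b0)" using e(1)[of b0] by simp
    then show "x \<in> chart_dom (chart_at A b0)" using e(2) by blast
  qed (rule \<delta>)
qed

end

lemma tendsto_if_close:
  fixes a a' :: "nat \<Rightarrow> 'm::metric_space"
  assumes "a' \<longlonglongrightarrow> l" "\<epsilon> \<longlonglongrightarrow> 0" "\<And>m. dist (a m) (a' m) < \<epsilon> m"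
  shows "a \<longlonglongrightarrow> l"
proof -
  have "(\<lambda>m. \<epsilon> m + dist (a' m) l) \<longlonglongrightarrow> 0 + 0"
    by (rule tendsto_add[OF assms(2) tendsto_dist_iff[THEN iffD1, OF assms(1)]])
  then have lim: "(\<lambda>m. \<epsilon> m + dist (a' m) l) \<longlonglongrightarrow> 0" by simp
  have "dist (a m) l \<le> \<epsilon> m + dist (a' m) l" for m
    using dist_triangle[of "a m" l "a' m"] assms(3)[of m] by linarith
  then have "(\<lambda>m. dist (a m) l) \<longlonglongrightarrow> 0"
    by (intro tendsto_sandwich[OF _ _ tendsto_const lim] always_eventually allI zero_le_dist)
  then show ?thesis by (rule tendsto_dist_iff[THEN iffD2])
qed

lemma subsequence_with_constant_label:
  fixes p :: "nat \<Rightarrow> 'm::metric_space"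
  assumes "compact K" "\<And>m. p m \<in> K" "finite (range b)"
  shows "\<exists>s x b0. strict_mono (s :: nat \<Rightarrow> nat) \<and> x \<in> K \<and> (\<lambda>m. p (s m)) \<longlonglongrightarrow> x \<and> (\<forall>m. b (s m) = b0)"
proof -
  have "\<exists>n0\<in>UNIV. infinite {n \<in> UNIV. b n = b n0}" by (rule pigeonhole_infinite) (use assms(3) in auto)
  then obtain n0 where "infinite {n. b n = b n0}" by auto
  from infinite_enumerate[OF this] obtain r :: "nat \<Rightarrow> nat" where r: "strict_mono r" "\<And>n. b (r n) = b n0" by blast
  have "\<forall>m. (p \<circ> r) m \<in> K" using assms(2) by simp
  then obtain x t where x: "x \<in> K" "strict_mono t" "((p \<circ> r) \<circ> t) \<longlonglongrightarrow> x"
    using assms(1)[unfolded compact_def, rule_format, of "p \<circ> r"] by blast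
  show ?thesis
    using x r strict_mono_o[OF r(1) x(2)]
    by (intro exI[of _ "r \<circ> t"] exI[of _ x] exI[of _ "b n0"]) (simp add: o_def)
qed

context splitting
begin

text \<open>Compactness makes the pair estimate uniform. Counterexamples for radii tending to 0
  subconverge to one point \<open>x\<close> of \<Lambda>, with \<open>q\<close> tending to
  \<open>\<phi> t x\<close>, and after fixing the two charts they contradict
  \<open>pair_sequences\<close>.\<close>

lemma pair_estimate:
  fixes b :: "'m \<Rightarrow> 'm"
  assumes dom: "dominates_at t" and t: "t \<ge> 0" and fb: "finite (range b)"
    and b: "\<forall>b0 p x. p \<longlonglongrightarrow> x \<longrightarrow> (\<forall>m::nat. b (p m) = b0) \<longrightarrow> x \<in> chart_dom (chart_at A b0)"
  shows "\<exists>\<delta>>0. \<forall>p q y z. p \<in> \<Lambda> \<longrightarrow> q \<in> \<Lambda> \<longrightarrow> y \<in> ball p \<delta> \<longrightarrow> z \<in> ball p \<delta> \<longrightarrow> \<phi> t y \<in> ball q \<delta> \<longrightarrow> \<phi> t z \<in> ball q \<delta> \<longrightarrow>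
    (let c = chart_at A (b p); d = chart_at A (b q); v = coord c y - coord c z; w = coord d (\<phi> t y) - coord d (\<phi> t z) in
      nE c p v \<le> nF c p v \<longrightarrow> dim (F q) = dim (F p) \<and> nE d q w \<le> nF d q w \<and>
        gnorm g (\<phi> t p) (mderiv A (\<phi> t) p (projF p (from_chart c p v))) \<le> 2 * nF d q w)"
    (is "\<exists>\<delta>>0. ?good \<delta>")
proof (rule ccontr)
  define c where "c p = chart_at A (b p)" for p
  define v where "v p y z = coord (c p) y - coord (c p) z" for p y z
  define B where "B \<delta> p q y z \<longleftrightarrow> p \<in> \<Lambda> \<and> q \<in> \<Lambda> \<and> y \<in> ball p \<delta> \<and> z \<in> ball p \<delta> \<and> \<phi> t y \<in> ball q \<delta> \<and> \<phi> t z \<in> ball q \<delta> \<and>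
    nE (c p) p (v p y z) \<le> nF (c p) p (v p y z) \<and>
    \<not> (dim (F q) = dim (F p) \<and> nE (c q) q (v q (\<phi> t y) (\<phi> t z)) \<le> nF (c q) q (v q (\<phi> t y) (\<phi> t z)) \<and>
        gnorm g (\<phi> t p) (mderiv A (\<phi> t) p (projF p (from_chart (c p) p (v p y z)))) \<le> 2 * nF (c q) q (v q (\<phi> t y) (\<phi> t z)))" for \<delta> p q y z
  assume "\<not> ?thesis"
  then have "\<exists>p q y z. B \<delta> p q y z" if "\<delta> > 0" for \<delta>
    using that unfolding B_def c_def v_def Let_def by blast
  then have "\<forall>n. \<exists>T. B (inverse (real (Suc n))) (fst T) (fst (snd T)) (fst (snd (snd T))) (snd (snd (snd T)))"
    by (metis fst_conv snd_conv inverse_positive_iff_positive of_nat_0_less_iff zero_less_Suc)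
  from choice[OF this] obtain T where T: "\<forall>n. B (inverse (real (Suc n))) (fst (T n)) (fst (snd (T n))) (fst (snd (snd (T n)))) (snd (snd (snd (T n))))" ..
  define p0 where "p0 n = fst (T n)" for n
  define q0 where "q0 n = fst (snd (T n))" for n
  define y0 where "y0 n = fst (snd (snd (T n)))" for n
  define z0 where "z0 n = snd (snd (snd (T n)))" for n
  have B0: "B (inverse (real (Suc n))) (p0 n) (q0 n) (y0 n) (z0 n)" for n
    using T unfolding p0_def q0_def y0_def z0_def by blast
  have p0\<Lambda>: "p0 n \<in> \<Lambda>" and q0\<Lambda>: "q0 n \<in> \<Lambda>" for n using B0[of n] by (simp_all add: B_def)
  \<comment> \<open>The label is a pair because the charts at the source and at the target must both
    become constant.\<close>
  have "finite (range (\<lambda>n. (b (p0 n), b (q0 n))))"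
    by (rule finite_subset[OF _ finite_cartesian_product[OF fb fb]]) auto
  from subsequence_with_constant_label[where p=p0, OF compact_\<Lambda> p0\<Lambda> this]
  obtain s x b0 where s: "strict_mono (s :: nat \<Rightarrow> nat)" "x \<in> \<Lambda>" "(\<lambda>m. p0 (s m)) \<longlonglongrightarrow> x" "\<forall>m. (b (p0 (s m)), b (q0 (s m))) = b0"
    by blast
  define p where "p m = p0 (s m)" for m
  define q where "q m = q0 (s m)" for m
  define y where "y m = y0 (s m)" for m
  define z where "z m = z0 (s m)" for m
  define \<epsilon> where "\<epsilon> m = inverse (real (Suc (s m)))" for m
  have B1: "B (\<epsilon> m) (p m) (q m) (y m) (z m)" for m unfolding p_def q_def y_def z_def \<epsilon>_def by (rule B0)
  have \<epsilon>: "\<epsilon> \<longlonglongrightarrow> 0" unfolding \<epsilon>_def using LIMSEQ_subseq_LIMSEQ[OF LIMSEQ_inverse_real_of_nat s(1)] by (simp add: o_def)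
  have px: "p \<longlonglongrightarrow> x" using s(3) by (simp add: p_def[abs_def])
  have pL: "p m \<in> \<Lambda>" and qL: "q m \<in> \<Lambda>" for m using B1[of m] by (simp_all add: B_def)
  have yx: "y \<longlonglongrightarrow> x" by (rule tendsto_if_close[OF px \<epsilon>]) (use B1 in \<open>simp add: B_def dist_commute\<close>)
  have zx: "z \<longlonglongrightarrow> x" by (rule tendsto_if_close[OF px \<epsilon>]) (use B1 in \<open>simp add: B_def dist_commute\<close>)
  have fyx: "(\<lambda>m. \<phi> t (y m)) \<longlonglongrightarrow> \<phi> t x" by (rule isCont_tendsto_compose[OF flow_cont[OF t] yx])
  have qx: "q \<longlonglongrightarrow> \<phi> t x" by (rule tendsto_if_close[OF fyx \<epsilon>]) (use B1 in \<open>simp add: B_def\<close>)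
  have bp: "b (p m) = fst b0" and bq: "b (q m) = snd b0" for m using s(4)[rule_format, of m, symmetric] by (simp_all add: p_def q_def)
  define C where "C = chart_at A (fst b0)"
  define D where "D = chart_at A (snd b0)"
  have C: "C \<in> A" "x \<in> chart_dom C" unfolding C_def using chart_at(1) b[rule_format, OF px bp] by blast+
  have D: "D \<in> A" "\<phi> t x \<in> chart_dom D" unfolding D_def using chart_at(1) b[rule_format, OF qx bq] by blast+
  have cp: "c (p m) = C" and cq: "c (q m) = D" for m by (simp_all add: c_def bp bq C_def D_def)
  have vp: "v (p m) y' z' = coord C y' - coord C z'" and vq: "v (q m) y' z' = coord D y' - coord D z'" for m y' z'
    by (simp_all add: v_def cp cq)
  note B2 = B1[unfolded B_def cp cq vp vq]
  have "\<forall>\<^sub>F m in sequentially. dim (F (p m)) = dim (F x)" "\<forall>\<^sub>F m in sequentially. dim (F (q m)) = dim (F (\<phi> t x))"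
  proof -
    obtain U where U: "open U" "x \<in> U" "\<forall>y\<in>\<Lambda> \<inter> U. dim (F y) = dim (F x)" using dim_F_eventually[OF s(2)] by blast
    show "\<forall>\<^sub>F m in sequentially. dim (F (p m)) = dim (F x)"
      using tendsto_in_open[OF px U(1,2)] by eventually_elim (use U(3) pL in blast)
    obtain U where U: "open U" "\<phi> t x \<in> U" "\<forall>y\<in>\<Lambda> \<inter> U. dim (F y) = dim (F (\<phi> t x))"
      using dim_F_eventually[OF flow_in[OF s(2)]] by blast
    show "\<forall>\<^sub>F m in sequentially. dim (F (q m)) = dim (F (\<phi> t x))"
      using tendsto_in_open[OF qx U(1,2)] by eventually_elim (use U(3) qL in blast)
  qed
  then have "\<forall>\<^sub>F m in sequentially. dim (F (q m)) = dim (F (p m))"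
    by eventually_elim (simp add: dim_F_flow[OF s(2)])
  \<comment> \<open>The dimension condition is settled first and the early terms are discarded. What
    can then fail is the cone condition or the expansion estimate.\<close>
  then obtain M where M: "\<And>m. m \<ge> M \<Longrightarrow> dim (F (q m)) = dim (F (p m))"
    unfolding eventually_sequentially by blast
  have "\<exists>m. nE D (q (m + M)) (coord D (\<phi> t (y (m + M))) - coord D (\<phi> t (z (m + M)))) \<le> nF D (q (m + M)) (coord D (\<phi> t (y (m + M))) - coord D (\<phi> t (z (m + M)))) \<and>
    gnorm g (\<phi> t (p (m + M))) (mderiv A (\<phi> t) (p (m + M)) (projF (p (m + M)) (from_chart C (p (m + M)) (coord C (y (m + M)) - coord C (z (m + M))))))
      \<le> 2 * nF D (q (m + M)) (coord D (\<phi> t (y (m + M))) - coord D (\<phi> t (z (m + M))))"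
    by (rule pair_sequences[OF dom t s(2) C D LIMSEQ_ignore_initial_segment[OF px] pL LIMSEQ_ignore_initial_segment[OF qx] qL
        LIMSEQ_ignore_initial_segment[OF yx] LIMSEQ_ignore_initial_segment[OF zx]]) (use B2 in blast)
  then show False using B2 M[OF le_add2] by blast
qed

text \<open>The scheme of \<open>pair_estimate\<close> again: the coordinate differences of a
  sequence of counterexamples would tend to 0.\<close>

lemma coordinate_bound:
  fixes b :: "'m \<Rightarrow> 'm"
  assumes fb: "finite (range b)"
    and b: "\<forall>b0 p x. p \<longlonglongrightarrow> x \<longrightarrow> (\<forall>m::nat. b (p m) = b0) \<longrightarrow> x \<in> chart_dom (chart_at A b0)"
  shows "\<exists>\<delta>>0. \<forall>p y z. p \<in> \<Lambda> \<longrightarrow> y \<in> ball p \<delta> \<longrightarrow> z \<in> ball p \<delta> \<longrightarrow>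
    nF (chart_at A (b p)) p (coord (chart_at A (b p)) y - coord (chart_at A (b p)) z) \<le> 1"
proof (rule ccontr)
  define B where "B \<delta> p y z \<longleftrightarrow> p \<in> \<Lambda> \<and> y \<in> ball p \<delta> \<and> z \<in> ball p \<delta> \<and>
    \<not> nF (chart_at A (b p)) p (coord (chart_at A (b p)) y - coord (chart_at A (b p)) z) \<le> 1" for \<delta> p y z
  assume "\<not> ?thesis"
  then have "\<exists>p y z. B \<delta> p y z" if "\<delta> > 0" for \<delta>
    using that unfolding B_def by blast
  then have "\<forall>n. \<exists>T. B (inverse (real (Suc n))) (fst T) (fst (snd T)) (snd (snd T))"
    by (metis fst_conv snd_conv inverse_positive_iff_positive of_nat_0_less_iff zero_less_Suc)
  from choice[OF this] obtain T where T: "\<forall>n. B (inverse (real (Suc n))) (fst (T n)) (fst (snd (T n))) (snd (snd (T n)))" ..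
  define p0 where "p0 n = fst (T n)" for n
  have p0\<Lambda>: "p0 n \<in> \<Lambda>" for n using T by (simp add: B_def p0_def)
  have "finite (range (\<lambda>n. b (p0 n)))" by (rule finite_subset[OF _ fb]) auto
  from subsequence_with_constant_label[where p=p0, OF compact_\<Lambda> p0\<Lambda> this]
  obtain s x b0 where s: "strict_mono (s :: nat \<Rightarrow> nat)" "x \<in> \<Lambda>" "(\<lambda>m. p0 (s m)) \<longlonglongrightarrow> x" "\<forall>m. b (p0 (s m)) = b0"
    by blast
  define p where "p m = p0 (s m)" for m
  define y where "y m = fst (snd (T (s m)))" for m
  define z where "z m = snd (snd (T (s m)))" for m
  define \<epsilon> where "\<epsilon> m = inverse (real (Suc (s m)))" for m
  have B1: "B (\<epsilon> m) (p m) (y m) (z m)" for m using T unfolding p_def p0_def y_def z_def \<epsilon>_def by blast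
  have \<epsilon>: "\<epsilon> \<longlonglongrightarrow> 0" unfolding \<epsilon>_def using LIMSEQ_subseq_LIMSEQ[OF LIMSEQ_inverse_real_of_nat s(1)] by (simp add: o_def)
  have px: "p \<longlonglongrightarrow> x" using s(3) by (simp add: p_def[abs_def])
  have pL: "p m \<in> \<Lambda>" for m using B1[of m] by (simp add: B_def)
  have yx: "y \<longlonglongrightarrow> x" by (rule tendsto_if_close[OF px \<epsilon>]) (use B1 in \<open>simp add: B_def dist_commute\<close>)
  have zx: "z \<longlonglongrightarrow> x" by (rule tendsto_if_close[OF px \<epsilon>]) (use B1 in \<open>simp add: B_def dist_commute\<close>)
  have bp: "b (p m) = b0" for m using s(4) by (simp add: p_def)
  define C where "C = chart_at A b0"
  have C: "C \<in> A" "x \<in> chart_dom C" unfolding C_def using chart_at(1) b[rule_format, OF px bp] by blast+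
  have "(\<lambda>m. coord C (y m) - coord C (z m)) \<longlonglongrightarrow> 0"
    using tendsto_diff[OF coord_tendsto[OF C yx] coord_tendsto[OF C zx]] by simp
  from nF_tendsto[OF s(2) C px pL this] have "(\<lambda>m. nF C (p m) (coord C (y m) - coord C (z m))) \<longlonglongrightarrow> nF C x 0" .
  moreover have "nF C x 0 = 0" using nF_scale[OF s(2) C, of 0 0] by simp
  ultimately have "\<forall>\<^sub>F m in sequentially. nF C (p m) (coord C (y m) - coord C (z m)) < 1"
    using order_tendstoD(2)[of _ "nF C x 0" _ 1] by simp
  then obtain m where "nF C (p m) (coord C (y m) - coord C (z m)) < 1" unfolding eventually_sequentially by blast
  then show False using B1[of m] by (simp add: B_def bp C_def)
qed

end

text \<open>The enumeration \<open>h\<close> places the coordinates among the components of a possibly longer vector: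
  the library computes the measure of a linear image only for well-ordered index types, so
  \<open>'n bit0\<close> will replace \<open>'n\<close>.\<close>

definition basis_coord :: "('a \<Rightarrow> 'a \<Rightarrow> real) \<Rightarrow> (nat \<Rightarrow> 'a) \<Rightarrow> ('k::finite \<Rightarrow> nat) \<Rightarrow> nat \<Rightarrow> 'a \<Rightarrow> real^'k" where
  "basis_coord ip e h d u = (\<chi> j. if h j < d then ip (e (h j)) u else 0)"

text \<open>The identity on the surplus components leaves the determinant equal to that of the
  \<open>d\<close>-dimensional block and lets the matrix fix the slab directions of
  \<open>measure_thicken_expand\<close>.\<close>

definition basis_matrix ::
    "('b \<Rightarrow> 'b \<Rightarrow> real) \<Rightarrow> (nat \<Rightarrow> 'b) \<Rightarrow> (nat \<Rightarrow> 'a) \<Rightarrow> ('k::finite \<Rightarrow> nat) \<Rightarrow> nat \<Rightarrow> ('a \<Rightarrow> 'b) \<Rightarrow> real^'k^'k" where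
  "basis_matrix ip' f e h d L =
    (\<chi> i j. if h i < d \<and> h j < d then ip' (f (h i)) (L (e (h j))) else if i = j then 1 else 0)"

section \<open>Fibres in orthonormal coordinates\<close>

lemma sum_enumeration:
  fixes h :: "'k::finite \<Rightarrow> nat" and \<psi> :: "nat \<Rightarrow> real"
  assumes h: "bij_betw h UNIV {0..<n}" and d: "d \<le> n"
  shows "(\<Sum>j\<in>UNIV. if h j < d then \<psi> (h j) else 0) = (\<Sum>i<d. \<psi> i)"
proof -
  have "(\<Sum>j\<in>UNIV. if h j < d then \<psi> (h j) else 0) = (\<Sum>i\<in>{0..<n}. if i < d then \<psi> i else 0)"
    by (rule sum.reindex_bij_betw[OF h, of "\<lambda>i. if i < d then \<psi> i else 0"])
  also have "\<dots> = (\<Sum>i<d. \<psi> i)"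
    by (rule sum.mono_neutral_cong_right) (use d in auto)
  finally show ?thesis .
qed

context
  fixes ip :: "'a::euclidean_space \<Rightarrow> 'a \<Rightarrow> real" and e :: "nat \<Rightarrow> 'a" and d n :: nat and V :: "'a set" and h :: "'k::finite \<Rightarrow> nat"
  assumes ip: "inner_product ip" and e: "orthonormal_basis ip d e V" and h: "bij_betw h UNIV {0..<n}" and d: "d \<le> n"
begin

lemma basis_coord_linear: "linear (basis_coord ip e h d :: 'a \<Rightarrow> real^'k)"
  unfolding basis_coord_def by (rule linearI) (auto simp: vec_eq_iff ip_simps[OF ip])

text \<open>Parseval makes the coordinates isometric on \<open>V\<close>, so metric estimates in the
  fibres become Euclidean estimates.\<close>

lemma norm_basis_coord:
  assumes "u \<in> V"
  shows "norm (basis_coord ip e h d u :: real^'k) = sqrt (ip u u)"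
proof -
  have "(norm (basis_coord ip e h d u :: real^'k))\<^sup>2 = (\<Sum>j\<in>UNIV. if h j < d then ip (e (h j)) u * ip (e (h j)) u else 0)"
    unfolding power2_norm_eq_inner inner_vec_def basis_coord_def by (intro sum.cong) auto
  also have "\<dots> = (\<Sum>i<d. ip (e i) u * ip (e i) u)" by (rule sum_enumeration[OF h d])
  also have "\<dots> = ip u u" using orthonormal_parseval[OF ip e assms] by simp
  finally show ?thesis by (metis norm_ge_zero real_sqrt_unique)
qed

lemma basis_coord_surj:
  assumes b: "\<And>j. \<not> h j < d \<Longrightarrow> b $ j = 0"
  shows "basis_coord ip e h d (\<Sum>j\<in>UNIV. (b $ j) *\<^sub>R (if h j < d then e (h j) else 0)) = (b :: real^'k)"
proof -
  have "basis_coord ip e h d (\<Sum>j\<in>UNIV. (b $ j) *\<^sub>R (if h j < d then e (h j) else 0)) $ i = b $ i" for i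
  proof (cases "h i < d")
    case True
    have inj: "h i = h j \<longleftrightarrow> i = j" for j using h by (auto simp: bij_betw_def inj_on_def)
    have "ip (e (h i)) ((b $ j) *\<^sub>R (if h j < d then e (h j) else 0)) = (if i = j then b $ j else 0)" for j
      using True e inj[of j] by (auto simp: orthonormal_basis_def ip_simps[OF ip])
    then show ?thesis using True by (simp add: basis_coord_def ip_simps(9)[OF ip])
  qed (simp add: basis_coord_def b)
  then show ?thesis by (simp add: vec_eq_iff)
qed

lemma basis_coord_span:
  assumes "\<And>j. \<not> h j < d \<Longrightarrow> b $ j = 0"
  shows "(\<Sum>j\<in>UNIV. ((b :: real^'k) $ j) *\<^sub>R (if h j < d then e (h j) else 0)) \<in> V"
proof -
  have sV: "subspace V" using e unfolding orthonormal_basis_def by (metis subspace_span)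
  show ?thesis
    by (intro subspace_sum[OF sV] subspace_scale[OF sV]) (use orthonormal_in[OF e] subspace_0[OF sV] in auto)
qed

lemma basis_matrix_mult:
  fixes L :: "'a \<Rightarrow> 'b::euclidean_space"
  assumes ip': "inner_product ip'" and L: "linear L" and u: "u \<in> V"
  shows "(basis_matrix ip' f e h d L :: real^'k^'k) *v basis_coord ip e h d u = basis_coord ip' f h d (L u)"
proof -
  have "((basis_matrix ip' f e h d L :: real^'k^'k) *v basis_coord ip e h d u) $ i = basis_coord ip' f h d (L u) $ i" for i
  proof (cases "h i < d")
    case True
    have "L u = (\<Sum>j<d. ip (e j) u *\<^sub>R L (e j))"
      by (subst orthonormal_expansion[OF ip e u]) (simp add: linear_sum[OF L] linear_cmul[OF L])
    then have "ip' (f (h i)) (L u) = (\<Sum>j<d. ip' (f (h i)) (L (e j)) * ip (e j) u)"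
      by (simp add: ip_simps[OF ip'] mult.commute)
    also have "\<dots> = (\<Sum>j\<in>UNIV. if h j < d then ip' (f (h i)) (L (e (h j))) * ip (e (h j)) u else 0)"
      by (rule sum_enumeration[OF h d, symmetric])
    also have "\<dots> = ((basis_matrix ip' f e h d L :: real^'k^'k) *v basis_coord ip e h d u) $ i"
      unfolding matrix_vector_mult_def basis_matrix_def basis_coord_def using True by (auto intro!: sum.cong)
    finally show ?thesis using True by (simp add: basis_coord_def)
  next
    case False
    then show ?thesis unfolding matrix_vector_mult_def basis_matrix_def basis_coord_def
      by (auto intro!: sum.neutral)
  qed
  then show ?thesis by (simp add: vec_eq_iff)
qed

lemma det_basis_matrix:
  fixes L :: "'a \<Rightarrow> 'b::euclidean_space"
  assumes ip': "inner_product ip'" and L: "linear L" and f: "orthonormal_basis ip' d f (L ` V)"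
  shows "\<bar>det (basis_matrix ip' f e h d L :: real^'k^'k)\<bar> = abs_det_on ip ip' L V"
  unfolding basis_matrix_def
    det_block_identity_eq_JNF[OF h d, of "\<lambda>i j. ip' (f i) (L (e j))"] abs_det_on_eq[OF ip ip' L e f] ..

end

lemma basis_matrix_block:
  fixes b :: "real^'k::finite" and h :: "'k \<Rightarrow> nat"
  shows "(\<And>i. \<not> h i < d \<Longrightarrow> b $ i = 0) \<Longrightarrow> \<not> h j < d \<Longrightarrow> (basis_matrix ip' f e h d L *v b) $ j = 0"
    and "(\<And>i. h i < d \<Longrightarrow> b $ i = 0) \<Longrightarrow> basis_matrix ip' f e h d L *v b = b"
proof -
  assume b: "\<And>i. \<not> h i < d \<Longrightarrow> b $ i = 0" and j: "\<not> h j < d"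
  show "(basis_matrix ip' f e h d L *v b) $ j = 0"
    unfolding matrix_vector_mult_def basis_matrix_def using b j by (auto intro!: sum.neutral)
next
  assume b: "\<And>i. h i < d \<Longrightarrow> b $ i = 0"
  have "(basis_matrix ip' f e h d L *v b) $ j = b $ j" for j
  proof -
    have "(if h j < d \<and> h i < d then ip' (f (h j)) (L (e (h i))) else if j = i then 1 else 0) * b $ i = (if i = j then b $ i else 0)" for i
      using b[of i] by (cases "h i < d") auto
    then have "(basis_matrix ip' f e h d L *v b) $ j = (\<Sum>i\<in>UNIV. if i = j then b $ i else 0)"
      unfolding matrix_vector_mult_def basis_matrix_def by simp
    then show ?thesis by simp
  qed
  then show "basis_matrix ip' f e h d L *v b = b" by (simp add: vec_eq_iff)
qed


subsection \<open>The entropy estimate\<close>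

context splitting
begin

lemma flow_funpow: "(\<phi> s ^^ i) x = \<phi> (real i * s) x"
proof (induction i)
  case (Suc i)
  then show ?case using flow_add[of s "real i * s" x] by (simp add: algebra_simps)
qed (simp add: flow_0)

text \<open>The geometric data are shown to form an instance of \<open>cone_expansion\<close> for
  the time map at \<open>N\<close>, with coordinates given by projection to the fibre followed by an
  orthonormal basis.\<close>

lemma entropy_estimate:
  assumes N: "N > 0" and dom: "dominates_at (real N)" and stable: "lyapunov_stable \<phi> \<Lambda>"
    and x0: "x0 \<in> \<Lambda>" "dim (F x0) \<ge> 2" and a: "a > 0"
    and expand: "\<And>x V. x \<in> \<Lambda> \<Longrightarrow> subspace V \<Longrightarrow> V \<subseteq> F x \<Longrightarrow> dim V \<ge> 2 \<Longrightarrow>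
      abs_det_on (g x) (g (\<phi> (real N) x)) (mderiv A (\<phi> (real N)) x) V \<ge> a"
  shows "topological_entropy (\<phi> 1) \<Lambda> \<ge> ereal (ln (a / 4 ^ (2 * CARD('n))) / real N)"
proof -
  define t where "t = real N"
  have t: "t \<ge> 0" by (simp add: t_def)
  define f where "f = \<phi> t"
  define d where "d = dim (F x0)"
  \<comment> \<open>The fibre dimension is only locally constant. Itineraries starting at
    \<open>x0\<close> remain among points of dimension \<open>d\<close> by
    \<open>pair_estimate\<close>.\<close>
  define \<Lambda>d where "\<Lambda>d = {p \<in> \<Lambda>. dim (F p) = d}"
  have sub: "\<Lambda>d \<subseteq> \<Lambda>" by (auto simp: \<Lambda>d_def)
  \<comment> \<open>\<open>'n bit0\<close> has twice as many elements as \<open>'n\<close>, which is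
    the origin of \<open>2 * CARD('n)\<close> in the exponent.\<close>
  obtain h :: "'n bit0 \<Rightarrow> nat" where h: "bij_betw h UNIV {0..<CARD('n bit0)}"
    using ex_bij_betw_finite_nat[of "UNIV :: 'n bit0 set"] by auto
  have d: "d \<le> CARD('n bit0)" using dim_subset_UNIV[of "F x0"] by (simp add: d_def)
  define I where "I = {j. h j < d}"
  obtain b \<delta>1 where fb: "finite (range b)" and \<delta>1: "\<delta>1 > 0" "\<And>p. ball p \<delta>1 \<subseteq> chart_dom (chart_at A (b p))"
    and b: "\<forall>b0 p x. p \<longlonglongrightarrow> x \<longrightarrow> (\<forall>m::nat. b (p m) = b0) \<longrightarrow> x \<in> chart_dom (chart_at A b0)"
    using chart_selection by blast
  define \<kappa> where "\<kappa> p = chart_at A (b p)" for p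
  have \<kappa>: "\<kappa> p \<in> A" "p \<in> chart_dom (\<kappa> p)" for p
    unfolding \<kappa>_def using chart_at(1) \<delta>1 by (auto simp: subset_iff)
  define cone where "cone p y z \<longleftrightarrow> nE (\<kappa> p) p (coord (\<kappa> p) y - coord (\<kappa> p) z) \<le> nF (\<kappa> p) p (coord (\<kappa> p) y - coord (\<kappa> p) z)" for p y z
  obtain \<delta>2 where \<delta>2: "\<delta>2 > 0" and est: "\<And>p q y z. p \<in> \<Lambda> \<Longrightarrow> q \<in> \<Lambda> \<Longrightarrow> y \<in> ball p \<delta>2 \<Longrightarrow> z \<in> ball p \<delta>2 \<Longrightarrow> f y \<in> ball q \<delta>2 \<Longrightarrow> f z \<in> ball q \<delta>2 \<Longrightarrow>
      cone p y z \<Longrightarrow> dim (F q) = dim (F p) \<and> cone q (f y) (f z) \<and>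
        gnorm g (f p) (mderiv A f p (projF p (from_chart (\<kappa> p) p (coord (\<kappa> p) y - coord (\<kappa> p) z)))) \<le> 2 * nF (\<kappa> q) q (coord (\<kappa> q) (f y) - coord (\<kappa> q) (f z))"
    using pair_estimate[OF dom[folded t_def] t fb b] unfolding Let_def \<kappa>_def[symmetric] cone_def[symmetric] f_def[symmetric] by blast
  obtain \<delta>3 where \<delta>3: "\<delta>3 > 0" and bdd: "\<And>p y z. p \<in> \<Lambda> \<Longrightarrow> y \<in> ball p \<delta>3 \<Longrightarrow> z \<in> ball p \<delta>3 \<Longrightarrow>
    nF (\<kappa> p) p (coord (\<kappa> p) y - coord (\<kappa> p) z) \<le> 1"
    using coordinate_bound[OF fb b] unfolding \<kappa>_def[symmetric] by blast
  \<comment> \<open>The three radii serve the chart domain, the pair estimate and the coordinate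
    bound.\<close>
  define \<delta> where "\<delta> = min \<delta>1 (min \<delta>2 \<delta>3)"
  have \<delta>: "\<delta> > 0" using \<delta>1(1) \<delta>2 \<delta>3 by (simp add: \<delta>_def)
  have ball\<delta>: "ball p \<delta> \<subseteq> ball p \<delta>1" "ball p \<delta> \<subseteq> ball p \<delta>2" "ball p \<delta> \<subseteq> ball p \<delta>3" for p
    by (auto simp: \<delta>_def)
  \<comment> \<open>The bases need not vary continuously with \<open>p\<close>: different centres
    are compared only through norms and absolute determinants.\<close>
  define e where "e p = (SOME e. orthonormal_basis (g p) (dim (F p)) e (F p))" for p
  have e: "orthonormal_basis (g p) d (e p) (F p)" if "p \<in> \<Lambda>d" for p
    using someI_ex[OF orthonormal_basis_exists[OF ip subspace_F]] that unfolding e_def \<Lambda>d_def by blast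
  have fd: "f p \<in> \<Lambda>d" if "p \<in> \<Lambda>d" for p
    using that flow_in dim_F_flow by (simp add: \<Lambda>d_def f_def)
  define P where "P p y = (basis_coord (g p) (e p) h d (projF p (from_chart (\<kappa> p) p (coord (\<kappa> p) y))) :: real^'n bit0)" for p y
  define M where "M p = (basis_matrix (g (f p)) (e (f p)) (e p) h d (mderiv A f p) :: real^'n bit0^'n bit0)" for p
  have linD: "linear (mderiv A f p)" for p unfolding f_def by (rule mderiv_linear[OF flow_mdifferentiable[OF t]])
  have linP: "linear (\<lambda>v. basis_coord (g p) (e p) h d (projF p (from_chart (\<kappa> p) p v)) :: real^'n bit0)" if "p \<in> \<Lambda>d" for p
  proof -
    have "linear (projF p)" using projF_linear sub that by blast
    from linear_compose[OF linear_compose[OF from_chart_linear[OF \<kappa>] this] basis_coord_linear[OF ip e[OF that] h d]]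
    show ?thesis by (simp add: o_def)
  qed
  have Pdiff: "P p y - P p z = basis_coord (g p) (e p) h d (projF p (from_chart (\<kappa> p) p (coord (\<kappa> p) y - coord (\<kappa> p) z)))" if "p \<in> \<Lambda>d" for p y z
    unfolding P_def by (rule linear_diff[OF linP[OF that], symmetric])
  have normP: "norm (P p y - P p z) = nF (\<kappa> p) p (coord (\<kappa> p) y - coord (\<kappa> p) z)" if p: "p \<in> \<Lambda>d" for p y z
    unfolding Pdiff[OF p] nF_def gnorm_def by (rule norm_basis_coord[OF ip e[OF p] h d]) (use projF_in p sub in blast)
  have MP: "norm (M p *v (P p y - P p z)) = gnorm g (f p) (mderiv A f p (projF p (from_chart (\<kappa> p) p (coord (\<kappa> p) y - coord (\<kappa> p) z))))"
    if p: "p \<in> \<Lambda>d" for p y z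
  proof -
    let ?u = "projF p (from_chart (\<kappa> p) p (coord (\<kappa> p) y - coord (\<kappa> p) z))"
    have u: "?u \<in> F p" using projF_in p sub by blast
    have "M p *v (P p y - P p z) = basis_coord (g (f p)) (e (f p)) h d (mderiv A f p ?u)"
      unfolding Pdiff[OF p] M_def by (rule basis_matrix_mult[OF ip e[OF p] h d ip linD u])
    moreover have "mderiv A f p ?u \<in> F (f p)" using mderiv_F[of p t] p sub u unfolding f_def by blast
    then have "norm (basis_coord (g (f p)) (e (f p)) h d (mderiv A f p ?u) :: real^'n bit0) = gnorm g (f p) (mderiv A f p ?u)"
      unfolding gnorm_def by (rule norm_basis_coord[OF ip e[OF fd[OF p]] h d])
    ultimately show ?thesis by simp
  qed
  have Pcont: "continuous_on (ball p \<delta>) (P p)" if p: "p \<in> \<Lambda>d" for p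
  proof -
    have "ball p \<delta> \<subseteq> chart_dom (\<kappa> p)" unfolding \<kappa>_def using \<delta>1(2) ball\<delta>(1) by (rule order_trans[rotated])
    then have 1: "continuous_on (ball p \<delta>) (coord (\<kappa> p))" by (rule continuous_on_subset[OF cont_coord[OF \<kappa>(1)]])
    have 2: "continuous_on UNIV (\<lambda>v. basis_coord (g p) (e p) h d (projF p (from_chart (\<kappa> p) p v)) :: real^'n bit0)"
      by (rule linear_continuous_on[OF linear_conv_bounded_linear[THEN iffD1, OF linP[OF p]]])
    show ?thesis unfolding P_def by (rule continuous_on_compose2[OF 2 1]) simp
  qed
  have ce: "cone_expansion f \<Lambda> \<Lambda>d \<delta> a P M cone I x0"
  proof
    show "isCont f x" for x unfolding f_def by (rule flow_cont[OF t])
    show "f ` \<Lambda> \<subseteq> \<Lambda>" unfolding f_def using flow_in by blast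
    show "\<Lambda>d \<subseteq> \<Lambda>" by (rule sub)
    show "x0 \<in> \<Lambda>d" using x0 by (simp add: \<Lambda>d_def d_def)
    show "\<delta> > 0" "a > 0" by (rule \<delta> a)+
  next
    fix U assume U: "open U" "\<Lambda> \<subseteq> U"
    obtain W where *: "(\<forall>i::nat. compact (W i) \<and> \<Lambda> \<subseteq> interior (W i) \<and> W (Suc i) \<subseteq> W i) \<and>
        (\<Inter>i. W i) = \<Lambda> \<and> (\<forall>i. \<forall>t\<ge>0. \<phi> t ` W (Suc i) \<subseteq> W i)"
      using stable unfolding lyapunov_stable_def by (elim exE) (rule that)
    have W: "\<And>i. compact (W i)" "\<And>i. \<Lambda> \<subseteq> interior (W i)" "\<And>i. W (Suc i) \<subseteq> W i"
      "(\<Inter>i. W i) = \<Lambda>" "\<And>i t. t \<ge> 0 \<Longrightarrow> \<phi> t ` W (Suc i) \<subseteq> W i"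
      using * by blast+
    \<comment> \<open>Points starting in \<open>W (Suc i)\<close> remain in \<open>W i\<close>, so
      the interior of \<open>W (Suc i)\<close> is the required neighbourhood.\<close>
    obtain i where i: "W i \<subseteq> U" using nested_compact_subset_open[of W U] W(1,3,4) U by auto
    show "\<exists>V. open V \<and> \<Lambda> \<subseteq> V \<and> (\<forall>x\<in>V. \<forall>i. (f ^^ i) x \<in> U)"
    proof (intro exI[of _ "interior (W (Suc i))"] conjI ballI allI)
      fix x k assume "x \<in> interior (W (Suc i))"
      then have "x \<in> W (Suc i)" using interior_subset by blast
      then have "\<phi> (real k * t) x \<in> W i" using W(5)[of "real k * t" i] t by auto
      then show "(f ^^ k) x \<in> U" using i unfolding f_def flow_funpow by blast
    qed (use W(2) in auto)
  next
    fix p q y z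
    assume p: "p \<in> \<Lambda>d" and q: "q \<in> \<Lambda>" and yz: "y \<in> ball p \<delta>" "z \<in> ball p \<delta>" "f y \<in> ball q \<delta>" "f z \<in> ball q \<delta>" and c: "cone p y z"
    have p': "p \<in> \<Lambda>" "dim (F p) = d" using p by (auto simp: \<Lambda>d_def)
    have yz2: "y \<in> ball p \<delta>2" "z \<in> ball p \<delta>2" "f y \<in> ball q \<delta>2" "f z \<in> ball q \<delta>2" using yz ball\<delta>(2) by blast+
    have E: "dim (F q) = dim (F p)" "cone q (f y) (f z)"
      "gnorm g (f p) (mderiv A f p (projF p (from_chart (\<kappa> p) p (coord (\<kappa> p) y - coord (\<kappa> p) z)))) \<le> 2 * nF (\<kappa> q) q (coord (\<kappa> q) (f y) - coord (\<kappa> q) (f z))"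
      using est[OF p'(1) q yz2 c] by simp_all
    have qd: "q \<in> \<Lambda>d" using q E(1) p' by (simp add: \<Lambda>d_def)
    show "q \<in> \<Lambda>d \<and> cone q (f y) (f z) \<and> norm (M p *v (P p y - P p z)) \<le> 2 * norm (P q (f y) - P q (f z))"
      unfolding MP[OF p] normP[OF qd] using qd E by blast
  next
    fix p assume p: "p \<in> \<Lambda>d"
    have p': "p \<in> \<Lambda>" "dim (F p) = d" using p by (auto simp: \<Lambda>d_def)
    have "orthonormal_basis (g (f p)) d (e (f p)) (mderiv A f p ` F p)"
      using e[OF fd[OF p]] mderiv_F[OF p'(1), of t] by (simp add: f_def)
    then have "\<bar>det (M p)\<bar> = abs_det_on (g p) (g (f p)) (mderiv A f p) (F p)"
      unfolding M_def by (rule det_basis_matrix[OF ip e[OF p] h d ip linD])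
    \<comment> \<open>Sectional expansion is applied to the whole fibre, whose dimension
      \<open>d\<close> is at least 2.\<close>
    also have "\<dots> \<ge> a" unfolding f_def t_def
      by (rule expand[OF p'(1) subspace_F[OF p'(1)] order_refl]) (use p' x0 in \<open>simp add: d_def\<close>)
    finally show "\<bar>det (M p)\<bar> \<ge> a" .
  next
    fix p y z assume p: "p \<in> \<Lambda>d" and yz: "y \<in> ball p \<delta>" "z \<in> ball p \<delta>"
    have "y \<in> ball p \<delta>3" "z \<in> ball p \<delta>3" using yz ball\<delta>(3) by blast+
    then show "norm (P p y - P p z) \<le> 1" unfolding normP[OF p] by (rule bdd[OF subsetD[OF sub p]])
  next
    show "continuous_on (ball p \<delta>) (P p)" if "p \<in> \<Lambda>d" for p by (rule Pcont[OF that])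
    show "vec_nth (P p y) j = 0" if "p \<in> \<Lambda>d" "j \<notin> I" for p y j using that by (simp add: P_def basis_coord_def I_def)
    show "vec_nth (M p *v b) j = 0" if "p \<in> \<Lambda>d" "\<And>i. i \<notin> I \<Longrightarrow> vec_nth b i = 0" "j \<notin> I" for p b j
      unfolding M_def by (rule basis_matrix_block(1)) (use that in \<open>simp_all add: I_def\<close>)
    show "M p *v b = b" if "p \<in> \<Lambda>d" "\<And>i. i \<in> I \<Longrightarrow> vec_nth b i = 0" for p b
      unfolding M_def by (rule basis_matrix_block(2)) (use that in \<open>simp add: I_def\<close>)
  next
    fix U assume U: "open U" "x0 \<in> U"
    have x0d: "x0 \<in> \<Lambda>d" using x0 by (simp add: \<Lambda>d_def d_def)
    define c where "c = \<kappa> x0"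
    have c: "c \<in> A" "x0 \<in> chart_dom c" unfolding c_def by (rule \<kappa>)+
    define c0 where "c0 = coord c x0"
    have "open (coord c ` (chart_dom c \<inter> (U \<inter> ball x0 \<delta>)))" using c U by (intro open_coord_image) auto
    moreover have "c0 \<in> coord c ` (chart_dom c \<inter> (U \<inter> ball x0 \<delta>))" unfolding c0_def using c U \<delta> by auto
    ultimately obtain r1 where r1: "r1 > 0" "cball c0 r1 \<subseteq> coord c ` (chart_dom c \<inter> (U \<inter> ball x0 \<delta>))"
      using open_contains_cball by blast
    \<comment> \<open>\<open>V\<close> is the fibre of \<open>x0\<close> in chart coordinates. The
      disc is a piece of the affine plane through \<open>c0\<close> in this direction, so
      differences of its points have no component in \<open>E\<close> and lie in the cone.\<close>
    define V where "V = {v. from_chart c x0 v \<in> F x0}"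
    have "subspace V" unfolding V_def
      using linear_subspace_vimage[OF from_chart_linear[OF c] subspace_F[OF x0(1)]] by (simp add: vimage_def)
    define B where "B = cball c0 r1 \<inter> (\<lambda>v. c0 + v) ` V"
    define D where "D = coord_inv c ` B"
    have "compact B" unfolding B_def
      using closed_translation[OF closed_subspace[OF \<open>subspace V\<close>], of c0] by (simp add: compact_Int_closed)
    have B_im: "B \<subseteq> chart_im c" using r1(2) by (auto simp: B_def)
    have "compact D" unfolding D_def
      using \<open>compact B\<close> continuous_on_subset[OF cont_coord_inv[OF c(1)] B_im] by (rule compact_continuous_image[rotated])
    have D_sub: "D \<subseteq> U \<inter> ball x0 \<delta>"
    proof
      fix y assume "y \<in> D"
      then obtain p where p: "p \<in> cball c0 r1" "y = coord_inv c p" by (auto simp: D_def B_def)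
      then obtain y' where "y' \<in> chart_dom c" "y' \<in> U \<inter> ball x0 \<delta>" "p = coord c y'" using r1(2) by blast
      then show "y \<in> U \<inter> ball x0 \<delta>" using p(2) coord_inv_coord[OF c(1), of y'] by simp
    qed
    have projV: "projF x0 (from_chart c x0 v) = from_chart c x0 v" if "v \<in> V" for v
      using projF_id[OF x0(1)] that by (simp add: V_def)
    have "cone x0 y z" if yz: "y \<in> D" "z \<in> D" for y z
    proof -
      obtain v w where vw: "v \<in> V" "w \<in> V" "c0 + v \<in> B" "c0 + w \<in> B" "y = coord_inv c (c0 + v)" "z = coord_inv c (c0 + w)"
        using yz unfolding D_def B_def by blast
      have "coord c y = c0 + v" "coord c z = c0 + w"
        unfolding vw(5,6) by (rule coord_coord_inv[OF subsetD[OF B_im vw(3)]] coord_coord_inv[OF subsetD[OF B_im vw(4)]])+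
      then have "coord c y - coord c z = v - w" by simp
      moreover have "v - w \<in> V" by (rule subspace_diff[OF \<open>subspace V\<close> vw(1,2)])
      ultimately have "nE c x0 (coord c y - coord c z) = 0" unfolding nE_def using projV gnorm_0 by simp
      moreover have "nF c x0 (coord c y - coord c z) \<ge> 0" unfolding nF_def by (rule gnorm_nonneg)
      ultimately show ?thesis unfolding cone_def c_def by simp
    qed
    \<comment> \<open>A right inverse of the coordinates \<open>P x0\<close> along the disc. Its
      bound \<open>K\<close> converts the chart radius \<open>r1\<close> into the coordinate radius
      \<open>r1 / K\<close>.\<close>
    moreover define lift where "lift b = to_chart c x0 (\<Sum>j\<in>UNIV. (vec_nth b j) *\<^sub>R (if h j < d then e x0 (h j) else 0))" for b :: "real^'n bit0"
    have "linear lift"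
    proof -
      have "linear (\<lambda>b :: real^'n bit0. \<Sum>j\<in>UNIV. (vec_nth b j) *\<^sub>R (if h j < d then e x0 (h j) else 0))"
        by (rule linearI) (simp_all add: scaleR_left_distrib sum.distrib scaleR_sum_right)
      from linear_compose[OF this to_chart_linear[OF c]] show ?thesis by (simp add: lift_def[abs_def] o_def)
    qed
    then obtain K where K: "K > 0" "\<And>b. norm (lift b) \<le> K * norm b" using linear_bounded_pos by blast
    have "P x0 x0 + b \<in> P x0 ` D" if b: "\<forall>j. j \<notin> I \<longrightarrow> vec_nth b j = 0" "norm b \<le> r1 / K" for b
    proof -
      have b': "\<not> h j < d \<Longrightarrow> vec_nth b j = 0" for j using b(1) by (simp add: I_def)
      let ?u = "\<Sum>j\<in>UNIV. (vec_nth b j) *\<^sub>R (if h j < d then e x0 (h j) else 0)"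
      have u: "?u \<in> F x0" by (rule basis_coord_span[OF ip e[OF x0d] h d b'])
      have fl: "from_chart c x0 (lift b) = ?u" unfolding lift_def by (rule from_to_chart[OF c])
      have "lift b \<in> V" using u fl by (simp add: V_def)
      moreover have "norm (lift b) \<le> r1"
      proof -
        have "K * norm b \<le> r1" using b(2) K(1) by (simp add: field_simps)
        then show ?thesis using K(2)[of b] by linarith
      qed
      ultimately have inB: "c0 + lift b \<in> B" by (simp add: B_def dist_norm)
      then have "coord_inv c (c0 + lift b) \<in> D" unfolding D_def by (rule imageI)
      moreover have "P x0 (coord_inv c (c0 + lift b)) = P x0 x0 + b"
      proof -
        have co: "coord c (coord_inv c (c0 + lift b)) = c0 + lift b" by (rule coord_coord_inv[OF subsetD[OF B_im inB]])
        have "P x0 (coord_inv c (c0 + lift b)) - P x0 x0 = basis_coord (g x0) (e x0) h d (projF x0 (from_chart c x0 (lift b)))"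
          unfolding Pdiff[OF x0d] c_def[symmetric] co by (simp add: c0_def)
        also have "\<dots> = b" unfolding fl projF_id[OF x0(1) u] by (rule basis_coord_surj[OF ip e[OF x0d] h d b'])
        finally show ?thesis by (simp add: algebra_simps)
      qed
      ultimately show ?thesis by force
    qed
    ultimately show "\<exists>D r c. compact D \<and> D \<subseteq> U \<and> D \<subseteq> ball x0 \<delta> \<and> (\<forall>y\<in>D. \<forall>z\<in>D. cone x0 y z) \<and> r > 0 \<and>
      (\<forall>b. (\<forall>j. j \<notin> I \<longrightarrow> vec_nth b j = 0) \<longrightarrow> norm b \<le> r \<longrightarrow> c + b \<in> P x0 ` D)"
      using \<open>compact D\<close> D_sub r1(1) K(1) by (intro exI[of _ D] exI[of _ "r1 / K"] exI[of _ "P x0 x0"]) auto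
  qed
  interpret ce: cone_expansion f \<Lambda> \<Lambda>d \<delta> a P M cone I x0 by (rule ce)
  have "topological_entropy (\<phi> 1) \<Lambda> \<ge> ereal (ln ce.\<beta> / real N)"
  proof (rule topological_entropy_ge[OF N _ ce.\<beta>_pos])
    show "f = \<phi> 1 ^^ N" by (rule ext) (simp add: f_def t_def flow_funpow)
    show "\<delta> / 4 > 0" using \<delta> by simp
    show "\<exists>S. finite S \<and> S \<subseteq> \<Lambda> \<and> separated f m (\<delta> / 4) S \<and> ce.\<beta> ^ m \<le> real (card S)" if "m > 0" for m
      by (rule ce.many_separated[OF that])
  qed
  then show ?thesis by (simp add: ce.\<beta>_def)
qed

end

text \<open>A fibre of dimension at least 2 excludes the vacuous case: if every fibre had dimension
  at most 1, sectional expansion would hold for every positive \<open>lam\<close>.\<close>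

theorem theorem3:
  fixes A :: "('m::metric_space, 'n::finite) chart set"
    and g :: "'m \<Rightarrow> real^'n \<Rightarrow> real^'n \<Rightarrow> real"
    and X :: "'m \<Rightarrow> real^'n"
    and \<phi> :: "real \<Rightarrow> 'm \<Rightarrow> 'm"
    and \<Lambda> :: "'m set"
    and Es Fcu :: "'m \<Rightarrow> (real^'n) set"
    and lam :: real
  assumes "compact_riemannian_manifold A g"
    and "C1_vector_field A X"
    and "flow_of A X \<phi>"
    and "compact_invariant \<phi> \<Lambda>"
    and "sectional_hyperbolic A g \<phi> \<Lambda> Es Fcu lam"
    and "\<exists>x\<in>\<Lambda>. dim (Fcu x) \<ge> 2"
    and "\<forall>x\<in>\<Lambda>. X x = 0 \<longrightarrow> hyperbolic_singularity A X x"
    and "lyapunov_stable \<phi> \<Lambda>"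
  shows "flow_entropy \<phi> \<Lambda> \<ge> ereal lam \<and> lam > 0"
proof -
  have man: "smooth_atlas A" "riemannian_metric A g" "compact (UNIV :: 'm set)"
    using assms(1) unfolding compact_riemannian_manifold_def by blast+
  have ds: "dominated_splitting A g \<phi> \<Lambda> Es Fcu" and se: "sectional_expanding A g \<phi> \<Lambda> Fcu lam"
    using assms(5) unfolding sectional_hyperbolic_def by blast+
  interpret splitting A X \<phi> g \<Lambda> Es Fcu
    by unfold_locales (use man assms ds in auto)
  have lam: "lam > 0" using se unfolding sectional_expanding_def by blast
  obtain C where C: "C > 0" "\<forall>x\<in>\<Lambda>. \<forall>V. subspace V \<and> V \<subseteq> Fcu x \<and> dim V \<ge> 2 \<longrightarrow>
        (\<forall>t>0. abs_det_on (g x) (g (\<phi> t x)) (mderiv A (\<phi> t) x) V \<ge> C * exp (lam * t))"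
    using se unfolding sectional_expanding_def by blast
  obtain C' \<mu> where \<mu>: "C' > 0" "0 < \<mu>" "\<mu> < 1" "\<forall>x\<in>\<Lambda>. \<forall>u\<in>Es x. \<forall>v\<in>Fcu x. \<forall>t>0. gnorm g x u = 1 \<longrightarrow> gnorm g x v = 1 \<longrightarrow>
           gnorm g (\<phi> t x) (mderiv A (\<phi> t) x u) \<le>
             C' * \<mu> powr t * gnorm g (\<phi> t x) (mderiv A (\<phi> t) x v)"
    using ds unfolding dominated_splitting_def by blast
  obtain x0 where x0: "x0 \<in> \<Lambda>" "dim (Fcu x0) \<ge> 2" using assms(6) by blast
  \<comment> \<open>The bound obtained from time \<open>N\<close>: the multiplicative constants
    contribute a logarithm divided by \<open>N\<close>.\<close>
  define L where "L N = lam + ln (C / 4 ^ (2 * CARD('n))) / real N" for N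
  have "(\<lambda>N. C' * \<mu> ^ N) \<longlonglongrightarrow> C' * 0" using \<mu> by (intro tendsto_mult tendsto_const LIMSEQ_realpow_zero) auto
  \<comment> \<open>For large \<open>N\<close> the contraction ratio beats the constant, as
    \<open>dominates_at\<close> requires.\<close>
  then have "\<forall>\<^sub>F N in sequentially. C' * \<mu> ^ N < 1" by (intro order_tendstoD(2)) auto
  then have "\<forall>\<^sub>F N in sequentially. ereal (L N) \<le> topological_entropy (\<phi> 1) \<Lambda>"
    using eventually_gt_at_top[of 0]
  proof eventually_elim
    case (elim N)
    have "dominates_at (real N)"
      unfolding dominates_at_def
    proof (intro exI[of _ "C' * \<mu> powr real N"] conjI ballI impI)
      show "C' * \<mu> powr real N < 1" using elim \<mu>(2) by (simp add: powr_realpow)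
    qed (use \<mu>(4) elim in simp)
    moreover have "C * exp (lam * real N) \<le> abs_det_on (g x) (g (\<phi> (real N) x)) (mderiv A (\<phi> (real N)) x) V"
      if "x \<in> \<Lambda>" "subspace V" "V \<subseteq> Fcu x" "dim V \<ge> 2" for x V
      using C(2) that elim(2) by simp
    ultimately have "ereal (ln (C * exp (lam * real N) / 4 ^ (2 * CARD('n))) / real N) \<le> topological_entropy (\<phi> 1) \<Lambda>"
      using C(1) by (intro entropy_estimate[OF elim(2) _ assms(8) x0]) auto
    moreover have "ln (C * exp (lam * real N) / 4 ^ (2 * CARD('n))) / real N = L N"
    proof -
      have "C * exp (lam * real N) / 4 ^ (2 * CARD('n)) = exp (lam * real N) * (C / 4 ^ (2 * CARD('n)))" by simp
      also have "ln \<dots> = lam * real N + ln (C / 4 ^ (2 * CARD('n)))" using C(1) by (subst ln_mult_pos) auto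
      finally show ?thesis using elim(2) by (simp add: L_def add_divide_distrib)
    qed
    ultimately show ?case by simp
  qed
  \<comment> \<open>The error term vanishes in the limit, which recovers the full rate
    \<open>lam\<close>.\<close>
  moreover have "(\<lambda>N. ereal (L N)) \<longlonglongrightarrow> ereal (lam + 0)"
    unfolding L_def by (intro tendsto_ereal tendsto_add tendsto_const real_tendsto_divide_at_top[OF tendsto_const] filterlim_real_sequentially)
  ultimately have "ereal (lam + 0) \<le> topological_entropy (\<phi> 1) \<Lambda>"
    by (intro tendsto_upperbound) auto
  then show ?thesis using lam by (simp add: flow_entropy_def)
qed

end
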